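(* For every integer $d>2$ and every $k\in\mathbb{N}$ there is a constant $\epsilon>0$, depending only on $k$ and $d$, such that the following holds. Let $\Gamma\le \mathrm{Isom}(\mathbb{H}^d)$ be a lattice, let $\mathcal{P}$ be a Dirichlet polyhedron for $\Gamma$ having exactly $k$ faces of dimension $d-1$, let $\mathcal{T}=\{\gamma\mathcal{P}:\gamma\in\Gamma\}$ be the associated tiling of $\mathbb{H}^d$, and let $\mathcal{G}$ be the dual graph of $\mathcal{T}$ (which is $k$-regular). Then $$gr(\mathcal{G})<k-1-\epsilon .$$
   Context: $\mathbb{H}^d$ is the $d$-dimensional hyperbolic (Lobachevsky) space and $\mathrm{Isom}(\mathbb{H}^d)$ is its full group of isometries. A lattice $\Gamma\le\mathrm{Isom}(\mathbb{H}^d)$ is a discrete subgroup of finite covolume; it may be cocompact or not, and it may have torsion. A Dirichlet polyhedron for $\Gamma$ is a set of the form $\mathcal{P}=\{x\in\mathbb{H}^d: \mathrm{dist}(x,p)\le \mathrm{dist}(x,\gamma p)\ \text{for all }\gamma\in\Gamma\}$, where $p\in\mathbb{H}^d$ is a point with trivial stabilizer in $\Gamma$. It is a convex polyhedron of finite volume and a fundamental domain for $\Gamma$, and its translates $\gamma\mathcal{P}$, $\gamma\in\Gamma$, tile $\mathbb{H}^d$. The dual graph $\mathcal{G}$ of the tiling $\mathcal{T}$ has one vertex for each tile, and two distinct vertices are joined by an edge if and only if the corresponding tiles share a $(d-1)$-dimensional face. Equivalently, $\mathcal{G}$ is the Cayley graph $\mathrm{Cay}(\Gamma,S)$ of $\Gamma$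 with respect to the generating set $S=\{\gamma\in\Gamma:\gamma\mathcal{P}\ \text{is adjacent to}\ \mathcal{P}\}$, where adjacent means distinct and sharing a $(d-1)$-dimensional face. The growth rate is $gr(\mathcal{G})=\lim_{r\to\infty}|B(r)|^{1/r}$, where $|B(r)|$ is the number of vertices in a ball of radius $r$ in $\mathcal{G}$ for the graph metric (independent of the center, since $\mathcal{G}$ is vertex-transitive). The limit exists by submultiplicativity. *)

theory Defs
  imports "HOL-Analysis.Analysis" "HOL-Algebra.Bij"
begin

text \<open>
  Hyperbolic d-space in the Beltrami--Klein model: the open unit ball of a Euclidean space
  of dimension d. Hyperbolic geodesic segments are the Euclidean ones, so hyperbolic convexity,
  faces and their dimensions are given by \<^const>\<open>convex\<close>, \<^const>\<open>face_of\<close> and \<^const>\<open>aff_dim\<close>.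
\<close>

abbreviation hyp_space :: "'a::euclidean_space set" where
  "hyp_space \<equiv> ball 0 1"

definition hdist :: "'a::euclidean_space \<Rightarrow> 'a \<Rightarrow> real" where
  "hdist x y = arcosh ((1 - x \<bullet> y) / (sqrt (1 - (norm x)\<^sup>2) * sqrt (1 - (norm y)\<^sup>2)))"

text \<open>
  The Riemannian volume. The Klein metric has Gram matrix
  \<open>I / (1 - |x|\<^sup>2) + x x\<^sup>T / (1 - |x|\<^sup>2)\<^sup>2\<close>, whose determinant is \<open>(1 - |x|\<^sup>2)\<close> to the power \<open>- (d + 1)\<close>.
\<close>

definition hvol :: "'a::euclidean_space measure" where
  "hvol = density lborel (\<lambda>x. indicator hyp_space x *
     ennreal ((1 - (norm x)\<^sup>2) powr (- (real DIM('a) + 1) / 2)))"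

lemma subgroup_distance_preserving:
  fixes h :: "'a \<Rightarrow> 'a \<Rightarrow> real"
  shows "subgroup {f \<in> Bij S. \<forall>x\<in>S. \<forall>y\<in>S. h (f x) (f y) = h x y} (BijGroup S)" (is "subgroup ?I _")
proof (rule group.subgroupI[OF group_BijGroup])
  show "?I \<subseteq> carrier (BijGroup S)"
    by (auto simp: BijGroup_def)
  have "(\<lambda>x\<in>S. x) \<in> ?I" using id_Bij by auto
  then show "?I \<noteq> {}" by blast
next
  fix f assume f: "f \<in> ?I"
  then have fB: "f \<in> Bij S" by simp
  then have im: "f ` S = S" by (simp add: Bij_def bij_betw_def)
  have "h (inv_into S f x) (inv_into S f y) = h x y" if "x \<in> S" "y \<in> S" for x y
  proof -
    have "inv_into S f x \<in> S" "inv_into S f y \<in> S" using that im by (simp_all add: inv_into_into)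
    then have "h (f (inv_into S f x)) (f (inv_into S f y)) = h (inv_into S f x) (inv_into S f y)"
      using f by blast
    then show ?thesis using that im by (simp add: f_inv_into_f)
  qed
  then show "inv\<^bsub>BijGroup S\<^esub> f \<in> ?I"
    using restrict_inv_into_Bij[OF fB] by (simp add: inv_BijGroup[OF fB])
next
  fix f g assume f: "f \<in> ?I" and g: "g \<in> ?I"
  then have "g x \<in> S" if "x \<in> S" for x
    using that by (auto simp: Bij_def bij_betw_def)
  then show "f \<otimes>\<^bsub>BijGroup S\<^esub> g \<in> ?I"
    using f g compose_Bij[of f S g] by (simp add: BijGroup_def compose_eq)
qed

text \<open>
  The isometry group. As in \<^const>\<open>BijGroup\<close>, maps are extensional: they take the value
  \<^const>\<open>undefined\<close> outside the ball, so distinct group elements are distinct maps of the space.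
\<close>

definition hyp_isom :: "('a::euclidean_space \<Rightarrow> 'a) set" where
  "hyp_isom = {f \<in> Bij hyp_space.
     \<forall>x\<in>hyp_space. \<forall>y\<in>hyp_space. hdist (f x) (f y) = hdist x y}"

definition Isom :: "('a::euclidean_space \<Rightarrow> 'a) monoid" where
  "Isom = (BijGroup hyp_space)\<lparr>carrier := hyp_isom\<rparr>"

lemma group_Isom: "group (Isom :: ('a::euclidean_space \<Rightarrow> 'a) monoid)"
  unfolding Isom_def hyp_isom_def
  by (rule group.subgroup_imp_group[OF group_BijGroup subgroup_distance_preserving])

text \<open>
  Discreteness refers to the topology of pointwise convergence, which on a group of isometries
  is the compact-open topology. The metric \<^const>\<open>hdist\<close> induces the Euclidean topology on the ball.
\<close>

definition discrete_isometries :: "('a::euclidean_space \<Rightarrow> 'a) set \<Rightarrow> bool" where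
  "discrete_isometries \<Gamma> \<longleftrightarrow>
     subtopology (product_topology (\<lambda>_. top_of_set hyp_space) hyp_space) \<Gamma> = discrete_topology \<Gamma>"

definition fundamental_set :: "('a::euclidean_space \<Rightarrow> 'a) set \<Rightarrow> 'a set \<Rightarrow> bool" where
  "fundamental_set \<Gamma> D \<longleftrightarrow> D \<in> sets hvol \<and> D \<subseteq> hyp_space \<and> (\<Union>\<gamma>\<in>\<Gamma>. \<gamma> ` D) = hyp_space \<and>
     (\<forall>\<gamma>\<in>\<Gamma>. \<gamma> \<noteq> \<one>\<^bsub>Isom\<^esub> \<longrightarrow> emeasure hvol (\<gamma> ` D \<inter> D) = 0)"

definition hyp_lattice :: "('a::euclidean_space \<Rightarrow> 'a) set \<Rightarrow> bool" where
  "hyp_lattice \<Gamma> \<longleftrightarrow> subgroup \<Gamma> Isom \<and> discrete_isometries \<Gamma> \<and>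
     (\<exists>D. fundamental_set \<Gamma> D \<and> emeasure hvol D < \<infinity>)"

definition dirichlet_polyhedron :: "('a::euclidean_space \<Rightarrow> 'a) set \<Rightarrow> 'a set \<Rightarrow> bool" where
  "dirichlet_polyhedron \<Gamma> P \<longleftrightarrow> (\<exists>p\<in>hyp_space. {\<gamma> \<in> \<Gamma>. \<gamma> p = p} = {\<one>\<^bsub>Isom\<^esub>} \<and>
     P = {x \<in> hyp_space. \<forall>\<gamma>\<in>\<Gamma>. hdist x p \<le> hdist x (\<gamma> p)})"

definition hfacets :: "'a::euclidean_space set \<Rightarrow> 'a set set" where
  "hfacets P = {F. F face_of P \<and> aff_dim F = int DIM('a) - 1}"

definition tiling :: "('a::euclidean_space \<Rightarrow> 'a) set \<Rightarrow> 'a set \<Rightarrow> 'a set set" where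
  "tiling \<Gamma> P = (\<lambda>\<gamma>. \<gamma> ` P) ` \<Gamma>"

text \<open>A graph is given by its vertex set and its symmetric irreflexive edge relation.\<close>

definition dual_edges :: "'a::euclidean_space set set \<Rightarrow> ('a set \<times> 'a set) set" where
  "dual_edges \<T> = {(A, B). A \<in> \<T> \<and> B \<in> \<T> \<and> A \<noteq> B \<and> hfacets A \<inter> hfacets B \<noteq> {}}"

definition graph_dist :: "('v \<times> 'v) set \<Rightarrow> 'v \<Rightarrow> 'v \<Rightarrow> enat" where
  "graph_dist E u v = (INF n\<in>{n. (u, v) \<in> E ^^ n}. enat n)"

definition graph_ball :: "'v set \<Rightarrow> ('v \<times> 'v) set \<Rightarrow> 'v \<Rightarrow> nat \<Rightarrow> 'v set" where
  "graph_ball V E u r = {v \<in> V. graph_dist E u v \<le> enat r}"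

text \<open>The centre is a parameter; the value does not depend on it when the graph is vertex-transitive.\<close>

definition growth_rate :: "'v set \<Rightarrow> ('v \<times> 'v) set \<Rightarrow> 'v \<Rightarrow> real" where
  "growth_rate V E u = lim (\<lambda>r. root r (real (card (graph_ball V E u r))))"

end

theory Submission
  imports Defs
begin

text \<open>
  The hyperboloid model turns the Klein ball into rays of a Lorentzian space in which isometries
  are linear, bisectors are hyperplanes orthogonal to differences of centres, and the volume of a set is
  that of a truncated cone. Finite covolume forces the hull of the \<open>k\<close> facet half-spaces to be a polytope
  inside the closed ball. As \<open>d > 2\<close>, it has a face of codimension 3, possibly an ideal vertex,
  and three ridges through that face that are not coplanar. The normals of the planes spanned by these
  ridges are unit vectors on which the Lorentz form is positive semidefinite, so some two of them have inner
  product at least \<open>- 1 / 2\<close>: one of the ridges has dihedral angle at least \<open>\<pi> / 3\<close>.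
  The tiles around a point of this ridge fall into at most \<open>k\<^sup>2\<close> types, and each type occurs at
  most 25 times, since isometries of a plane move the wide wedge to wedges with disjoint interiors.
  Hence every tile lies in a set of at most \<open>25 * k\<^sup>2\<close> tiles each of which has two neighbours in the set.
  A breadth-first tree of the dual graph can then not branch fully for \<open>25 * k\<^sup>2\<close> generations below
  any vertex, which bounds the growth rate away from \<open>k - 1\<close>.
\<close>

section \<open>Growth of graphs of bounded degree\<close>

text \<open>The condition d > 2 is about ideal points. In the hyperbolic plane a ridge is a vertex,
  which may be ideal; the reflections in the sides of an ideal triangle have a 3-regular tree as
  dual graph, whose growth is exactly k - 1. For d > 2 a ridge has positive dimension, so its
  relative interior lies in the open ball, where a point belongs to finitely many tiles, even if the
  face of codimension 3 is ideal. Finiteness alone does not suffice, since the bound may depend on k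
  only and dihedral angles can be arbitrarily small. One wide wedge is available, but the tiles at
  the ridge may appear there with narrow wedges. The remedy is to apply the isometries between tiles
  of one type not to these tiles but to the wide wedge: such an isometry need not fix
  \<open>x\<close>, yet it preserves the plane of normals, and the images of the middle of the wedge
  are unit vectors of that plane at mutual distance at least 1. Squares of side 1/2, five in each
  direction, separate them; this is the origin of 25.\<close>

lemma convergent_root_submultiplicative:
  fixes b :: "nat \<Rightarrow> real"
  assumes b1: "\<And>n. 1 \<le> b n" and sub: "\<And>m n. b (m + n) \<le> b m * b n"
  shows "convergent (\<lambda>n. root n (b n))"
proof -
  define x where "x n = ln (b n) / real n" for n
  define L where "L = Inf (x ` {1..})"
  have lnb: "0 \<le> ln (b n)" for n using b1 by simp
  have x0: "0 \<le> x n" for n using lnb by (simp add: x_def)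
  have bdd: "bdd_below (x ` {1..})" using x0 by (auto intro!: bdd_belowI2[where m=0])
  have subl: "ln (b (m + n)) \<le> ln (b m) + ln (b n)" for m n
  proof -
    have p: "0 < b i" for i using b1[of i] by linarith
    have "ln (b (m + n)) \<le> ln (b m * b n)" using sub p by simp
    also have "ln (b m * b n) = ln (b m) + ln (b n)" using p[of m] p[of n] by (intro ln_mult_pos) auto
    finally show ?thesis .
  qed
  have mult: "ln (b (q * m + r)) \<le> real q * ln (b m) + ln (b r)" for q m r
  proof (induction q)
    case (Suc q)
    have "ln (b (Suc q * m + r)) \<le> ln (b m) + ln (b (q * m + r))"
      using subl[of m "q * m + r"] by (simp add: add.assoc)
    then show ?case using Suc by (simp add: algebra_simps)
  qed simp
  \<comment> \<open>Fekete's argument: division of \<open>n\<close> by a fixed \<open>m\<close> with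
    \<open>x m\<close> near the infimum leaves a remainder term bounded by \<open>M\<close>, whose
    share \<open>M / n\<close> vanishes. Convergence matters because \<open>growth_rate\<close> is
    defined by \<open>lim\<close>, which says nothing about divergent sequences.\<close>
  have "x \<longlonglongrightarrow> L"
  proof (rule LIMSEQ_I)
    fix e :: real assume e: "e > 0"
    have "\<exists>m\<in>{1..}. x m < L + e/2"
      using cInf_lessD[of "x ` {1..}" "L + e/2"] e by (auto simp: L_def)
    then obtain m where m: "m \<ge> 1" "x m < L + e/2" by auto
    define M where "M = (\<Sum>r<m. ln (b r))"
    have M: "ln (b r) \<le> M" if "r < m" for r
      unfolding M_def by (rule member_le_sum) (use that lnb in auto)
    have M0: "0 \<le> M" unfolding M_def using lnb by (simp add: sum_nonneg)
    obtain K :: nat where K: "2 * M / e < real K" using reals_Archimedean2 by blast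
    have "norm (x n - L) < e" if n: "n \<ge> Suc K" for n
    proof -
      have n0: "real n > 0" using n by simp
      have "L \<le> x n" unfolding L_def using n by (intro cInf_lower bdd) auto
      moreover have "x n < L + e"
      proof -
        have "ln (b n) \<le> real (n div m) * ln (b m) + ln (b (n mod m))"
          using mult[of "n div m" m "n mod m"] by simp
        also have "\<dots> \<le> real (n div m) * (real m * x m) + M"
        proof -
          have "real m * x m = ln (b m)" using m by (simp add: x_def)
          then show ?thesis using M[of "n mod m"] m by simp
        qed
        also have "\<dots> \<le> real n * x m + M"
        proof -
          have "(n div m) * m \<le> n" by simp
          then have "real (n div m) * real m \<le> real n" by (metis of_nat_le_iff of_nat_mult)
          then have "real (n div m) * real m * x m \<le> real n * x m" using x0[of m] by (rule mult_right_mono)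
            then show ?thesis by (simp only: mult.assoc add_le_cancel_right)
        qed
        finally have "x n \<le> x m + M / real n"
          using n0 by (simp add: x_def field_simps)
        moreover have "M / real n < e/2"
        proof -
          have "2 * M < e * real K" using K e by (simp add: field_simps)
          also have "\<dots> \<le> e * real n" using n e by simp
          finally show ?thesis using n0 by (simp add: field_simps)
        qed
        ultimately show ?thesis using m by linarith
      qed
      ultimately show ?thesis by simp
    qed
    then show "\<exists>no. \<forall>n\<ge>no. norm (x n - L) < e" by blast
  qed
  then have "(\<lambda>n. exp (x n)) \<longlonglongrightarrow> exp L" by (rule tendsto_exp)
  moreover have "\<forall>\<^sub>F n in sequentially. exp (x n) = root n (b n)"
  proof (rule eventually_sequentiallyI[of 1])
    fix n :: nat assume "1 \<le> n"
    moreover have "0 < b n" using b1[of n] by linarith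
    ultimately show "exp (x n) = root n (b n)"
      by (simp add: x_def root_powr_inverse powr_def)
  qed
  ultimately have "(\<lambda>n. root n (b n)) \<longlonglongrightarrow> exp L"
    by (rule Lim_transform_eventually)
  then show ?thesis by (rule convergentI)
qed

lemma graph_ball_eq: "graph_ball V E u r = {v \<in> V. \<exists>n\<le>r. (u, v) \<in> E ^^ n}"
proof -
  have "graph_dist E u v \<le> enat r \<longleftrightarrow> (\<exists>n\<le>r. (u, v) \<in> E ^^ n)" for v
  proof
    assume le: "graph_dist E u v \<le> enat r"
    show "\<exists>n\<le>r. (u, v) \<in> E ^^ n"
    proof (rule ccontr)
      assume "\<not> ?thesis"
      then have "enat (Suc r) \<le> graph_dist E u v"
        unfolding graph_dist_def by (intro INF_greatest) (auto simp: not_less_eq_eq)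
      from order_trans[OF this le] have "enat (Suc r) \<le> enat r" .
      then show False by simp
    qed
  next
    assume "\<exists>n\<le>r. (u, v) \<in> E ^^ n"
    then obtain n where "n \<le> r" "(u, v) \<in> E ^^ n" by blast
    then show "graph_dist E u v \<le> enat r"
      unfolding graph_dist_def by (intro INF_lower2[of n]) auto
  qed
  then show ?thesis by (simp add: graph_ball_def)
qed

section \<open>Spheres and the breadth-first tree\<close>

definition graph_sphere :: "('v \<times> 'v) set \<Rightarrow> 'v \<Rightarrow> nat \<Rightarrow> 'v set" where
  "graph_sphere E u n = {v. (u, v) \<in> E ^^ n \<and> (\<forall>m<n. (u, v) \<notin> E ^^ m)}"

text \<open>A vertex may have several neighbours in the previous sphere; choosing one of them turns
  the spheres into the levels of a tree.\<close>

definition bfs_parent :: "('v \<times> 'v) set \<Rightarrow> 'v \<Rightarrow> nat \<Rightarrow> 'v \<Rightarrow> 'v" where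
  "bfs_parent E u n w = (SOME v. v \<in> graph_sphere E u n \<and> (v, w) \<in> E)"

primrec descendants :: "('v \<times> 'v) set \<Rightarrow> 'v \<Rightarrow> nat \<Rightarrow> nat \<Rightarrow> 'v \<Rightarrow> 'v set" where
  "descendants E u n 0 v = {v}"
| "descendants E u n (Suc m) v =
    (\<Union>c\<in>{w \<in> graph_sphere E u (Suc n). bfs_parent E u n w = v}. descendants E u (Suc n) m c)"

lemma bfs_parent:
  assumes "w \<in> graph_sphere E u (Suc n)"
  shows "bfs_parent E u n w \<in> graph_sphere E u n" "(bfs_parent E u n w, w) \<in> E"
proof -
  from assms obtain v where v: "(u, v) \<in> E ^^ n" "(v, w) \<in> E" by (auto simp: graph_sphere_def)
  have "(u, v) \<notin> E ^^ m" if "m < n" for m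
  proof
    assume "(u, v) \<in> E ^^ m"
    then have "(u, w) \<in> E ^^ Suc m" using v by auto
    then show False using assms that by (auto simp: graph_sphere_def simp del: relpow.simps)
  qed
  then have "\<exists>v. v \<in> graph_sphere E u n \<and> (v, w) \<in> E" using v by (auto simp: graph_sphere_def)
  from someI_ex[OF this] show "bfs_parent E u n w \<in> graph_sphere E u n" "(bfs_parent E u n w, w) \<in> E"
    by (auto simp: bfs_parent_def)
qed

lemma graph_sphere_disjoint:
  "\<lbrakk>v \<in> graph_sphere E u m; v \<in> graph_sphere E u n\<rbrakk> \<Longrightarrow> m = n"
  by (auto simp: graph_sphere_def) (metis linorder_neqE_nat)

lemma descendants_cover:
  "graph_sphere E u (n + m) \<subseteq> (\<Union>v\<in>graph_sphere E u n. descendants E u n m v)"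
proof (induction m arbitrary: n)
  case (Suc m)
  show ?case
  proof
    fix w assume "w \<in> graph_sphere E u (n + Suc m)"
    then have "w \<in> graph_sphere E u (Suc n + m)" by simp
    then obtain c where c: "c \<in> graph_sphere E u (Suc n)" "w \<in> descendants E u (Suc n) m c"
      using Suc by blast
    then show "w \<in> (\<Union>v\<in>graph_sphere E u n. descendants E u n (Suc m) v)"
      using bfs_parent(1)[OF c(1)] by auto
  qed
qed auto

locale bounded_degree_graph =
  fixes E :: "('v \<times> 'v) set" and k :: nat
  assumes sym_E: "sym E"
    and finite_neighbours: "finite (E `` {v})"
    and card_neighbours: "card (E `` {v}) \<le> k"
    and k3: "3 \<le> k"
begin

lemma finite_graph_sphere: "finite (graph_sphere E u n)"
proof (induction n)
  case 0
  then show ?case by (simp add: graph_sphere_def)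
next
  case (Suc n)
  have "graph_sphere E u (Suc n) \<subseteq> (\<Union>v\<in>graph_sphere E u n. E `` {v})"
    using bfs_parent by fastforce
  then show ?case using Suc finite_neighbours finite_subset by blast
qed

abbreviation children where
  "children u n v \<equiv> {w \<in> graph_sphere E u (Suc n). bfs_parent E u n w = v}"

lemma children_subset:
  assumes "v \<in> graph_sphere E u (Suc n)"
  shows "children u (Suc n) v \<subseteq> E `` {v} - {bfs_parent E u n v}"
proof
  fix w assume w: "w \<in> children u (Suc n) v"
  have "bfs_parent E u n v \<in> graph_sphere E u n" using bfs_parent assms by metis
  with w have "w \<noteq> bfs_parent E u n v" using graph_sphere_disjoint[of w E u "Suc (Suc n)" n] by auto
  with w show "w \<in> E `` {v} - {bfs_parent E u n v}" using bfs_parent(2)[of w E u "Suc n"] by auto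
qed

lemma card_neighbours_minus_parent:
  assumes "v \<in> graph_sphere E u (Suc n)"
  shows "card (E `` {v} - {bfs_parent E u n v}) \<le> k - 1"
proof -
  have "bfs_parent E u n v \<in> E `` {v}"
    using bfs_parent(2)[OF assms] sym_E by (auto dest: symD)
  then show ?thesis using card_neighbours[of v] finite_neighbours[of v] by simp
qed

lemma finite_descendants: "finite (descendants E u n m v)"
  by (induction m arbitrary: n v) (auto simp: finite_graph_sphere)

lemma card_descendants_Suc:
  "card (descendants E u n (Suc m) v) \<le> (\<Sum>c\<in>children u n v. card (descendants E u (Suc n) m c))"
  using finite_graph_sphere by (auto intro!: card_UN_le)

lemma card_descendants:
  assumes "v \<in> graph_sphere E u (Suc n)"
  shows "card (descendants E u (Suc n) m v) \<le> (k - 1) ^ m"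
  using assms
proof (induction m arbitrary: n v)
  case (Suc m)
  have "card (descendants E u (Suc n) (Suc m) v)
      \<le> (\<Sum>c\<in>children u (Suc n) v. card (descendants E u (Suc (Suc n)) m c))"
    by (rule card_descendants_Suc)
  also have "\<dots> \<le> (\<Sum>c\<in>children u (Suc n) v. (k - 1) ^ m)"
    using Suc.IH by (intro sum_mono) auto
  also have "\<dots> = card (children u (Suc n) v) * (k - 1) ^ m" by simp
  also have "card (children u (Suc n) v) \<le> k - 1"
    using card_mono[OF _ children_subset[OF Suc.prems]] card_neighbours_minus_parent[OF Suc.prems]
      finite_neighbours by (meson finite_Diff le_trans)
  finally show ?case by (simp add: mult_right_mono)
qed auto

text \<open>This is the equality case of \<open>card_descendants\<close>: the count is a sum over at
  most \<open>k - 1\<close> children with at most \<open>(k - 1) ^ m\<close> each, so no child can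
  be absent and no subtree deficient.\<close>

lemma full_descendants:
  assumes v: "v \<in> graph_sphere E u (Suc n)"
    and full: "(k - 1) ^ Suc m \<le> card (descendants E u (Suc n) (Suc m) v)"
  shows "children u (Suc n) v = E `` {v} - {bfs_parent E u n v}"
    and "\<And>c. c \<in> children u (Suc n) v \<Longrightarrow> (k - 1) ^ m \<le> card (descendants E u (Suc (Suc n)) m c)"
proof -
  let ?C = "children u (Suc n) v"
  have finC: "finite ?C" using finite_graph_sphere by simp
  have pos: "(k - 1) ^ m > 0" using k3 by simp
  have le: "card (descendants E u (Suc (Suc n)) m c) \<le> (k - 1) ^ m" if "c \<in> ?C" for c
    using card_descendants that by blast
  have sum: "(k - 1) ^ Suc m \<le> (\<Sum>c\<in>?C. card (descendants E u (Suc (Suc n)) m c))"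
    using full card_descendants_Suc le_trans by blast
  also have "\<dots> \<le> card ?C * (k - 1) ^ m"
    using sum_mono[of ?C, OF le] by simp
  finally have "(k - 1) * (k - 1) ^ m \<le> card ?C * (k - 1) ^ m" by simp
  then have "k - 1 \<le> card ?C" using pos by (simp only: mult_le_cancel2)
  then show "?C = E `` {v} - {bfs_parent E u n v}"
    using children_subset[OF v] card_neighbours_minus_parent[OF v] finite_neighbours
    by (intro card_seteq) auto
  then have cC: "card ?C \<le> k - 1" using card_neighbours_minus_parent[OF v] by simp
  show "(k - 1) ^ m \<le> card (descendants E u (Suc (Suc n)) m c)" if c: "c \<in> ?C" for c
  proof (rule ccontr)
    assume "\<not> ?thesis"
    then have "(\<Sum>c\<in>?C. card (descendants E u (Suc (Suc n)) m c)) < (\<Sum>c\<in>?C. (k - 1) ^ m)"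
      using c le finC by (intro sum_strict_mono_ex1) auto
    also have "\<dots> \<le> (k - 1) ^ Suc m" using cC by (simp add: mult_right_mono)
    finally show False using sum by simp
  qed
qed

text \<open>If no branch of the breadth-first tree below \<open>v\<close> is missing, then a walk inside \<open>C\<close> starting at
  \<open>v\<close> can always be continued away from the root, so that \<open>C\<close> meets every level.\<close>

lemma full_descendants_meet:
  assumes "v \<in> graph_sphere E u (Suc n)" "v \<in> C"
    and two: "\<And>c. c \<in> C \<Longrightarrow> \<exists>w1 w2. w1 \<noteq> w2 \<and> w1 \<in> C \<and> w2 \<in> C \<and> (c, w1) \<in> E \<and> (c, w2) \<in> E"
    and "(k - 1) ^ m \<le> card (descendants E u (Suc n) m v)" "j \<le> m"
  shows "C \<inter> graph_sphere E u (Suc n + j) \<noteq> {}"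
  using assms(1,2,4,5)
proof (induction m arbitrary: n v j)
  case (Suc m)
  show ?case
  proof (cases j)
    case (Suc j')
    \<comment> \<open>Of two distinct neighbours in \<open>C\<close> at most one is the
      parent.\<close>
    obtain w where w: "w \<in> C" "(v, w) \<in> E" "w \<noteq> bfs_parent E u n v"
      using two[OF Suc.prems(2)] by metis
    then have wc: "w \<in> children u (Suc n) v" using full_descendants(1)[OF Suc.prems(1,3)] by blast
    have "C \<inter> graph_sphere E u (Suc (Suc n) + j') \<noteq> {}"
      using wc w full_descendants(2)[OF Suc.prems(1,3) wc] Suc.prems Suc by (intro Suc.IH) auto
    then show ?thesis using Suc by simp
  qed (use Suc in auto)
qed auto

text \<open>A full tree of depth \<open>N\<close> would make \<open>C\<close> meet every level from
  \<open>Suc n\<close> to \<open>Suc n + N\<close>. These are \<open>N + 1\<close> disjoint spheres,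
  one more than \<open>C\<close> has elements for.\<close>

lemma card_descendants_less:
  assumes "v \<in> graph_sphere E u (Suc n)" "v \<in> C" "finite C" "card C \<le> N"
    and two: "\<And>c. c \<in> C \<Longrightarrow> \<exists>w1 w2. w1 \<noteq> w2 \<and> w1 \<in> C \<and> w2 \<in> C \<and> (c, w1) \<in> E \<and> (c, w2) \<in> E"
  shows "card (descendants E u (Suc n) N v) \<le> (k - 1) ^ N - 1"
proof (rule ccontr)
  assume "\<not> ?thesis"
  then have full: "(k - 1) ^ N \<le> card (descendants E u (Suc n) N v)" by linarith
  have "\<forall>j\<in>{..N}. \<exists>c. c \<in> C \<inter> graph_sphere E u (Suc n + j)"
    using full_descendants_meet[OF assms(1,2) two full] by blast
  then obtain f where f: "\<And>j. j \<le> N \<Longrightarrow> f j \<in> C \<inter> graph_sphere E u (Suc n + j)"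
    by (metis atMost_iff)
  have "inj_on f {..N}"
  proof (rule inj_onI)
    fix i j assume "i \<in> {..N}" "j \<in> {..N}" "f i = f j"
    then show "i = j" using f[of i] f[of j] graph_sphere_disjoint[of "f i" E u "Suc n + i" "Suc n + j"] by auto
  qed
  then have "card {..N} \<le> card C" using f assms(3) by (intro card_inj_on_le[of f]) auto
  then show False using assms(4) by simp
qed

end

text \<open>Below each vertex at least one of the \<open>(k - 1) ^ N\<close> possible branches is
  missing after \<open>N\<close> levels, so sphere sizes grow at most by the factor
  \<open>(k - 1) ^ N - 1\<close> per \<open>N\<close> levels. Equal ball sizes at all centres make
  them submultiplicative; hence the limit exists and may be computed along the radii
  \<open>r * N\<close>.\<close>

lemma (in bounded_degree_graph) growth_rate_bound:
  assumes EV: "E \<subseteq> V \<times> V" and u: "u \<in> V"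
    and trans: "\<And>v r. v \<in> V \<Longrightarrow> card (graph_ball V E v r) = card (graph_ball V E u r)"
    and N: "N > 0"
    and core: "\<And>v. v \<in> V \<Longrightarrow> \<exists>C. v \<in> C \<and> finite C \<and> card C \<le> N \<and>
      (\<forall>c\<in>C. \<exists>w1 w2. w1 \<noteq> w2 \<and> w1 \<in> C \<and> w2 \<in> C \<and> (c, w1) \<in> E \<and> (c, w2) \<in> E)"
  shows "growth_rate V E u \<le> root N (real ((k - 1) ^ N - 1))"
proof -
  define s where "s n = card (graph_sphere E u n)" for n
  define q where "q = (k - 1) ^ N - 1"
  define b where "b r = card (graph_ball V E u r)" for r
  have relV: "v \<in> V" if "(w, v) \<in> E ^^ n" "w \<in> V" for w v n
    using that EV by (cases n) auto
  have "(2::nat) ^ 1 \<le> (k - 1) ^ N"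
  proof -
    have "(2::nat) ^ 1 \<le> 2 ^ N" using N by (intro power_increasing) auto
    also have "\<dots> \<le> (k - 1) ^ N" using k3 by (intro power_mono) auto
    finally show ?thesis .
  qed
  then have q1: "1 \<le> q" by (simp add: q_def)
  \<comment> \<open>The estimate starts at the first sphere, because the root has no parent and may
    have \<open>k\<close> children.\<close>
  have step: "s (Suc n + N) \<le> q * s (Suc n)" for n
  proof -
    have "s (Suc n + N) \<le> card (\<Union>v\<in>graph_sphere E u (Suc n). descendants E u (Suc n) N v)"
      unfolding s_def by (intro card_mono descendants_cover) (auto simp: finite_descendants finite_graph_sphere)
    also have "\<dots> \<le> (\<Sum>v\<in>graph_sphere E u (Suc n). card (descendants E u (Suc n) N v))"
      by (intro card_UN_le finite_graph_sphere)
    also have "\<dots> \<le> (\<Sum>v\<in>graph_sphere E u (Suc n). q)"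
    proof (rule sum_mono)
      fix v assume v: "v \<in> graph_sphere E u (Suc n)"
      then have "v \<in> V" using relV u by (auto simp: graph_sphere_def simp del: relpow.simps)
      from core[OF this] obtain C where "v \<in> C" "finite C" "card C \<le> N"
        "\<And>c. c \<in> C \<Longrightarrow> \<exists>w1 w2. w1 \<noteq> w2 \<and> w1 \<in> C \<and> w2 \<in> C \<and> (c, w1) \<in> E \<and> (c, w2) \<in> E" by blast
      then show "card (descendants E u (Suc n) N v) \<le> q"
        unfolding q_def using v by (intro card_descendants_less) auto
    qed
    finally show ?thesis by (simp add: s_def mult.commute)
  qed
  have blocks: "s (Suc (i + j * N)) \<le> q ^ j * s (Suc i)" for i j
  proof (induction j)
    case (Suc j)
    have "s (Suc (i + Suc j * N)) \<le> q * s (Suc (i + j * N))"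
      using step[of "i + j * N"] by (simp add: algebra_simps)
    also have "\<dots> \<le> q * (q ^ j * s (Suc i))" using Suc by simp
    finally show ?case by simp
  qed simp
  define M where "M = (\<Sum>i<N. s (Suc i))"
  have ball_sphere: "graph_ball V E u r \<subseteq> (\<Union>n\<le>r. graph_sphere E u n)" for r
  proof
    fix v assume "v \<in> graph_ball V E u r"
    then obtain n where n: "n \<le> r" "(u, v) \<in> E ^^ n" by (auto simp: graph_ball_eq)
    define m where "m = (LEAST m. (u, v) \<in> E ^^ m)"
    have "(u, v) \<in> E ^^ m" unfolding m_def using n(2) by (rule LeastI)
    moreover have "(u, v) \<notin> E ^^ i" if "i < m" for i using not_less_Least that unfolding m_def by blast
    moreover have "m \<le> r" using n Least_le[of "\<lambda>m. (u, v) \<in> E ^^ m" n] by (simp add: m_def)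
    ultimately show "v \<in> (\<Union>n\<le>r. graph_sphere E u n)" by (auto simp: graph_sphere_def)
  qed
  \<comment> \<open>Infinite sets have \<open>card\<close> 0, so equality of cardinalities
    transports finiteness from the centre \<open>u\<close>, whose ball is covered by finitely many
    spheres.\<close>
  have finb: "finite (graph_ball V E v r)" if "v \<in> V" for v r
  proof (cases "v = u")
    case True
    then show ?thesis using ball_sphere finite_graph_sphere by (meson finite_UN finite_atMost finite_subset)
  next
    case False
    have "finite (graph_ball V E u r)"
      using ball_sphere finite_graph_sphere by (meson finite_UN finite_atMost finite_subset)
    moreover have "u \<in> graph_ball V E u r" using u by (auto simp: graph_ball_eq intro: exI[of _ 0])
    ultimately have "card (graph_ball V E v r) > 0" using trans[OF that] by (auto simp: card_gt_0_iff)
    then show ?thesis by (simp add: card_ge_0_finite)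
  qed
  have b1: "1 \<le> b r" for r
  proof -
    have "u \<in> graph_ball V E u r" using u by (auto simp: graph_ball_eq intro: exI[of _ 0])
    then show ?thesis using finb[OF u] by (auto simp: b_def Suc_le_eq card_gt_0_iff)
  qed
  have sub: "b (m + n) \<le> b m * b n" for m n
  proof -
    have "graph_ball V E u (m + n) \<subseteq> (\<Union>v\<in>graph_ball V E u m. graph_ball V E v n)"
    proof
      fix w assume "w \<in> graph_ball V E u (m + n)"
      then obtain l where l: "w \<in> V" "l \<le> m + n" "(u, w) \<in> E ^^ l" by (auto simp: graph_ball_eq)
      have "(u, w) \<in> E ^^ (min l m + (l - min l m))" using l by simp
      then obtain v where v: "(u, v) \<in> E ^^ (min l m)" "(v, w) \<in> E ^^ (l - min l m)"
        unfolding relpow_add by blast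
      have "v \<in> graph_ball V E u m" using v relV u
        by (auto simp: graph_ball_eq intro!: exI[of _ "min l m"])
      moreover have "w \<in> graph_ball V E v n" using v l
        by (auto simp: graph_ball_eq intro!: exI[of _ "l - min l m"])
      ultimately show "w \<in> (\<Union>v\<in>graph_ball V E u m. graph_ball V E v n)" by blast
    qed
    then have "b (m + n) \<le> card (\<Union>v\<in>graph_ball V E u m. graph_ball V E v n)"
      unfolding b_def using finb u by (intro card_mono) (auto simp: graph_ball_eq)
    also have "\<dots> \<le> (\<Sum>v\<in>graph_ball V E u m. card (graph_ball V E v n))"
      by (intro card_UN_le finb u)
    also have "\<dots> = (\<Sum>v\<in>graph_ball V E u m. b n)"
      unfolding b_def by (intro sum.cong refl trans) (auto simp: graph_ball_def)
    finally show ?thesis by (simp add: b_def)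
  qed
  have "convergent (\<lambda>n. root n (real (b n)))"
  proof (rule convergent_root_submultiplicative)
    show "1 \<le> real (b n)" for n using b1 by simp
    show "real (b (m + n)) \<le> real (b m) * real (b n)" for m n
      using sub by (metis of_nat_le_iff of_nat_mult)
  qed
  then have lim: "(\<lambda>n. root n (real (b n))) \<longlonglongrightarrow> growth_rate V E u"
    unfolding growth_rate_def b_def by (simp add: convergent_LIMSEQ_iff)
  \<comment> \<open>The spheres from 1 to \<open>r * N\<close> are grouped into \<open>r\<close>
    blocks of length \<open>N\<close>. The first block has \<open>M\<close> vertices, and block
    \<open>j\<close> has at most \<open>q ^ j * M\<close>.\<close>
  have bbound: "b (r * N) \<le> (1 + r * M) * q ^ r" for r
  proof -
    have "b (r * N) \<le> card (\<Union>n\<le>r * N. graph_sphere E u n)"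
      unfolding b_def by (intro card_mono ball_sphere) (auto simp: finite_graph_sphere)
    also have "\<dots> \<le> (\<Sum>n\<le>r * N. s n)" unfolding s_def by (rule card_UN_le) simp
    also have "\<dots> = s 0 + (\<Sum>n<r * N. s (Suc n))" by (metis lessThan_Suc_atMost sum.lessThan_Suc_shift)
    also have "(\<Sum>n<r * N. s (Suc n)) = (\<Sum>j<r. \<Sum>n\<in>{j * N..<j * N + N}. s (Suc n))"
      by (rule sum.nat_group[symmetric])
    also have "\<dots> = (\<Sum>j<r. \<Sum>i<N. s (Suc (i + j * N)))"
    proof (rule sum.cong[OF refl])
      fix j
      show "(\<Sum>n\<in>{j * N..<j * N + N}. s (Suc n)) = (\<Sum>i<N. s (Suc (i + j * N)))"
        using sum.shift_bounds_nat_ivl[of "\<lambda>n. s (Suc n)" 0 "j * N" N]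
        by (simp add: atLeast0LessThan add.commute)
    qed
    also have "\<dots> \<le> (\<Sum>j<r. \<Sum>i<N. q ^ r * s (Suc i))"
    proof (intro sum_mono)
      fix j i assume "j \<in> {..<r}"
      then have "q ^ j \<le> q ^ r" using q1 by (intro power_increasing) auto
      then show "s (Suc (i + j * N)) \<le> q ^ r * s (Suc i)"
        using blocks[of i j] by (meson le_trans mult_le_mono1)
    qed
    also have "\<dots> = r * M * q ^ r" by (simp add: M_def sum_distrib_left mult_ac)
    also have "s 0 = 1" by (simp add: s_def graph_sphere_def)
    finally have "b (r * N) \<le> 1 + r * M * q ^ r" by simp
    also have "\<dots> \<le> (1 + r * M) * q ^ r" using q1 by (simp add: algebra_simps)
    finally show ?thesis .
  qed
  have lim1: "(\<lambda>r. root (r * N) (real (b (r * N)))) \<longlonglongrightarrow> growth_rate V E u"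
    using LIMSEQ_subseq_LIMSEQ[OF lim, of "\<lambda>r. r * N"] N by (auto simp: strict_mono_def o_def)
  \<comment> \<open>The polynomial factor \<open>1 + r * M\<close> disappears under the root of
    order \<open>r * N\<close>.\<close>
  have lim2: "(\<lambda>r. (1 + real r * real M) powr (1 / (real r * real N)) * root N (real q)) \<longlonglongrightarrow> 1 * root N (real q)"
  proof (intro tendsto_intros)
    have "((\<lambda>x::real. (1 + x * real M) powr (1 / (x * real N))) \<longlongrightarrow> 1) at_top"
    proof -
      have Npos: "real N > 0" using N by simp
      have e: "(\<lambda>x::real. exp (ln (1 + x * real M) / (x * real N))) = (\<lambda>x. exp (ln (1 + x * real M) / (x * real N)))" ..
      have "((\<lambda>x::real. ln (1 + x * real M) / (x * real N)) \<longlongrightarrow> 0) at_top"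
      proof (cases "M = 0")
        case False
        then have "real M > 0" by simp
        have l: "((\<lambda>x::real. (ln (1 + real M) + ln x) / x) \<longlongrightarrow> 0) at_top"
        proof -
          have "((\<lambda>x::real. ln (1 + real M) / x + ln x / x) \<longlongrightarrow> 0 + 0) at_top"
          proof (intro tendsto_add)
            show "((\<lambda>x::real. ln (1 + real M) / x) \<longlongrightarrow> 0) at_top"
              by (intro tendsto_divide_0[OF tendsto_const] filterlim_at_top_imp_at_infinity filterlim_ident)
            show "((\<lambda>x::real. ln x / x) \<longlongrightarrow> 0) at_top" by (rule ln_x_over_x_tendsto_0)
          qed
          then show ?thesis by (simp add: add_divide_distrib)
        qed
        have l2: "((\<lambda>x::real. (ln (1 + real M) + ln x) / x / real N) \<longlongrightarrow> 0) at_top"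
          using tendsto_divide[OF l tendsto_const[of "real N"]] Npos by simp
        show ?thesis
        proof (rule tendsto_sandwich[OF _ _ tendsto_const l2])
          show "\<forall>\<^sub>F x in at_top. 0 \<le> ln (1 + x * real M) / (x * real N)"
            using eventually_ge_at_top[of 1] by eventually_elim auto
          show "\<forall>\<^sub>F x in at_top. ln (1 + x * real M) / (x * real N) \<le> (ln (1 + real M) + ln x) / x / real N"
            using eventually_ge_at_top[of 1]
          proof eventually_elim
            case (elim x)
            have "ln (1 + x * real M) \<le> ln ((1 + real M) * x)"
              using elim by (subst ln_le_cancel_iff) (auto simp: algebra_simps intro!: add_pos_nonneg)
            also have "\<dots> = ln (1 + real M) + ln x" using elim by (intro ln_mult_pos add_pos_nonneg) auto
            finally have "ln (1 + x * real M) \<le> ln (1 + real M) + ln x" .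
            then show ?case using elim Npos by (simp add: divide_right_mono)
          qed
        qed
      qed simp
      then have "((\<lambda>x::real. exp (ln (1 + x * real M) / (x * real N))) \<longlongrightarrow> exp 0) at_top"
        by (rule tendsto_exp)
      moreover have "\<forall>\<^sub>F x in at_top. exp (ln (1 + x * real M) / (x * real N)) = (1 + x * real M) powr (1 / (x * real N))"
        using eventually_ge_at_top[of 0]
      proof eventually_elim
        case (elim x)
        then have "0 \<le> x * real M" by simp
        then have "1 + x * real M \<noteq> 0" by linarith
        then show ?case by (simp add: powr_def)
      qed
      ultimately show ?thesis by (simp add: tendsto_cong)
    qed
    from filterlim_compose[OF this filterlim_real_sequentially]
    show "(\<lambda>r. (1 + real r * real M) powr (1 / (real r * real N))) \<longlonglongrightarrow> 1" .
  qed
  have "growth_rate V E u \<le> 1 * root N (real q)"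
  proof (rule LIMSEQ_le[OF lim1 lim2], intro exI[of _ 1] allI impI)
    fix r :: nat assume r: "1 \<le> r"
    have rN: "r * N > 0" using r N by simp
    have "real (b (r * N)) \<le> real ((1 + r * M) * q ^ r)" using bbound of_nat_le_iff by blast
    then have "root (r * N) (real (b (r * N))) \<le> root (r * N) ((1 + real r * real M) * real q ^ r)"
      using rN by (intro real_root_le_mono) (auto simp: algebra_simps)
    also have "\<dots> = root (r * N) (1 + real r * real M) * root (r * N) (real q ^ r)"
      by (rule real_root_mult)
    also have "root (r * N) (1 + real r * real M) = (1 + real r * real M) powr (1 / (real r * real N))"
      using rN by (subst root_powr_inverse) (auto intro!: add_pos_nonneg)
    also have "root (r * N) (real q ^ r) = root N (real q)"
    proof -
      have "root (r * N) (real q ^ r) = root N (root r (real q ^ r))"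
        by (metis mult.commute real_root_mult_exp)
      then show ?thesis using r by (simp add: real_root_power_cancel)
    qed
    finally show "root (r * N) (real (b (r * N))) \<le> (1 + real r * real M) powr (1 / (real r * real N)) * root N (real q)" .
  qed
  then show ?thesis by (simp add: q_def)
qed

section \<open>The hyperboloid model\<close>

definition lor :: "'a::euclidean_space \<times> real \<Rightarrow> 'a \<times> real \<Rightarrow> real" where
  "lor v w = fst v \<bullet> fst w - snd v * snd w"

definition homog :: "'a::euclidean_space \<Rightarrow> 'a \<times> real" where
  "homog x = (x, 1)"

lemma fst_homog [simp]: "fst (homog x) = x" and snd_homog [simp]: "snd (homog x) = 1"
  by (simp_all add: homog_def)

text \<open>The point of the upper sheet of the hyperboloid on the ray through
  \<open>homog x\<close>. The unnormalised \<open>homog x\<close> is kept beside it because it also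
  makes sense for ideal points and for points outside the ball.\<close>

definition lift :: "'a::euclidean_space \<Rightarrow> 'a \<times> real" where
  "lift x = (1 / sqrt (1 - (norm x)\<^sup>2)) *\<^sub>R homog x"

lemma lor_commute: "lor v w = lor w v"
  by (simp add: lor_def inner_commute mult.commute)

lemma lor_add_left: "lor (u + v) w = lor u w + lor v w"
  and lor_add_right: "lor w (u + v) = lor w u + lor w v"
  and lor_diff_left: "lor (u - v) w = lor u w - lor v w"
  and lor_diff_right: "lor w (u - v) = lor w u - lor w v"
  and lor_scale_left: "lor (c *\<^sub>R u) w = c * lor u w"
  and lor_scale_right: "lor w (c *\<^sub>R u) = c * lor w u"
  and lor_minus_left: "lor (- u) w = - lor u w"
  and lor_minus_right: "lor w (- u) = - lor w u"
  and lor_zero_left: "lor 0 w = 0"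
  and lor_zero_right: "lor w 0 = 0"
  by (simp_all add: lor_def inner_add_left inner_add_right inner_diff_left inner_diff_right algebra_simps)

lemmas lor_simps = lor_add_left lor_add_right lor_diff_left lor_diff_right lor_scale_left
  lor_scale_right lor_minus_left lor_minus_right lor_zero_left lor_zero_right

lemma linear_lor_left: "linear (\<lambda>v. lor v w)" and linear_lor_right: "linear (lor w)"
  by (rule linearI; simp add: lor_simps)+

lemma lor_span_zero:
  assumes "v \<in> span S" "\<And>s. s \<in> S \<Longrightarrow> lor s w = 0"
  shows "lor v w = 0"
  using linear_eq_0_on_span[OF linear_lor_left _ assms(1)] assms(2) by blast

lemma lor_eq_inner: "lor v w = v \<bullet> (fst w, - snd w)"
  by (cases v) (simp add: lor_def)

lemma lor_nondegenerate:
  assumes "\<And>w. lor v w = 0" shows "v = 0"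
proof -
  have "lor v (fst v, - snd v) = 0" by (rule assms)
  then have "fst v \<bullet> fst v + snd v * snd v = 0" by (simp add: lor_def)
  then have "v \<bullet> v = 0" by (simp add: inner_prod_def)
  then show ?thesis by simp
qed

lemma lor_hom: "lor (homog x) u = fst u \<bullet> x - snd u"
  by (simp add: lor_def inner_commute)

lemma ball_norm_less: "x \<in> ball 0 1 \<Longrightarrow> 0 < 1 - (norm (x::'a::real_normed_vector))\<^sup>2"
  by (simp add: abs_square_less_1)

lemma lift_factor_pos: "x \<in> hyp_space \<Longrightarrow> 0 < 1 / sqrt (1 - (norm x)\<^sup>2)"
  using ball_norm_less[of x] by simp

lemma lift_scaleE:
  assumes "x \<in> hyp_space"
  obtains a where "0 < a" "lift x = a *\<^sub>R homog x"
  by (rule that[OF lift_factor_pos[OF assms] lift_def])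

lemma lor_lift_self: "x \<in> hyp_space \<Longrightarrow> lor (lift x) (lift x) = -1"
proof -
  assume x: "x \<in> hyp_space"
  define s where "s = 1 - (norm x)\<^sup>2"
  have s: "s > 0" using ball_norm_less[OF x] by (simp add: s_def)
  have "lor (homog x) (homog x) = - s"
    by (simp add: lor_def s_def power2_norm_eq_inner)
  then have "lor (lift x) (lift x) = - s * (1 / sqrt s * (1 / sqrt s))"
    by (simp add: lift_def lor_simps flip: s_def)
  also have "\<dots> = -1" using s by simp
  finally show ?thesis .
qed

lemma lor_hom_neg: "\<lbrakk>norm x \<le> 1; norm y < 1\<rbrakk> \<Longrightarrow> lor (homog x) (homog y) < 0"
proof -
  assume "norm x \<le> 1" "norm y < 1"
  then have "x \<bullet> y < 1"
    using norm_cauchy_schwarz[of x y] mult_left_le_one_le[of "norm y" "norm x"] by simp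
  then show ?thesis by (simp add: lor_def)
qed

text \<open>Orthogonality expresses \<open>snd v\<close> through \<open>fst v\<close>, and both
  claims become Cauchy-Schwarz for \<open>x\<close> and \<open>fst v\<close>. The weak form covers
  ideal points, where the complement contains the null vector \<open>homog x\<close> itself.\<close>

lemma lor_causal_orthogonal:
  assumes x: "norm x \<le> 1" and "lor (homog x) v = 0"
  shows "0 \<le> lor v v" and "\<lbrakk>norm x < 1; v \<noteq> 0\<rbrakk> \<Longrightarrow> 0 < lor v v"
proof -
  have t: "snd v = x \<bullet> fst v" using assms by (simp add: lor_def)
  have cs: "(x \<bullet> fst v)\<^sup>2 \<le> (norm x)\<^sup>2 * (norm (fst v))\<^sup>2"
    by (metis Cauchy_Schwarz_ineq power2_norm_eq_inner)
  have e: "lor v v = (norm (fst v))\<^sup>2 - (x \<bullet> fst v)\<^sup>2"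
    by (simp add: lor_def t flip: power2_norm_eq_inner) (simp add: power2_eq_square)
  have x2: "(norm x)\<^sup>2 \<le> 1" using x by (simp add: power_le_one)
  then have "(norm x)\<^sup>2 * (norm (fst v))\<^sup>2 \<le> 1 * (norm (fst v))\<^sup>2" by (rule mult_right_mono) simp
  with cs e show "0 \<le> lor v v" by simp
  assume "norm x < 1" "v \<noteq> 0"
  have "fst v \<noteq> 0" using t \<open>v \<noteq> 0\<close> by (metis inner_zero_right prod.collapse zero_prod_def)
  moreover have "(norm x)\<^sup>2 < 1" using \<open>norm x < 1\<close> by (simp add: abs_square_less_1)
  ultimately have "(norm x)\<^sup>2 * (norm (fst v))\<^sup>2 < 1 * (norm (fst v))\<^sup>2"
    by (intro mult_strict_right_mono) auto
  with cs e show "0 < lor v v" by simp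
qed

text \<open>The part \<open>v\<close> of \<open>lift y\<close> orthogonal to \<open>lift x\<close>
  satisfies \<open>lor v v = ?c * ?c - 1\<close>, which is nonnegative by
  \<open>lor_causal_orthogonal\<close>; the sign of \<open>?c\<close> comes from
  \<open>lor_hom_neg\<close>.\<close>

lemma lor_lift_le: 
  assumes x: "x \<in> hyp_space" and y: "y \<in> hyp_space"
  shows "lor (lift x) (lift y) \<le> -1" and "lor (lift x) (lift y) = -1 \<Longrightarrow> x = y"
proof -
  let ?u = "lift x" and ?w = "lift y"
  let ?c = "lor ?u ?w"
  define v where "v = ?w + ?c *\<^sub>R ?u"
  have "lor ?u v = 0" using lor_lift_self[OF x] by (simp add: v_def lor_simps)
  then have o: "lor (homog x) v = 0" using lift_factor_pos[OF x] by (simp add: lift_def lor_simps)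
  have vv: "lor v v = -1 + ?c * ?c"
    using lor_lift_self[OF x] lor_lift_self[OF y] by (simp add: v_def lor_simps lor_commute[of ?w ?u])
  have neg: "?c < 0"
  proof -
    obtain a b where ab: "0 < a" "lift x = a *\<^sub>R homog x" "0 < b" "lift y = b *\<^sub>R homog y"
      using lift_scaleE[OF x] lift_scaleE[OF y] by metis
    then show ?thesis using lor_hom_neg[of x y] x y by (simp add: lor_simps mult_pos_neg)
  qed
  have "0 \<le> lor v v" using lor_causal_orthogonal(1)[OF _ o] x by simp
  then have "1 \<le> ?c * ?c" using vv by simp
  then have "1 \<le> \<bar>?c\<bar>" by (metis abs_mult_self_eq abs_square_less_1 linorder_not_less power2_eq_square)
  with neg show "?c \<le> -1" by simp
  assume c: "?c = -1"
  then have "lor v v = 0" using vv by simp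
  then have "v = 0" using lor_causal_orthogonal(2)[OF _ o] x by force
  then have e: "?w = ?u" using c by (simp add: v_def)
  then have "snd ?w = snd ?u" "fst ?w = fst ?u" by simp_all
  then show "x = y" using lift_factor_pos[OF x] by (simp add: lift_def)
qed

lemma hdist_eq: "hdist x y = arcosh (- lor (lift x) (lift y))"
  by (simp add: hdist_def lift_def lor_def algebra_simps diff_divide_distrib)

lemma hdist_le_iff:
  assumes "x \<in> hyp_space" "y \<in> hyp_space" "x' \<in> hyp_space" "y' \<in> hyp_space"
  shows "hdist x y \<le> hdist x' y' \<longleftrightarrow> lor (lift x') (lift y') \<le> lor (lift x) (lift y)"
  using arcosh_less_iff_real[of "- lor (lift x') (lift y')" "- lor (lift x) (lift y)"]
    lor_lift_le(1)[of x y] lor_lift_le(1)[of x' y'] assms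
  by (simp add: hdist_eq not_less[symmetric])

lemma hdist_eq_iff:
  assumes "x \<in> hyp_space" "y \<in> hyp_space" "x' \<in> hyp_space" "y' \<in> hyp_space"
  shows "hdist x y = hdist x' y' \<longleftrightarrow> lor (lift x) (lift y) = lor (lift x') (lift y')"
  using hdist_le_iff[of x y x' y'] hdist_le_iff[of x' y' x y] assms by (metis order_antisym order_refl)

text \<open>The positive factor of \<open>lift x\<close> drops out of the comparison. What remains
  is affine in \<open>x\<close>, so bisectors are hyperplanes in the Klein model.\<close>

lemma hdist_le_hom_iff:
  assumes x: "x \<in> hyp_space" and p: "p \<in> hyp_space" and q: "q \<in> hyp_space"
  shows "hdist x p \<le> hdist x q \<longleftrightarrow> 0 \<le> lor (homog x) (lift p - lift q)"
proof -
  obtain a where a: "0 < a" "lift x = a *\<^sub>R homog x" using lift_scaleE[OF x] by blast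
  have "hdist x p \<le> hdist x q \<longleftrightarrow> 0 \<le> a * lor (homog x) (lift p - lift q)"
    using hdist_le_iff[OF x p x q] by (simp add: a lor_simps right_diff_distrib)
  then show ?thesis using a(1) by (simp add: zero_le_mult_iff)
qed

lemma lift_inj: "\<lbrakk>x \<in> hyp_space; y \<in> hyp_space; lift x = lift y\<rbrakk> \<Longrightarrow> x = y"
  using lor_lift_le(2)[of x y] lor_lift_self[of y] by simp

lemma lor_lift_diff_pos:
  assumes "x \<in> hyp_space" "y \<in> hyp_space" "x \<noteq> y"
  shows "0 < lor (homog x) (lift x - lift y)"
proof -
  have "lor (lift x) (lift y) < -1" using lor_lift_le[of x y] assms by force
  then have "0 < lor (lift x) (lift x - lift y)"
    using lor_lift_self[of x] assms by (simp add: lor_simps)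
  moreover obtain a where "0 < a" "lift x = a *\<^sub>R homog x" using lift_scaleE assms by blast
  ultimately show ?thesis by (metis lor_scale_left zero_less_mult_pos)
qed

section \<open>Isometries as Lorentz maps\<close>

lemma span_lift: "span (lift ` hyp_space) = (UNIV :: ('a::euclidean_space \<times> real) set)"
proof -
  have hom_in: "homog x \<in> span (lift ` hyp_space)" if "x \<in> hyp_space" for x :: 'a
  proof -
    have "homog x = sqrt (1 - (norm x)\<^sup>2) *\<^sub>R lift x"
      using ball_norm_less[OF that] by (simp add: lift_def)
    then show ?thesis using that by (metis imageI span_base span_scale)
  qed
  have "v \<in> span (lift ` hyp_space)" for v :: "'a \<times> real"
  proof -
    define s where "s = 1 + norm (fst v)"
    have s: "s > 0" unfolding s_def by (simp add: add_pos_nonneg)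
    have "(1 / s) *\<^sub>R fst v \<in> hyp_space" using s by (simp add: s_def)
    \<comment> \<open>\<open>homog 0\<close> is the vertical unit vector: the first term has the
      space part of \<open>v\<close>, the second corrects its height.\<close>
    then have "s *\<^sub>R homog ((1 / s) *\<^sub>R fst v) + (snd v - s) *\<^sub>R homog 0 \<in> span (lift ` hyp_space)"
      by (intro span_add span_scale hom_in) auto
    moreover have "s *\<^sub>R homog ((1 / s) *\<^sub>R fst v) + (snd v - s) *\<^sub>R homog 0 = v"
      using s by (simp add: prod_eq_iff)
    ultimately show ?thesis by simp
  qed
  then show ?thesis by auto
qed

definition lorentz :: "('a::euclidean_space \<times> real \<Rightarrow> 'a \<times> real) \<Rightarrow> bool" where
  "lorentz A \<longleftrightarrow> linear A \<and> (\<forall>v w. lor (A v) (A w) = lor v w)"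

lemma lorentz_linear: "lorentz A \<Longrightarrow> linear A"
  and lorentz_lor: "lorentz A \<Longrightarrow> lor (A v) (A w) = lor v w"
  unfolding lorentz_def by blast+

lemma lorentz_inj: "lorentz A \<Longrightarrow> inj A"
proof -
  assume A: "lorentz A"
  have "v = 0" if "A v = 0" for v
  proof (rule lor_nondegenerate)
    show "lor v w = 0" for w using lorentz_lor[OF A, of v w] that by (simp add: lor_simps)
  qed
  then show ?thesis using lorentz_linear[OF A] linear_injective_0 by blast
qed

text \<open>The values of \<open>f\<close> on a basis of lifted points define a linear map
  \<open>A\<close>. As \<open>f\<close> is onto and preserves \<open>lor\<close> between lifts, the
  lifts of its values span and can test equality; nondegeneracy then forces \<open>A\<close> to
  agree with \<open>f\<close> at all other points.\<close>

lemma isometry_lorentz: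
  fixes f :: "'a::euclidean_space \<Rightarrow> 'a"
  assumes f: "f \<in> hyp_isom"
  obtains A where "lorentz A" "\<And>x. x \<in> hyp_space \<Longrightarrow> lift (f x) = A (lift x)"
proof -
  have im: "f ` hyp_space = hyp_space" using f by (simp add: hyp_isom_def Bij_def bij_betw_def)
  have fB: "f x \<in> hyp_space" if "x \<in> hyp_space" for x using im that by blast
  have lorf: "lor (lift (f x)) (lift (f y)) = lor (lift x) (lift y)"
    if "x \<in> hyp_space" "y \<in> hyp_space" for x y
  proof -
    have "hdist (f x) (f y) = hdist x y" using f that unfolding hyp_isom_def by blast
    then show ?thesis using hdist_eq_iff[OF fB[OF that(1)] fB[OF that(2)] that] by blast
  qed
  have zero: "v = 0" if "\<And>y. y \<in> hyp_space \<Longrightarrow> lor v (lift (f y)) = 0" for v :: "'a \<times> real"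
  proof (rule lor_nondegenerate)
    fix w :: "'a \<times> real"
    have "w \<in> span (lift ` hyp_space)" using span_lift by blast
    then have "lor w v = 0"
    proof (rule lor_span_zero)
      fix s assume "s \<in> lift ` (hyp_space :: 'a set)"
      then have "s \<in> lift ` (f ` hyp_space)" unfolding im .
      then obtain y where "y \<in> hyp_space" "s = lift (f y)" by blast
      then show "lor s v = 0" using that by (simp add: lor_commute)
    qed
    then show "lor v w = 0" by (simp add: lor_commute)
  qed
  obtain B where B: "B \<subseteq> lift ` (hyp_space :: 'a set)" "independent B" "lift ` (hyp_space :: 'a set) \<subseteq> span B"
    using maximal_independent_subset by blast
  define h where "h b = lift (f (inv_into hyp_space lift b))" for b
  have h: "h (lift x) = lift (f x)" if "x \<in> hyp_space" for x
  proof -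
    have "inj_on (lift :: 'a \<Rightarrow> _) hyp_space" using lift_inj by (rule inj_onI)
    then show ?thesis using that by (simp only: h_def inv_into_f_f)
  qed
  have "\<exists>A. linear A \<and> (\<forall>b\<in>B. A b = h b)" by (rule linear_independent_extend[OF B(2)])
  then obtain A where A: "linear A" "\<And>b. b \<in> B \<Longrightarrow> A b = h b" by blast
  have key: "lor (A v) (lift (f y)) = lor v (lift y)" if y: "y \<in> hyp_space" for v y
  proof -
    have lin: "linear (\<lambda>v. lor (A v) (lift (f y)) - lor v (lift y))"
      by (rule linearI) (simp_all add: linear_add[OF A(1)] linear_scale[OF A(1)] lor_simps algebra_simps)
    have "v \<in> span B" using span_minimal[OF B(3) subspace_span] span_lift by blast
    moreover have "lor (A b) (lift (f y)) - lor b (lift y) = 0" if b: "b \<in> B" for b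
    proof -
      obtain x where x: "x \<in> hyp_space" "b = lift x" using subsetD[OF B(1) b] by auto
      then show ?thesis using A(2)[OF b] h lorf[OF x(1) y] by simp
    qed
    ultimately have "lor (A v) (lift (f y)) - lor v (lift y) = 0"
      using linear_eq_0_on_span[OF lin] by blast
    then show ?thesis by simp
  qed
  have AL: "lift (f x) = A (lift x)" if x: "x \<in> hyp_space" for x
  proof -
    have "A (lift x) - lift (f x) = 0"
    proof (rule zero)
      fix y :: 'a assume y: "y \<in> hyp_space"
      show "lor (A (lift x) - lift (f x)) (lift (f y)) = 0"
        using key[OF y, of "lift x"] lorf[OF x y] by (simp add: lor_diff_left)
    qed
    then show ?thesis by simp
  qed
  have "lor (A v) (A w) = lor v w" for v w
  proof -
    have lin: "linear (\<lambda>w. lor (A v) (A w) - lor v w)"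
      by (rule linearI) (simp_all add: linear_add[OF A(1)] linear_scale[OF A(1)] lor_simps algebra_simps)
    have "w \<in> span (lift ` hyp_space)" using span_lift by blast
    moreover have "lor (A v) (A b) - lor v b = 0" if b: "b \<in> lift ` hyp_space" for b
    proof -
      obtain x where x: "x \<in> hyp_space" "b = lift x" using b by blast
      then show ?thesis using key[OF x(1), of v] AL[OF x(1)] by simp
    qed
    ultimately have "lor (A v) (A w) - lor v w = 0" using linear_eq_0_on_span[OF lin] by blast
    then show ?thesis by simp
  qed
  then show ?thesis using that[of A] A AL by (simp add: lorentz_def)
qed

section \<open>Affine dimension through linear spans\<close>

lemma dim_hom:
  fixes X :: "'a::euclidean_space set"
  shows "aff_dim X = int (dim (homog ` X)) - 1"
proof (cases "X = {}")
  case True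
  then show ?thesis by simp
next
  case False
  then obtain a where a: "a \<in> X" by blast
  let ?D = "(\<lambda>x. x - a) ` X"
  let ?i = "\<lambda>v::'a. (v, 0::real)"
  have li: "linear ?i" by (auto intro!: linearI)
  have di: "dim (?i ` ?D) = dim ?D"
    by (rule dim_image_eq[OF li]) (auto simp: inj_on_def)
  \<comment> \<open>Differences of points have height 0 while \<open>homog a\<close> has height 1,
    which accounts for the shift by one.\<close>
  have notin: "homog a \<notin> span (?i ` ?D)"
  proof
    assume "homog a \<in> span (?i ` ?D)"
    then have "homog a \<in> ?i ` span ?D" by (simp add: linear_span_image[OF li])
    then show False by (auto simp: homog_def)
  qed
  have "span (homog ` X) = span (insert (homog a) (?i ` ?D))"
    unfolding span_eq
  proof (intro conjI)
    show "homog ` X \<subseteq> span (insert (homog a) (?i ` ?D))"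
    proof
      fix y assume "y \<in> homog ` X"
      then obtain x where x: "x \<in> X" "y = homog x" by blast
      have "homog a + (x - a, 0) \<in> span (insert (homog a) (?i ` ?D))"
        using x by (intro span_add span_base) auto
      then show "y \<in> span (insert (homog a) (?i ` ?D))" using x by (simp add: homog_def)
    qed
    show "insert (homog a) (?i ` ?D) \<subseteq> span (homog ` X)"
    proof -
      have "(x - a, 0) \<in> span (homog ` X)" if "x \<in> X" for x
      proof -
        have "homog x - homog a \<in> span (homog ` X)" using that a by (intro span_diff span_base) auto
        then show ?thesis by (simp add: homog_def)
      qed
      then show ?thesis using a by (auto intro: span_base)
    qed
  qed
  then have "dim (homog ` X) = dim (insert (homog a) (?i ` ?D))" by (metis dim_span)
  also have "\<dots> = dim ?D + 1" using notin by (simp add: dim_insert di)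
  finally show ?thesis using aff_dim_eq_dim_subtract[OF hull_inc[OF a, of affine]] by simp
qed

lemma span_hom_lift:
  assumes "X \<subseteq> hyp_space" shows "span (homog ` X) = span (lift ` X)"
  unfolding span_eq
proof (intro conjI)
  show "homog ` X \<subseteq> span (lift ` X)"
  proof
    fix y assume "y \<in> homog ` X"
    then obtain x where x: "x \<in> X" "y = homog x" by blast
    then have "y = sqrt (1 - (norm x)\<^sup>2) *\<^sub>R lift x"
      using ball_norm_less[of x] assms by (auto simp: lift_def)
    then show "y \<in> span (lift ` X)" using x by (metis imageI span_base span_scale)
  qed
  show "lift ` X \<subseteq> span (homog ` X)" proof
    fix y assume "y \<in> lift ` X"
    then obtain x where "x \<in> X" "y = (1 / sqrt (1 - (norm x)\<^sup>2)) *\<^sub>R homog x"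
      unfolding lift_def by blast
    then show "y \<in> span (homog ` X)" by (metis imageI span_base span_scale)
  qed
qed

text \<open>Isometries act on the Klein ball by projective maps, in general not affine ones, so
  dimensions are compared through the linear spans of the lifts.\<close>

lemma aff_dim_isometry:
  fixes f :: "'a::euclidean_space \<Rightarrow> 'a"
  assumes f: "f \<in> hyp_isom" and X: "X \<subseteq> hyp_space"
  shows "aff_dim (f ` X) = aff_dim X"
proof -
  obtain A where A: "lorentz A" "\<And>x. x \<in> hyp_space \<Longrightarrow> lift (f x) = A (lift x)"
    using isometry_lorentz[OF f] by blast
  have fX: "f ` X \<subseteq> hyp_space" using f X by (auto simp: hyp_isom_def Bij_def bij_betw_def)
  have "lift ` (f ` X) = A ` (lift ` X)" using A X by (force simp: image_image)
  then have "dim (lift ` (f ` X)) = dim (lift ` X)"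
    using dim_image_eq[OF lorentz_linear[OF A(1)] inj_on_subset[OF lorentz_inj[OF A(1)] subset_UNIV]] by simp
  then have "dim (homog ` (f ` X)) = dim (homog ` X)"
    using span_hom_lift[OF X] span_hom_lift[OF fX] by (metis dim_span)
  then show ?thesis by (simp add: dim_hom)
qed

section \<open>Hyperbolic volume\<close>

lemma linear_borel_measurable:
  fixes f :: "'a::euclidean_space \<Rightarrow> 'b::euclidean_space"
  shows "linear f \<Longrightarrow> f \<in> borel_measurable borel"
  by (auto intro!: borel_measurable_continuous_onI linear_continuous_on simp: linear_conv_bounded_linear)

text \<open>Linear changes of variables are available for \<open>real ^ 'n\<close> with a well-ordered index type \<open>'n\<close>;
  the following type provides such an index for an arbitrary Euclidean space.\<close>

typedef (overloaded) ('a::euclidean_space) basis_index = "{..<DIM('a)}"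
  by (rule exI[of _ 0]) simp

instance basis_index :: (euclidean_space) finite
proof
  have "(UNIV :: 'a basis_index set) \<subseteq> Abs_basis_index ` {..<DIM('a)}"
    by (metis Rep_basis_index Rep_basis_index_inverse imageI subsetI)
  then show "finite (UNIV :: 'a basis_index set)" by (rule finite_surj[OF finite_lessThan])
qed

instantiation basis_index :: (euclidean_space) wellorder
begin

definition less_eq_basis_index :: "'a basis_index \<Rightarrow> 'a basis_index \<Rightarrow> bool" where
  "less_eq_basis_index i j \<longleftrightarrow> Rep_basis_index i \<le> Rep_basis_index j"

definition less_basis_index :: "'a basis_index \<Rightarrow> 'a basis_index \<Rightarrow> bool" where
  "less_basis_index i j \<longleftrightarrow> Rep_basis_index i < Rep_basis_index j"

instance
proof
  fix P :: "'a basis_index \<Rightarrow> bool" and i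
  assume step: "\<And>x. (\<And>y. y < x \<Longrightarrow> P y) \<Longrightarrow> P x"
  show "P i"
    by (induction i rule: measure_induct_rule[of Rep_basis_index]) (use step less_basis_index_def in blast)
qed (auto simp: less_eq_basis_index_def less_basis_index_def Rep_basis_index_inject)

end

definition basis_vec :: "'a::euclidean_space basis_index \<Rightarrow> 'a" where
  "basis_vec i = (SOME h. bij_betw h {..<DIM('a)} Basis) (Rep_basis_index i)"

lemma bij_basis_vec: "bij_betw basis_vec UNIV (Basis :: 'a::euclidean_space set)"
proof -
  have "\<exists>h. bij_betw h {..<DIM('a)} (Basis :: 'a set)"
    using ex_bij_betw_nat_finite[of "Basis :: 'a set"] by (simp add: atLeast0LessThan)
  then have 1: "bij_betw (SOME h. bij_betw h {..<DIM('a)} (Basis :: 'a set)) {..<DIM('a)} Basis"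
    by (rule someI_ex)
  have 2: "bij_betw Rep_basis_index (UNIV :: 'a basis_index set) {..<DIM('a)}"
    by (rule bij_betw_byWitness[of _ Abs_basis_index])
       (use Rep_basis_index in \<open>auto simp: Rep_basis_index_inverse Abs_basis_index_inverse\<close>)
  show ?thesis
    using bij_betw_trans[OF 2 1] by (simp add: basis_vec_def[abs_def] o_def)
qed

lemma basis_vec_in_Basis: "basis_vec i \<in> Basis"
  using bij_basis_vec by (auto simp: bij_betw_def)

lemma basis_vec_inject: "basis_vec i = basis_vec j \<longleftrightarrow> i = j"
  using bij_basis_vec by (auto simp: bij_betw_def inj_def)

lemma Basis_eq_basis_vec: "Basis = range basis_vec"
  using bij_basis_vec by (auto simp: bij_betw_def)

section \<open>Euclidean coordinates and Lebesgue measure\<close>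

definition to_vec :: "'a::euclidean_space \<Rightarrow> real ^ 'a basis_index" where
  "to_vec x = (\<chi> i. x \<bullet> basis_vec i)"

definition of_vec :: "real ^ 'a basis_index \<Rightarrow> 'a::euclidean_space" where
  "of_vec v = (\<Sum>i\<in>UNIV. (v $ i) *\<^sub>R basis_vec i)"

lemma sum_basis_index: "(\<Sum>i\<in>UNIV. f (basis_vec i)) = (\<Sum>b\<in>(Basis :: 'a::euclidean_space set). f b)"
  by (rule sum.reindex_bij_betw[OF bij_basis_vec])

lemma linear_to_vec: "linear to_vec"
  by (rule linearI) (simp_all add: to_vec_def vec_eq_iff inner_add_left)

lemma linear_of_vec: "linear of_vec"
  by (rule linearI) (simp_all add: of_vec_def scaleR_left_distrib sum.distrib scaleR_sum_right)

lemma of_vec_to_vec [simp]: "of_vec (to_vec x) = x"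
  by (simp add: of_vec_def to_vec_def sum_basis_index[of "\<lambda>b. (x \<bullet> b) *\<^sub>R b"] euclidean_representation)

lemma of_vec_inner: "of_vec v \<bullet> basis_vec i = v $ i"
proof -
  have e: "basis_vec j \<bullet> basis_vec i = (if j = i then 1 else 0)" for j
    using basis_vec_in_Basis[of i] basis_vec_in_Basis[of j]
    by (simp add: inner_Basis basis_vec_inject)
  have "of_vec v \<bullet> basis_vec i = (\<Sum>j\<in>UNIV. if j = i then v $ j else 0)"
    unfolding of_vec_def inner_sum_left by (intro sum.cong refl) (simp add: e)
  then show ?thesis by simp
qed

lemma to_vec_of_vec [simp]: "to_vec (of_vec v) = v"
  by (simp add: to_vec_def vec_eq_iff of_vec_inner)

lemma inner_to_vec: "to_vec x \<bullet> to_vec y = x \<bullet> y"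
  by (simp add: inner_vec_def to_vec_def sum_basis_index[of "\<lambda>b. (x \<bullet> b) * (y \<bullet> b)"] euclidean_inner[of x y])

lemma borel_of_vec [measurable]: "of_vec \<in> borel_measurable borel"
  and borel_to_vec [measurable]: "to_vec \<in> borel_measurable borel"
  using linear_of_vec linear_to_vec
  by (auto intro: linear_borel_measurable)

lemma lborel_of_vec: "distr lborel borel of_vec = (lborel :: 'a::euclidean_space measure)"
proof (rule sym, rule lborel_eqI)
  fix l u :: 'a assume le: "\<And>b. b \<in> Basis \<Longrightarrow> l \<bullet> b \<le> u \<bullet> b"
  have "of_vec -` box l u = box (to_vec l) (to_vec u)"
  proof -
    have "(\<forall>b\<in>Basis. l \<bullet> b < of_vec v \<bullet> b \<and> of_vec v \<bullet> b < u \<bullet> b)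
      \<longleftrightarrow> (\<forall>i. l \<bullet> basis_vec i < v $ i \<and> v $ i < u \<bullet> basis_vec i)" for v :: "real ^ 'a basis_index"
      by (simp add: Basis_eq_basis_vec of_vec_inner)
    then show ?thesis by (auto simp: box_def[of l u] mem_box_cart to_vec_def)
  qed
  then have "emeasure (distr lborel borel of_vec) (box l u) = emeasure lborel (box (to_vec l) (to_vec u))"
    by (simp add: emeasure_distr)
  also have "\<dots> = (\<Prod>b\<in>Basis. (to_vec u - to_vec l) \<bullet> b)"
    by (rule emeasure_lborel_box) (use le[OF basis_vec_in_Basis] in \<open>auto simp: Basis_vec_def inner_axis to_vec_def\<close>)
  also have "(\<Prod>b\<in>Basis. (to_vec u - to_vec l) \<bullet> b) = (\<Prod>i\<in>UNIV. (u - l) \<bullet> basis_vec i)"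
    by (rule prod.reindex_bij_witness[of _ "\<lambda>i. axis i 1" "\<lambda>b. THE i. b = axis i 1"])
       (auto simp: Basis_vec_def axis_eq_axis inner_axis to_vec_def inner_diff_left)
  also have "\<dots> = (\<Prod>b\<in>Basis. (u - l) \<bullet> b)"
    by (rule prod.reindex_bij_betw[OF bij_basis_vec])
  finally show "emeasure (distr lborel borel of_vec) (box l u) = (\<Prod>b\<in>Basis. (u - l) \<bullet> b)" .
qed simp

lemma distr_lborel_det_one:
  fixes f :: "real ^ 'n::{finite,wellorder} \<Rightarrow> real ^ 'n::_"
  assumes f: "linear f" and det: "\<bar>det (matrix f)\<bar> = 1"
  shows "distr lborel borel f = lborel"
proof (rule sym, rule lborel_eqI)
  fix l u :: "(real, 'n) vec" assume le: "\<And>b. b \<in> Basis \<Longrightarrow> l \<bullet> b \<le> u \<bullet> b"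
  have fm [measurable]: "f \<in> borel_measurable borel"
    using f by (auto intro: linear_borel_measurable)
  have "inj f" using det_nz_iff_inj[OF f] det by auto
  then obtain g where g: "linear g" "f \<circ> g = id" "g \<circ> f = id"
    using f linear_injective_isomorphism by (metis comp_def eq_id_iff)
  have "matrix f ** matrix g = mat 1"
    using matrix_compose[OF g(1) f] g(2) by (simp add: matrix_id_mat_1)
  then have "det (matrix f) * det (matrix g) = 1" by (metis det_I det_mul)
  then have detg: "\<bar>det (matrix g)\<bar> = 1" using det by (metis abs_mult abs_one mult_1)
  have pre: "f -` X = g ` X" for X
    using g(2,3) by (auto simp: fun_eq_iff image_iff) metis
  have "box l u \<in> lmeasurable" by simp
  then have gb: "g ` box l u \<in> lmeasurable" "measure lebesgue (g ` box l u) = measure lebesgue (box l u)"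
    using measurable_linear_image[OF g(1)] measure_linear_image[OF g(1)] detg by auto
  have gborel: "g ` box l u \<in> sets borel"
    using measurable_sets[OF fm, of "box l u"] by (simp add: pre)
  have "emeasure (distr lborel borel f) (box l u) = emeasure lborel (g ` box l u)"
    by (simp add: emeasure_distr pre)
  also have "\<dots> = emeasure lebesgue (g ` box l u)" using gborel by simp
  also have "\<dots> = ennreal (measure lebesgue (g ` box l u))"
    by (rule emeasure_eq_measure2[OF gb(1)])
  also have "\<dots> = emeasure lebesgue (box l u)"
    unfolding gb by (rule emeasure_eq_measure2[OF \<open>box l u \<in> lmeasurable\<close>, symmetric])
  also have "\<dots> = emeasure lborel (box l u)" by simp
  finally show "emeasure (distr lborel borel f) (box l u) = (\<Prod>b\<in>Basis. (u - l) \<bullet> b)"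
    using le by simp
qed simp

text \<open>In matrices the hypothesis reads A^T J A = J with det J nonzero, so the square of det A
  is 1.\<close>

lemma distr_lborel_form_preserving:
  fixes A J :: "'a::euclidean_space \<Rightarrow> 'a"
  assumes A: "linear A" and J: "linear J" "inj J"
    and pres: "\<And>v w. A v \<bullet> J (A w) = v \<bullet> J w"
  shows "distr lborel borel A = lborel"
proof -
  define A' where "A' = to_vec \<circ> A \<circ> of_vec"
  define J' where "J' = to_vec \<circ> J \<circ> of_vec"
  have lA: "linear A'" and lJ: "linear J'"
    unfolding A'_def J'_def using A J linear_to_vec linear_of_vec by (auto intro!: linear_compose)
  have "inj J'"
    unfolding J'_def using J(2) by (intro inj_compose) (metis injI of_vec_to_vec to_vec_of_vec)+
  then have dJ: "det (matrix J') \<noteq> 0" using det_nz_iff_inj[OF lJ] by simp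
  have eq: "adjoint A' (J' (A' w)) = J' w" for w
  proof -
    have "v \<bullet> adjoint A' (J' (A' w)) = v \<bullet> J' w" for v
    proof -
      have "v \<bullet> adjoint A' (J' (A' w)) = A' v \<bullet> J' (A' w)"
        by (simp add: adjoint_works[OF lA])
      also have "\<dots> = A (of_vec v) \<bullet> J (A (of_vec w))" by (simp add: A'_def J'_def inner_to_vec)
      also have "\<dots> = v \<bullet> J' w" by (metis J'_def comp_apply inner_to_vec pres to_vec_of_vec)
      finally show ?thesis .
    qed
    then show ?thesis by (metis vector_eq_rdot inner_commute)
  qed
  have "matrix (adjoint A' \<circ> (J' \<circ> A')) = matrix J'"
    using eq by (simp add: fun_eq_iff o_def)
  then have "transpose (matrix A') ** (matrix J' ** matrix A') = matrix J'"
    by (simp add: matrix_compose lA lJ linear_compose adjoint_linear matrix_adjoint)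
  then have "det (matrix A') * (det (matrix J') * det (matrix A')) = det (matrix J')"
    by (metis det_mul det_transpose)
  then have "det (matrix A') * det (matrix A') = 1" using dJ by simp
  then have "\<bar>det (matrix A')\<bar> = 1" by (metis abs_1 abs_mult_self_eq abs_square_eq_1 power2_eq_square)
  then have d: "distr lborel borel A' = lborel" by (rule distr_lborel_det_one[OF lA])
  have [measurable]: "A' \<in> borel_measurable borel" "A \<in> borel_measurable borel"
    using lA A by (auto intro: linear_borel_measurable)
  have "distr (lborel :: 'a measure) borel A = distr (distr lborel borel of_vec) borel A"
    by (simp add: lborel_of_vec)
  also have "\<dots> = distr lborel borel (A \<circ> of_vec)" by (rule distr_distr) measurable
  also have "A \<circ> of_vec = of_vec \<circ> A'" by (simp add: A'_def fun_eq_iff)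
  also have "distr lborel borel (of_vec \<circ> A') = distr (distr lborel borel A') borel of_vec"
    by (rule distr_distr[symmetric]) measurable
  also have "\<dots> = lborel" by (simp add: d lborel_of_vec)
  finally show ?thesis .
qed

lemma emeasure_lorentz_image:
  fixes A :: "'a::euclidean_space \<times> real \<Rightarrow> 'a \<times> real"
  assumes A: "lorentz A" and X: "A ` X \<in> sets borel"
  shows "emeasure lborel (A ` X) = emeasure lborel X"
proof -
  define J :: "'a \<times> real \<Rightarrow> 'a \<times> real" where "J w = (fst w, - snd w)" for w
  have J: "linear J" by (rule linearI) (simp_all add: J_def)
  have "inj J" by (rule injI) (simp add: J_def prod_eq_iff)
  then have d: "distr lborel borel A = lborel"
    using A lorentz_lor[OF A] unfolding lor_eq_inner
    by (intro distr_lborel_form_preserving[OF lorentz_linear[OF A] J]) (simp_all add: J_def)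
  have "A \<in> borel_measurable borel"
    using lorentz_linear[OF A] by (auto intro: linear_borel_measurable)
  then have "emeasure (distr lborel borel A) (A ` X) = emeasure lborel (A -` A ` X)"
    using X by (simp add: emeasure_distr)
  then show ?thesis using lorentz_inj[OF A] d by (simp add: inj_vimage_image_eq)
qed

text \<open>Integrating the height \<open>s\<^sup>d\<close> of horizontal slices of this truncated cone produces the
  density of \<^const>\<open>hvol\<close>, while Lorentz maps permute such cones and have determinant \<open>\<plusminus>1\<close>.\<close>

definition trunc_cone :: "'a::euclidean_space set \<Rightarrow> ('a \<times> real) set" where
  "trunc_cone X = {t *\<^sub>R lift x | t x. x \<in> X \<and> 0 < t \<and> t \<le> 1}"

lemma mem_trunc_cone:
  assumes "X \<subseteq> hyp_space"
  shows "(y, s) \<in> trunc_cone X \<longleftrightarrow>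
    0 < s \<and> (1 / s) *\<^sub>R y \<in> X \<and> s \<le> 1 / sqrt (1 - (norm ((1 / s) *\<^sub>R y))\<^sup>2)"
proof
  assume "(y, s) \<in> trunc_cone X"
  then obtain t x where tx: "x \<in> X" "0 < t" "t \<le> 1" "(y, s) = t *\<^sub>R lift x" by (auto simp: trunc_cone_def)
  define r where "r = 1 / sqrt (1 - (norm x)\<^sup>2)"
  have r: "0 < r" unfolding r_def by (rule lift_factor_pos) (use tx assms in auto)
  have ys: "y = (t * r) *\<^sub>R x" "s = t * r" using tx(4) by (auto simp: lift_def homog_def r_def)
  then have "(1 / s) *\<^sub>R y = x" using r tx by simp
  then show "0 < s \<and> (1 / s) *\<^sub>R y \<in> X \<and> s \<le> 1 / sqrt (1 - (norm ((1 / s) *\<^sub>R y))\<^sup>2)"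
    using tx r ys(2) by (simp add: mult_left_le_one_le flip: r_def)
next
  assume *: "0 < s \<and> (1 / s) *\<^sub>R y \<in> X \<and> s \<le> 1 / sqrt (1 - (norm ((1 / s) *\<^sub>R y))\<^sup>2)"
  define x where "x = (1 / s) *\<^sub>R y"
  define r where "r = 1 / sqrt (1 - (norm x)\<^sup>2)"
  have x: "x \<in> X" and s: "0 < s" "s \<le> r" using * by (auto simp: x_def r_def)
  then have "(y, s) = (s / r) *\<^sub>R lift x"
    by (simp add: lift_def homog_def r_def[symmetric]) (simp add: x_def)
  moreover have "0 < s / r" "s / r \<le> 1" using s by auto
  ultimately show "(y, s) \<in> trunc_cone X" using x unfolding trunc_cone_def by blast
qed

section \<open>Hyperbolic volume as the volume of a truncated cone\<close>

lemma emeasure_scale: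
  fixes Y :: "'a::euclidean_space set"
  assumes "Y \<in> sets borel" "c > 0"
  shows "emeasure lborel Y = ennreal (c ^ DIM('a)) * emeasure lborel {x. c *\<^sub>R x \<in> Y}"
proof -
  have "emeasure lborel Y = emeasure (density (distr lborel borel (\<lambda>x. 0 + c *\<^sub>R x)) (\<lambda>_. ennreal (\<bar>c\<bar> ^ DIM('a)))) Y"
    using lborel_affine[of c "0::'a"] assms by simp
  also have "\<dots> = ennreal (\<bar>c\<bar> ^ DIM('a)) * emeasure (distr lborel borel (\<lambda>x. c *\<^sub>R x)) Y"
    using assms by (simp add: emeasure_density nn_integral_cmult_indicator)
  also have "emeasure (distr lborel borel (\<lambda>x. c *\<^sub>R x)) Y = emeasure lborel {x. c *\<^sub>R x \<in> Y}"
    using assms by (subst emeasure_distr) (auto simp: vimage_def)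
  finally show ?thesis using assms by simp
qed

lemma trunc_cone_borel:
  assumes "X \<in> sets borel" "X \<subseteq> (hyp_space :: 'a::euclidean_space set)"
  shows "trunc_cone X \<in> sets borel"
proof -
  have [measurable]: "X \<in> sets borel" by fact
  have "trunc_cone X = {v \<in> space (borel \<Otimes>\<^sub>M borel). 0 < snd v \<and> (1 / snd v) *\<^sub>R fst v \<in> X \<and>
      snd v \<le> 1 / sqrt (1 - (norm ((1 / snd v) *\<^sub>R fst v))\<^sup>2)}"
    using mem_trunc_cone[OF assms(2)] by (auto simp: space_pair_measure)
  also have "\<dots> \<in> sets (borel \<Otimes>\<^sub>M borel)" by measurable
  finally show ?thesis by (simp only: borel_prod)
qed

lemma emeasure_hvol:
  fixes X :: "'a::euclidean_space set"
  assumes X: "X \<in> sets borel"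
  shows "emeasure hvol X = (\<integral>\<^sup>+x. (indicator hyp_space x *
    ennreal ((1 - (norm x)\<^sup>2) powr (- (real DIM('a) + 1) / 2))) * indicator X x \<partial>lborel)"
proof -
  have [measurable]: "(hyp_space :: 'a set) \<in> sets borel" by (rule borel_open) simp
  show ?thesis unfolding hvol_def using X by (intro emeasure_density) simp_all
qed

lemma hvol_eq_trunc_cone:
  fixes X :: "'a::euclidean_space set"
  assumes X: "X \<in> sets borel" "X \<subseteq> hyp_space"
  shows "emeasure hvol X = ennreal (real (Suc DIM('a))) * emeasure lborel (trunc_cone X)"
proof -
  let ?d = "DIM('a)"
  define r where "r x = 1 / sqrt (1 - (norm (x::'a))\<^sup>2)" for x
  note [measurable] = X(1)
  have [measurable]: "r \<in> borel_measurable borel" unfolding r_def by measurable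
  have tc [measurable]: "trunc_cone X \<in> sets (lborel \<Otimes>\<^sub>M lborel)"
    using trunc_cone_borel[OF X] by (metis lborel_prod sets_lborel)
  have "emeasure lborel (trunc_cone X) = emeasure (lborel \<Otimes>\<^sub>M lborel) (trunc_cone X)"
    by (simp add: lborel_prod)
  also have "\<dots> = (\<integral>\<^sup>+s. emeasure lborel ((\<lambda>y. (y, s)) -` trunc_cone X) \<partial>lborel)"
    by (rule lborel_pair.emeasure_pair_measure_alt2[OF tc])
  \<comment> \<open>The slice at height \<open>s\<close> is the set of those \<open>x\<close> in
    \<open>X\<close> with \<open>s \<le> r x\<close>, scaled by \<open>s\<close>; hence the factor
    \<open>s ^ ?d\<close>. After the exchange of integrals, integration over \<open>s\<close> up to
    \<open>r x\<close> gives \<open>r x ^ Suc ?d / Suc ?d\<close>, and \<open>r x ^ Suc ?d\<close>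
    is the density of \<open>hvol\<close>.\<close>
  also have "\<dots> = (\<integral>\<^sup>+s. (\<integral>\<^sup>+x. ennreal (s ^ ?d) * (indicator X x * indicator {0<..r x} s) \<partial>lborel) \<partial>lborel)"
  proof (rule nn_integral_cong)
    fix s :: real
    show "emeasure lborel ((\<lambda>y. (y, s)) -` trunc_cone X) = (\<integral>\<^sup>+x. ennreal (s ^ ?d) * (indicator X x * indicator {0<..r x} s) \<partial>lborel)"
    proof (cases "s > 0")
      case True
      have m: "(\<lambda>y. (y, s)) -` trunc_cone X \<in> sets borel" using sets_Pair2[OF tc] by simp
      have [measurable]: "{x. s *\<^sub>R x \<in> (\<lambda>y. (y, s)) -` trunc_cone X} \<in> sets borel"
        using measurable_sets[of "\<lambda>x::'a. s *\<^sub>R x" borel borel, OF _ m] by (simp add: vimage_def)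
      have "{x. s *\<^sub>R x \<in> (\<lambda>y. (y, s)) -` trunc_cone X} = {x \<in> X. s \<le> r x}"
        using True mem_trunc_cone[OF X(2)] by (auto simp: r_def)
      then have "emeasure lborel ((\<lambda>y. (y, s)) -` trunc_cone X) = ennreal (s ^ ?d) * emeasure lborel {x \<in> X. s \<le> r x}"
        using emeasure_scale[OF m True] by simp
      also have "emeasure lborel {x \<in> X. s \<le> r x} = (\<integral>\<^sup>+x. indicator {x \<in> X. s \<le> r x} x \<partial>lborel)"
        by (rule nn_integral_indicator[symmetric]) simp
      also have "ennreal (s ^ ?d) * \<dots> = (\<integral>\<^sup>+x. ennreal (s ^ ?d) * indicator {x \<in> X. s \<le> r x} x \<partial>lborel)"
        by (rule nn_integral_cmult[symmetric]) simp
      also have "\<dots> = (\<integral>\<^sup>+x. ennreal (s ^ ?d) * (indicator X x * indicator {0<..r x} s) \<partial>lborel)"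
        using True by (intro nn_integral_cong) (auto split: split_indicator)
      finally show ?thesis .
    next
      case False
      then have "(\<lambda>y. (y, s)) -` trunc_cone X = {}" using mem_trunc_cone[OF X(2)] by auto
      then show ?thesis using False by simp
    qed
  qed
  also have "\<dots> = (\<integral>\<^sup>+x. (\<integral>\<^sup>+s. ennreal (s ^ ?d) * (indicator X x * indicator {0<..r x} s) \<partial>lborel) \<partial>lborel)"
  proof (rule lborel_pair.Fubini')
    have "(\<lambda>(x, s). ennreal (s ^ ?d) * (indicator X x * indicator {0<..r x} s))
        = (\<lambda>v. ennreal (snd v ^ ?d) * (indicator X (fst v) * (if 0 < snd v \<and> snd v \<le> r (fst v) then 1 else 0)))"
      by (auto simp: fun_eq_iff indicator_def)
    also have "\<dots> \<in> borel_measurable (lborel \<Otimes>\<^sub>M lborel)" by measurable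
    finally show "(\<lambda>(x, s). ennreal (s ^ ?d) * (indicator X x * indicator {0<..r x} s))
      \<in> borel_measurable (lborel \<Otimes>\<^sub>M lborel)" .
  qed
  also have "\<dots> = (\<integral>\<^sup>+x. indicator X x * ennreal (r x ^ Suc ?d / Suc ?d) \<partial>lborel)"
  proof (rule nn_integral_cong)
    fix x :: 'a
    show "(\<integral>\<^sup>+s. ennreal (s ^ ?d) * (indicator X x * indicator {0<..r x} s) \<partial>lborel) = indicator X x * ennreal (r x ^ Suc ?d / Suc ?d)"
    proof (cases "x \<in> X")
      case True
      then have r: "0 < r x" using X lift_factor_pos[of x] by (auto simp: r_def)
      have "(\<integral>\<^sup>+s. ennreal (s ^ ?d) * (indicator X x * indicator {0<..r x} s) \<partial>lborel)
          = (\<integral>\<^sup>+s. ennreal (s ^ ?d) * indicator {0..r x} s \<partial>lborel)"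
        using True by (intro nn_integral_cong) (auto split: split_indicator simp: power_0_left)
      also have "\<dots> = r x ^ Suc ?d / Suc ?d - 0 ^ Suc ?d / Suc ?d"
      proof (rule nn_integral_FTC_Icc[where F = "\<lambda>s. s ^ Suc ?d / real (Suc ?d)" and f = "\<lambda>s. s ^ ?d"])
        fix s :: real
        have "DERIV (\<lambda>s. s ^ Suc ?d / real (Suc ?d)) s :> real (Suc ?d) * s ^ ?d / real (Suc ?d)"
          using DERIV_cdivide[OF DERIV_pow[of "Suc ?d" s], of "real (Suc ?d)" UNIV]
          by (simp only: diff_Suc_Suc diff_zero)
        then show "DERIV (\<lambda>s. s ^ Suc ?d / real (Suc ?d)) s :> s ^ ?d" by (simp del: power_Suc)
      qed (use r in auto)
      finally show ?thesis using True by simp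
    qed simp
  qed
  finally have tcone: "emeasure lborel (trunc_cone X) = (\<integral>\<^sup>+x. indicator X x * ennreal (r x ^ Suc ?d / Suc ?d) \<partial>lborel)" .
  have "ennreal (real (Suc ?d)) * emeasure lborel (trunc_cone X)
      = (\<integral>\<^sup>+x. ennreal (real (Suc ?d)) * (indicator X x * ennreal (r x ^ Suc ?d / Suc ?d)) \<partial>lborel)"
    unfolding tcone by (rule nn_integral_cmult[symmetric]) measurable
  also have "\<dots> = (\<integral>\<^sup>+x. (indicator hyp_space x * ennreal ((1 - (norm x)\<^sup>2) powr (- (real ?d + 1) / 2))) * indicator X x \<partial>lborel)"
  proof (rule nn_integral_cong)
    fix x :: 'a
    show "ennreal (real (Suc ?d)) * (indicator X x * ennreal (r x ^ Suc ?d / Suc ?d))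
      = (indicator hyp_space x * ennreal ((1 - (norm x)\<^sup>2) powr (- (real ?d + 1) / 2))) * indicator X x"
    proof (cases "x \<in> X")
      case True
      then have xb: "x \<in> hyp_space" using X by blast
      have p: "0 < 1 - (norm x)\<^sup>2" using ball_norm_less[OF xb] .
      have "(1 - (norm x)\<^sup>2) powr (- (1 / 2)) = inverse (sqrt (1 - (norm x)\<^sup>2))"
        unfolding powr_minus using powr_half_sqrt[OF less_imp_le[OF p]] by simp
      then have r': "r x = (1 - (norm x)\<^sup>2) powr (- (1 / 2))"
        by (simp add: r_def inverse_eq_divide)
      have "0 < r x" unfolding r_def by (rule lift_factor_pos[OF xb])
      then have "r x ^ Suc ?d = r x powr real (Suc ?d)" by (rule powr_realpow[symmetric])
      also have "\<dots> = (1 - (norm x)\<^sup>2) powr (- (1 / 2) * real (Suc ?d))"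
        unfolding r' by (rule powr_powr)
      also have "- (1 / 2) * real (Suc ?d) = - (real ?d + 1) / 2" by (simp add: field_simps)
      finally have rx: "r x ^ Suc ?d = (1 - (norm x)\<^sup>2) powr (- (real ?d + 1) / 2)" .
      have "ennreal (real (Suc ?d)) * ennreal (r x ^ Suc ?d / Suc ?d) = ennreal (real (Suc ?d) * (r x ^ Suc ?d / Suc ?d))"
        by (rule ennreal_mult'[symmetric]) simp
      also have "real (Suc ?d) * (r x ^ Suc ?d / Suc ?d) = r x ^ Suc ?d"
        by (simp del: power_Suc of_nat_Suc)
      finally show ?thesis using True xb by (simp only: indicator_simps mult_1_left mult_1_right rx)
    qed simp
  qed
  also have "\<dots> = emeasure hvol X"
    by (rule emeasure_hvol[OF X(1), symmetric])
  finally show ?thesis ..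
qed

lemma isometry_image_trunc_cone:
  assumes "\<And>x. x \<in> X \<Longrightarrow> lift (f x) = A (lift x)" "linear A"
  shows "trunc_cone (f ` X) = A ` trunc_cone X"
proof -
  have "A (t *\<^sub>R lift x) = t *\<^sub>R lift (f x)" if "x \<in> X" for t x
    using that by (simp add: assms(1) linear_scale[OF assms(2)])
  note A = this
  show ?thesis
  proof
    show "trunc_cone (f ` X) \<subseteq> A ` trunc_cone X"
    proof
      fix v assume "v \<in> trunc_cone (f ` X)"
      then obtain t x where tx: "x \<in> X" "0 < t" "t \<le> 1" "v = t *\<^sub>R lift (f x)"
        unfolding trunc_cone_def by blast
      then have "v = A (t *\<^sub>R lift x)" "t *\<^sub>R lift x \<in> trunc_cone X"
        using A by (auto simp: trunc_cone_def)
      then show "v \<in> A ` trunc_cone X" by blast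
    qed
    show "A ` trunc_cone X \<subseteq> trunc_cone (f ` X)"
    proof
      fix v assume "v \<in> A ` trunc_cone X"
      then obtain t x where tx: "x \<in> X" "0 < t" "t \<le> 1" "v = A (t *\<^sub>R lift x)"
        unfolding trunc_cone_def by blast
      then have "v = t *\<^sub>R lift (f x)" using A by simp
      then show "v \<in> trunc_cone (f ` X)" unfolding trunc_cone_def using tx by blast
    qed
  qed
qed

lemma hvol_isometry_image:
  fixes f :: "'a::euclidean_space \<Rightarrow> 'a"
  assumes f: "f \<in> hyp_isom" and X: "X \<in> sets borel" "X \<subseteq> hyp_space" and fX: "f ` X \<in> sets borel"
  shows "emeasure hvol (f ` X) = emeasure hvol X"
proof -
  obtain A where A: "lorentz A" "\<And>x. x \<in> hyp_space \<Longrightarrow> lift (f x) = A (lift x)"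
    using isometry_lorentz[OF f] by blast
  have fXs: "f ` X \<subseteq> hyp_space" using f X by (auto simp: hyp_isom_def Bij_def bij_betw_def)
  have tc: "trunc_cone (f ` X) = A ` trunc_cone X"
    using A X by (intro isometry_image_trunc_cone lorentz_linear) auto
  then have "A ` trunc_cone X \<in> sets borel" using trunc_cone_borel[OF fX fXs] by simp
  then show ?thesis
    using hvol_eq_trunc_cone[OF X] hvol_eq_trunc_cone[OF fX fXs] emeasure_lorentz_image[OF A(1)]
    by (simp add: tc)
qed

text \<open>On the ball \<open>f\<close> coincides with the projective map induced by its Lorentz
  map, which is Borel as a quotient of affine functions.\<close>

lemma isometry_borel:
  fixes f :: "'a::euclidean_space \<Rightarrow> 'a"
  assumes f: "f \<in> hyp_isom" and X: "X \<in> sets borel"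
  shows "{x \<in> hyp_space. f x \<in> X} \<in> sets borel"
proof -
  obtain A where A: "lorentz A" "\<And>x. x \<in> hyp_space \<Longrightarrow> lift (f x) = A (lift x)"
    using isometry_lorentz[OF f] by blast
  have [measurable]: "A \<in> borel_measurable borel"
    using lorentz_linear[OF A(1)] by (auto intro: linear_borel_measurable)
  have hm [measurable]: "(homog :: 'a \<Rightarrow> _) \<in> borel_measurable borel"
    unfolding homog_def[abs_def] by (intro borel_measurable_continuous_onI continuous_intros)
  have fs [measurable]: "(fst :: 'a \<times> real \<Rightarrow> 'a) \<in> borel_measurable borel" "(snd :: 'a \<times> real \<Rightarrow> real) \<in> borel_measurable borel"
    by (intro borel_measurable_continuous_onI continuous_intros)+
  define g where "g x = (1 / snd (A (homog x))) *\<^sub>R fst (A (homog x))" for x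
  have [measurable]: "g \<in> borel_measurable borel" unfolding g_def by measurable
  have "f x = g x" if x: "x \<in> hyp_space" for x
  proof -
    have fx: "f x \<in> hyp_space" using f x by (auto simp: hyp_isom_def Bij_def bij_betw_def)
    obtain a b where ab: "0 < a" "lift x = a *\<^sub>R homog x" "0 < b" "lift (f x) = b *\<^sub>R homog (f x)"
      using lift_scaleE[OF x] lift_scaleE[OF fx] by metis
    have "b *\<^sub>R homog (f x) = a *\<^sub>R A (homog x)"
      using A(2)[OF x] ab linear_scale[OF lorentz_linear[OF A(1)]] by simp
    then have "(1 / a) *\<^sub>R (a *\<^sub>R A (homog x)) = (1 / a) *\<^sub>R (b *\<^sub>R homog (f x))" by simp
    then have "A (homog x) = (b / a) *\<^sub>R homog (f x)" using ab by simp
    then show ?thesis using ab by (simp add: g_def)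
  qed
  then have "{x \<in> hyp_space. f x \<in> X} = hyp_space \<inter> (g -` X \<inter> space borel)" by auto
  also have "\<dots> \<in> sets borel" using X by measurable
  finally show ?thesis .
qed

text \<open>In the cone over a small spherical cap about \<xi>, the shell of Euclidean thickness
  \<open>a\<close> below the sphere has Euclidean volume at least \<open>a * m\<close>. There 1 -
  |x|^2 is at most \<open>2 * a\<close>, and since the density is this quantity to a power at most
  -2, it is at least 1 / (4 a^2). The resulting bound \<open>m / (4 * a)\<close> is unbounded as
  \<open>a\<close> tends to 0.\<close>

lemma hvol_boundary_cap:
  fixes \<xi> :: "'a::euclidean_space"
  assumes \<xi>: "norm \<xi> = 1" and r: "0 < r" and d: "3 \<le> DIM('a)"
  shows "emeasure hvol (ball \<xi> r \<inter> hyp_space) = \<infinity>"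
proof -
  let ?d = "DIM('a)"
  define K where "K \<rho> = {x. x \<noteq> 0 \<and> norm x < \<rho> \<and> norm ((1 / norm x) *\<^sub>R x - \<xi>) < r / 2}" for \<rho>
  have oK: "open (K \<rho>)" for \<rho>
  proof -
    have "continuous_on {x::'a. x \<noteq> 0} (\<lambda>x. norm ((1 / norm x) *\<^sub>R x - \<xi>))"
      by (intro continuous_intros) auto
    then have "open ({x::'a. x \<noteq> 0} \<inter> (\<lambda>x. norm ((1 / norm x) *\<^sub>R x - \<xi>)) -` {..<r/2})"
      by (intro continuous_open_preimage) (auto simp: open_Collect_neq)
    moreover have "K \<rho> = ({x::'a. x \<noteq> 0} \<inter> (\<lambda>x. norm ((1 / norm x) *\<^sub>R x - \<xi>)) -` {..<r/2}) \<inter> ball 0 \<rho>"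
      by (auto simp: K_def)
    ultimately show ?thesis by auto
  qed
  then have mK [measurable]: "K \<rho> \<in> sets borel" for \<rho> by (rule borel_open)
  define m where "m = measure lborel (K 1)"
  have finK: "emeasure lborel (K \<rho>) < \<infinity>" for \<rho>
  proof -
    have "emeasure lborel (K \<rho>) \<le> emeasure lborel (cball (0::'a) \<rho>)" by (rule emeasure_mono) (auto simp: K_def)
    also have "\<dots> < \<infinity>" by (rule emeasure_bounded_finite) simp
    finally show ?thesis .
  qed
  have K1: "emeasure lborel (K 1) = ennreal m"
    unfolding m_def using finK[of 1] by (simp add: emeasure_eq_ennreal_measure)
  have "(1/2) *\<^sub>R \<xi> \<in> K 1" using \<xi> r by (auto simp: K_def)
  then have "\<not> negligible (K 1)" using oK[of 1] open_not_negligible by blast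
  then have "emeasure lborel (K 1) \<noteq> 0"
    using null_sets_completionI[of "K 1" lborel] mK[of 1]
    by (auto simp: negligible_iff_null_sets null_sets_def[of lborel])
  then have m: "m > 0" using K1 by (simp add: m_def zero_less_measure_iff)
  have Kscale: "emeasure lborel (K \<rho>) = ennreal (\<rho> ^ ?d * m)" if "0 < \<rho>" for \<rho>
  proof -
    have "{x. \<rho> *\<^sub>R x \<in> K \<rho>} = K 1" using that by (auto simp: K_def)
    then show ?thesis using emeasure_scale[OF mK that, of \<rho>] that m by (simp add: K1 ennreal_mult)
  qed
  have shell: "ennreal (m / (4 * a)) \<le> emeasure hvol (ball \<xi> r \<inter> hyp_space)"
    if a: "0 < a" "a < 1/2" "a < r / 2" for a
  proof -
    let ?S = "K 1 - K (1 - a)"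
    have "emeasure lborel ?S = emeasure lborel (K 1) - emeasure lborel (K (1 - a))"
    proof (rule emeasure_Diff)
      show "K (1 - a) \<subseteq> K 1" using a by (auto simp: K_def)
    qed (use finK[of "1 - a"] in \<open>auto simp: less_top\<close>)
    also have "\<dots> = ennreal (m - (1 - a) ^ ?d * m)" using a m by (simp add: K1 Kscale ennreal_minus)
    finally have eS: "emeasure lborel ?S = ennreal (m - (1 - a) ^ ?d * m)" .
    have "(1 - a) ^ ?d \<le> (1 - a) ^ 1" using a d by (intro power_decreasing) auto
    then have "(1 - a) ^ ?d * m \<le> (1 - a) * m" using m by simp
    then have le: "a * m \<le> m - (1 - a) ^ ?d * m" by (simp add: algebra_simps)
    have "ennreal (m / (4 * a)) \<le> ennreal ((1 / (4 * a\<^sup>2)) * (m - (1 - a) ^ ?d * m))"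
    proof (rule ennreal_leI)
      have "m / (4 * a) = (1 / (4 * a\<^sup>2)) * (a * m)" using a by (simp add: power2_eq_square)
      also have "\<dots> \<le> (1 / (4 * a\<^sup>2)) * (m - (1 - a) ^ ?d * m)" using le by (intro mult_left_mono) auto
      finally show "m / (4 * a) \<le> (1 / (4 * a\<^sup>2)) * (m - (1 - a) ^ ?d * m)" .
    qed
    also have "\<dots> = ennreal (1 / (4 * a\<^sup>2)) * emeasure lborel ?S"
      unfolding eS by (rule ennreal_mult') simp
    also have "\<dots> = (\<integral>\<^sup>+x. ennreal (1 / (4 * a\<^sup>2)) * indicator ?S x \<partial>lborel)"
      by (rule nn_integral_cmult_indicator[symmetric]) simp
    also have "\<dots> \<le> (\<integral>\<^sup>+x. (indicator hyp_space x * ennreal ((1 - (norm x)\<^sup>2) powr (- (real ?d + 1) / 2)))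
        * indicator (ball \<xi> r \<inter> hyp_space) x \<partial>lborel)"
    proof (rule nn_integral_mono)
      fix x :: 'a
      show "ennreal (1 / (4 * a\<^sup>2)) * indicator ?S x \<le> (indicator hyp_space x * ennreal ((1 - (norm x)\<^sup>2) powr (- (real ?d + 1) / 2)))
        * indicator (ball \<xi> r \<inter> hyp_space) x"
      proof (cases "x \<in> ?S")
        case True
        then have x: "x \<noteq> 0" "norm x < 1" "norm ((1 / norm x) *\<^sub>R x - \<xi>) < r / 2" "1 - a \<le> norm x"
          by (auto simp: K_def)
        have "norm (x - (1 / norm x) *\<^sub>R x) = norm ((1 - 1 / norm x) *\<^sub>R x)"
          by (simp add: scaleR_left_diff_distrib)
        also have "\<dots> = \<bar>1 - 1 / norm x\<bar> * \<bar>norm x\<bar>" by simp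
        also have "\<dots> = \<bar>norm x - 1\<bar>"
          unfolding abs_mult[symmetric] using x(1) by (simp add: left_diff_distrib)
        also have "\<dots> \<le> a" using x by simp
        finally have "norm (x - (1 / norm x) *\<^sub>R x) \<le> a" .
        then have "norm (x - \<xi>) < r"
          using norm_triangle_ineq[of "x - (1 / norm x) *\<^sub>R x" "(1 / norm x) *\<^sub>R x - \<xi>"] x a by simp
        then have inb: "x \<in> ball \<xi> r \<inter> hyp_space" using x by (simp add: dist_norm norm_minus_commute)
        define t where "t = 1 - (norm x)\<^sup>2"
        have "t = (1 - norm x) * (1 + norm x)" by (simp add: t_def power2_eq_square algebra_simps)
        also have "\<dots> \<le> a * 2" using x a by (intro mult_mono) auto
        finally have t: "t \<le> 2 * a" by simp
        have t0: "0 < t" using ball_norm_less[of x] x by (simp add: t_def)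
        have "1 / (4 * a\<^sup>2) = inverse ((2 * a)\<^sup>2)" by (simp add: inverse_eq_divide power_mult_distrib)
        also have "\<dots> = (2 * a) powr (- 2)" using a by (simp add: powr_minus powr_numeral)
        also have "\<dots> \<le> t powr (- 2)" using t t0 by (intro powr_mono2') auto
        also have "\<dots> \<le> t powr (- (real ?d + 1) / 2)"
          using t t0 a d by (intro powr_mono') auto
        finally have "ennreal (1 / (4 * a\<^sup>2)) \<le> ennreal (t powr (- (real ?d + 1) / 2))" by (rule ennreal_leI)
        then show ?thesis using True inb unfolding t_def by (simp add: indicator_def)
      qed simp
    qed
    also have "\<dots> = emeasure hvol (ball \<xi> r \<inter> hyp_space)"
      by (rule emeasure_hvol[symmetric]) simp
    finally show ?thesis .
  qed
  show ?thesis
  proof (rule ccontr)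
    assume fin: "emeasure hvol (ball \<xi> r \<inter> hyp_space) \<noteq> \<infinity>"
    then obtain M where M: "emeasure hvol (ball \<xi> r \<inter> hyp_space) = ennreal M" "0 \<le> M"
      by (cases "emeasure hvol (ball \<xi> r \<inter> hyp_space)") auto
    \<comment> \<open>The last term of the minimum makes \<open>m / (4 * a)\<close> at least
      \<open>2 * (M + 1)\<close>.\<close>
    define a where "a = min (min (1/4) (r/4)) (m / (8 * (M + 1)))"
    have a: "0 < a" "a < 1/2" "a < r/2" "a \<le> m / (8 * (M + 1))" using r m M by (auto simp: a_def)
    have "m / (4 * a) \<le> M" using shell[OF a(1-3)] M by simp
    then have "m \<le> M * (4 * a)" using a by (simp add: pos_divide_le_eq)
    also have "\<dots> \<le> (M + 1) * (4 * a)" using a by simp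
    also have "\<dots> \<le> (M + 1) * (4 * (m / (8 * (M + 1))))" using a M by (intro mult_left_mono) auto
    also have "\<dots> = m / 2" using M by (simp add: field_simps)
    finally show False using m by simp
  qed
qed

section \<open>Dirichlet tilings\<close>

lemma homog_convex: "homog ((1 - t) *\<^sub>R x + t *\<^sub>R y) = (1 - t) *\<^sub>R homog x + t *\<^sub>R homog y"
  by (simp add: homog_def)

lemma continuous_lor_homog: "continuous_on S (\<lambda>x. lor (homog x) u)"
  by (simp add: lor_hom) (intro continuous_intros)

lemma open_lor_halfspace: "open {x. 0 < lor (homog x) w}"
  using continuous_lor_homog[of UNIV w] by (intro open_Collect_less continuous_on_const) auto

lemma convex_lor_halfspace: "convex {x. 0 \<le> lor (homog x) u}"
  using convex_halfspace_ge[of "snd u" "fst u"] by (simp add: lor_hom)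

text \<open>With zero space part the pairing with \<open>homog z\<close> would be the same for all
  \<open>z\<close>, yet it is positive at \<open>x\<close> and negative at \<open>y\<close>. Thus a
  bisector is a proper affine hyperplane.\<close>

lemma lor_diff_lift_ne: 
  assumes "x \<in> hyp_space" "y \<in> hyp_space" "x \<noteq> y"
  shows "fst (lift x - lift y) \<noteq> 0"
proof
  assume z: "fst (lift x - lift y) = 0"
  have "0 < lor (homog x) (lift x - lift y)" "0 < lor (homog y) (lift y - lift x)"
    using lor_lift_diff_pos assms by (metis, metis)
  then show False using z by (simp add: lor_hom)
qed

text \<open>A line meets the quadric \<open>lor v v = -1\<close> in at most two points. Consequently
  the bisector and one centre determine the other centre.\<close>

lemma lift_collinear:
  assumes x: "x \<in> hyp_space" "y \<in> hyp_space" "z \<in> hyp_space" and ne: "x \<noteq> y" "x \<noteq> z"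
    and l: "lift x - lift z = c *\<^sub>R (lift x - lift y)"
  shows "y = z"
proof -
  define m where "m = - 1 - lor (lift x) (lift y)"
  have "lor (lift x) (lift y) \<noteq> -1" using lor_lift_le(2) x ne by blast
  then have m: "m \<noteq> 0" by (simp add: m_def)
  have zz: "lift z = lift x - c *\<^sub>R (lift x - lift y)" using l by (simp add: algebra_simps)
  have "lor (lift z) (lift z) = - 1 - 2 * c * m + 2 * c * c * m"
    unfolding zz using lor_lift_self[OF x(1)] lor_lift_self[OF x(2)]
    by (simp add: lor_simps m_def lor_commute[of "lift y" "lift x"] algebra_simps)
  then have "c * (c - 1) * m = 0" using lor_lift_self[OF x(3)] by (simp add: algebra_simps)
  then have "c = 0 \<or> c = 1" using m by simp
  moreover have "c \<noteq> 0"
  proof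
    assume "c = 0"
    then have "lift x = lift z" using l by simp
    then show False using lift_inj[OF x(1,3)] ne by blast
  qed
  ultimately have "lift z = lift y" using zz by simp
  then show ?thesis using lift_inj x by blast
qed

text \<open>Take a subfamily of least cardinality with the same solutions in \<open>U\<close>. If
  \<open>i\<close> is dropped, some \<open>x\<close> in \<open>U\<close> satisfies the other
  constraints and violates \<open>i\<close>; the segment from \<open>p\<close>, where all
  constraints are strict, to \<open>x\<close> crosses the hyperplane of \<open>i\<close> at the
  required \<open>y\<close>.\<close>

lemma irredundant_subfamily:
  assumes "finite A0" "convex U" "p \<in> U" and pos: "\<And>i. i \<in> A0 \<Longrightarrow> 0 < lor (homog p) (u i)"
  obtains A where "A \<subseteq> A0"
    "\<And>x i. \<lbrakk>x \<in> U; \<forall>i\<in>A. 0 \<le> lor (homog x) (u i); i \<in> A0\<rbrakk> \<Longrightarrow> 0 \<le> lor (homog x) (u i)"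
    "\<And>i. i \<in> A \<Longrightarrow> \<exists>y\<in>U. lor (homog y) (u i) = 0 \<and> (\<forall>j\<in>A - {i}. 0 < lor (homog y) (u j))"
proof -
  define Q where "Q A \<longleftrightarrow> A \<subseteq> A0 \<and> (\<forall>x\<in>U. (\<forall>i\<in>A. 0 \<le> lor (homog x) (u i)) \<longrightarrow> (\<forall>i\<in>A0. 0 \<le> lor (homog x) (u i)))" for A
  have "Q A0" by (simp add: Q_def)
  then obtain A where A: "Q A" and "\<forall>B. Q B \<longrightarrow> card A \<le> card B"
    using ex_has_least_nat[of Q A0 card] by blast
  then have min: "\<not> Q B" if "card B < card A" for B using that not_le by blast
  have finA: "finite A" using A assms(1) finite_subset by (auto simp: Q_def)
  have irr: "\<exists>y\<in>U. lor (homog y) (u i) = 0 \<and> (\<forall>j\<in>A - {i}. 0 < lor (homog y) (u j))" if i: "i \<in> A" for i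
  proof -
    have "\<not> Q (A - {i})" using min card_Diff1_less[OF finA i] by blast
    then obtain x k where x: "x \<in> U" "\<forall>j\<in>A - {i}. 0 \<le> lor (homog x) (u j)" "k \<in> A0" "lor (homog x) (u k) < 0"
      using A by (auto simp: Q_def not_le)
    have neg: "lor (homog x) (u i) < 0"
    proof (rule ccontr)
      assume "\<not> ?thesis"
      then have "\<forall>j\<in>A. 0 \<le> lor (homog x) (u j)" using x(2) by (auto simp: not_less)
      then have "0 \<le> lor (homog x) (u k)" using A x(1,3) unfolding Q_def by blast
      then show False using x(4) by simp
    qed
    define a where "a = lor (homog p) (u i)"
    define b where "b = - lor (homog x) (u i)"
    have a: "0 < a" and b: "0 < b" using pos neg i A by (auto simp: a_def b_def Q_def)
    define t where "t = a / (a + b)"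
    have t: "0 < t" "t < 1" using a b by (auto simp: t_def)
    define y where "y = (1 - t) *\<^sub>R p + t *\<^sub>R x"
    have y: "lor (homog y) w = (1 - t) * lor (homog p) w + t * lor (homog x) w" for w
      by (simp only: y_def homog_convex lor_simps)
    have "lor (homog y) (u i) = (1 - t) * a - t * b" by (simp add: y a_def b_def)
    also have "\<dots> = 0" using a b by (simp add: t_def field_simps)
    finally have "lor (homog y) (u i) = 0" .
    moreover have "0 < lor (homog y) (u j)" if j: "j \<in> A - {i}" for j
      unfolding y using t j x pos[of j] A by (intro add_pos_nonneg) (auto simp: Q_def)
    moreover have "y \<in> U" using assms(2,3) x t unfolding y_def by (intro convexD) auto
    ultimately show ?thesis by blast
  qed
  have Q: "0 \<le> lor (homog x) (u i)" if "x \<in> U" "\<forall>i\<in>A. 0 \<le> lor (homog x) (u i)" "i \<in> A0" for x i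
    using A that unfolding Q_def by blast
  have "A \<subseteq> A0" using A unfolding Q_def by blast
  then show ?thesis using Q irr by (rule that)
qed

text \<open>The rays over \<open>F\<close> span a linear hyperplane, and its orthogonal complement
  for the nondegenerate form is a line.\<close>

lemma lor_hyperplane_unique:
  fixes u v :: "'a::euclidean_space \<times> real"
  assumes F: "aff_dim F = int DIM('a) - 1"
    and u: "\<And>x. x \<in> F \<Longrightarrow> lor (homog x) u = 0" "u \<noteq> 0" and v: "\<And>x. x \<in> F \<Longrightarrow> lor (homog x) v = 0"
  obtains c where "v = c *\<^sub>R u"
proof -
  have dF: "dim (homog ` F) = DIM('a)" using F by (simp add: dim_hom)
  have "span (homog ` F) \<noteq> UNIV"
  proof
    assume "span (homog ` F) = UNIV"
    then have "dim (homog ` F) = dim (UNIV :: ('a \<times> real) set)" by (metis dim_span)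
    then show False using dF by simp
  qed
  then obtain w where w: "w \<notin> span (homog ` F)" by blast
  have "dim (insert w (homog ` F)) = DIM('a \<times> real)" using dF w by (simp add: dim_insert)
  then have full: "span (insert w (homog ` F)) = UNIV" by (simp only: dim_eq_full)
  have zero: "z = 0" if z: "lor w z = 0" "\<And>x. x \<in> F \<Longrightarrow> lor (homog x) z = 0" for z
  proof (rule lor_nondegenerate)
    fix y
    have "lor y z = 0" using full z by (intro lor_span_zero[of y "insert w (homog ` F)"]) auto
    then show "lor z y = 0" by (simp add: lor_commute)
  qed
  have wu: "lor w u \<noteq> 0" using zero u by blast
  have "v - (lor w v / lor w u) *\<^sub>R u = 0"
    by (rule zero) (use wu u v in \<open>simp_all add: lor_simps\<close>)
  then show ?thesis using that by simp
qed

text \<open>Total boundedness is used for one \<open>x\<close> at a time, each time keeping an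
  infinite part of \<open>S\<close>. In \<open>finite_ctr_bounded\<close> it provides two group
  elements that nearly agree on the test points.\<close>

lemma infinite_pigeonhole_bounded:
  fixes f :: "'i \<Rightarrow> 'g \<Rightarrow> 'e::heine_borel"
  assumes "finite X" "infinite S" and bdd: "\<And>x. x \<in> X \<Longrightarrow> bounded (f x ` S)" and \<delta>: "0 < \<delta>"
  shows "\<exists>S'\<subseteq>S. infinite S' \<and> (\<forall>g\<in>S'. \<forall>h\<in>S'. \<forall>x\<in>X. dist (f x g) (f x h) < \<delta>)"
  using assms(1,3)
proof (induction X)
  case empty
  then show ?case using assms(2) by blast
next
  case (insert x X)
  then obtain S' where S': "S' \<subseteq> S" "infinite S'" "\<forall>g\<in>S'. \<forall>h\<in>S'. \<forall>x\<in>X. dist (f x g) (f x h) < \<delta>"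
    by (metis insertI2)
  have "compact (closure (f x ` S))" using insert.prems by (simp add: compact_closure)
  then obtain K where K: "finite K" "closure (f x ` S) \<subseteq> (\<Union>c\<in>K. ball c (\<delta>/2))"
    using compact_eq_totally_bounded[of "closure (f x ` S)"] \<delta> by (meson half_gt_zero)
  have "S' \<subseteq> (\<Union>c\<in>K. {g \<in> S'. f x g \<in> ball c (\<delta>/2)})"
    using K(2) S'(1) closure_subset[of "f x ` S"] by fastforce
  then have "\<exists>c\<in>K. infinite {g \<in> S'. f x g \<in> ball c (\<delta>/2)}"
    using K(1) S'(2) by (meson finite_UN finite_subset)
  then obtain c where c: "infinite {g \<in> S'. f x g \<in> ball c (\<delta>/2)}" by blast
  have "dist (f x g) (f x h) < \<delta>" if "f x g \<in> ball c (\<delta>/2)" "f x h \<in> ball c (\<delta>/2)" for g h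
    using that dist_triangle_half_r[of c "f x g" \<delta> "f x h"] by (simp add: dist_commute)
  then show ?case using c S' by (intro exI[of _ "{g \<in> S'. f x g \<in> ball c (\<delta>/2)}"]) auto
qed

section \<open>Estimates for heights and distances\<close>

lemma snd_lift: "snd (lift x) = 1 / sqrt (1 - (norm x)\<^sup>2)"
  by (simp add: lift_def)

lemma lift_eq_snd: "lift x = snd (lift x) *\<^sub>R homog x"
  unfolding snd_lift by (simp only: lift_def)

lemma snd_lift_ge: "x \<in> hyp_space \<Longrightarrow> 1 \<le> snd (lift x)"
  using ball_norm_less[of x] by (simp add: snd_lift)

lemma norm_lift_le: "x \<in> hyp_space \<Longrightarrow> norm (lift x) \<le> 2 * snd (lift x)"
proof -
  assume x: "x \<in> hyp_space"
  have "norm (homog x) \<le> norm x + norm (1::real)" unfolding homog_def by (rule norm_Pair_le)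
  then have "norm (homog x) \<le> 2" using x by simp
  moreover have "norm (lift x) = snd (lift x) * norm (homog x)"
    using lift_eq_snd[of x] snd_lift_ge[OF x] by (metis abs_of_nonneg norm_scaleR order_trans zero_le_one)
  ultimately show ?thesis using snd_lift_ge[OF x] by (simp add: mult.commute)
qed

text \<open>Since \<open>snd (lift x)\<close> is the hyperbolic cosine of the distance from the
  origin, this is a crude triangle inequality: cosh d(0,u) <= 2 cosh d(0,q) cosh d(u,q).\<close>

lemma snd_lift_bound:
  assumes u: "u \<in> hyp_space" and q: "q \<in> hyp_space"
  shows "snd (lift u) \<le> 2 * snd (lift q) * - lor (lift u) (lift q)"
proof -
  define s where "s = snd (lift q)"
  define t where "t = snd (lift u)"
  have s: "1 \<le> s" and t: "1 \<le> t" using snd_lift_ge u q by (auto simp: s_def t_def)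
  have q2: "1 - (norm q)\<^sup>2 = 1 / (s * s)"
    using ball_norm_less[OF q] by (simp add: s_def snd_lift)
  have "1 - (norm q)\<^sup>2 = (1 + norm q) * (1 - norm q)" by (simp add: power2_eq_square algebra_simps)
  also have "\<dots> \<le> 2 * (1 - norm q)" using q by (intro mult_right_mono) auto
  finally have "1 / (s * s) \<le> 2 * (1 - norm q)" using q2 by simp
  also have "norm u * norm q \<le> 1 * norm q" using u by (intro mult_right_mono) auto
  then have "1 - norm q \<le> 1 - u \<bullet> q" using norm_cauchy_schwarz[of u q] by simp
  finally have "1 / (s * s) \<le> 2 * (1 - u \<bullet> q)" by simp
  then have "1 \<le> 2 * (1 - u \<bullet> q) * (s * s)" using s by (simp add: pos_divide_le_eq)
  then have "t * 1 \<le> t * (2 * (1 - u \<bullet> q) * (s * s))" using t by (intro mult_left_mono) auto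
  also have "\<dots> = 2 * s * - (t * s * (u \<bullet> q - 1))" by (simp add: algebra_simps)
  also have "t * s * (u \<bullet> q - 1) = lor (t *\<^sub>R homog u) (s *\<^sub>R homog q)" by (simp add: lor_def algebra_simps)
  also have "\<dots> = lor (lift u) (lift q)" unfolding s_def t_def lift_eq_snd[symmetric] ..
  finally show ?thesis by (simp add: s_def t_def)
qed

text \<open>Discreteness refers to the Euclidean topology of the ball, so Euclidean displacements
  must be controlled by the Lorentz form.\<close>

lemma dist_le_lor:
  assumes x: "x \<in> hyp_space" and y: "y \<in> hyp_space"
  shows "(dist x y)\<^sup>2 \<le> 2 * (- lor (lift x) (lift y) - 1)"
proof -
  define a where "a = sqrt (1 - (norm x)\<^sup>2)"
  define b where "b = sqrt (1 - (norm y)\<^sup>2)"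
  have a: "0 < a" "a \<le> 1" "a * a = 1 - (norm x)\<^sup>2" using ball_norm_less[OF x] by (auto simp: a_def)
  have b: "0 < b" "b \<le> 1" "b * b = 1 - (norm y)\<^sup>2" using ball_norm_less[OF y] by (auto simp: b_def)
  define c where "c = - lor (lift x) (lift y)"
  have c1: "1 \<le> c" using lor_lift_le[OF x y] by (simp add: c_def)
  have "c = (1 - x \<bullet> y) / (a * b)"
    by (simp add: c_def lift_def lor_simps lor_def a_def b_def diff_divide_distrib)
  then have xy: "1 - x \<bullet> y = a * b * c" using a b by simp
  have "(dist x y)\<^sup>2 = (norm x)\<^sup>2 + (norm y)\<^sup>2 - 2 * (x \<bullet> y)"
    by (simp add: dist_norm power2_norm_eq_inner inner_diff_left inner_diff_right inner_commute)
  also have "\<dots> = 2 * (a * b * (c - 1)) - (a - b) * (a - b)"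
    using xy a(3) b(3) by (simp add: algebra_simps)
  also have "\<dots> \<le> 2 * (a * b * (c - 1))" by simp
  also have "a * b * (c - 1) \<le> 1 * (c - 1)"
    using a b c1 by (intro mult_right_mono mult_le_one) auto
  finally show ?thesis by (simp add: c_def)
qed

lemma lor_self_le_norm: "lor v v \<le> (norm v)\<^sup>2"
proof -
  have "lor v v = v \<bullet> v - 2 * (snd v * snd v)" by (simp add: lor_def inner_prod_def)
  then show ?thesis by (simp add: power2_norm_eq_inner)
qed

section \<open>The group action and its tiles\<close>

locale dirichlet_tiling =
  fixes \<Gamma> :: "('a::euclidean_space \<Rightarrow> 'a) set" and p :: 'a
  assumes subgroup_Isom: "subgroup \<Gamma> Isom"
    and discrete: "discrete_isometries \<Gamma>"
    and p: "p \<in> hyp_space"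
    and stabilizer: "{\<gamma> \<in> \<Gamma>. \<gamma> p = p} = {\<one>\<^bsub>Isom\<^esub>}"
begin

abbreviation mul :: "('a \<Rightarrow> 'a) \<Rightarrow> ('a \<Rightarrow> 'a) \<Rightarrow> 'a \<Rightarrow> 'a" (infixl "\<odot>" 70) where
  "g \<odot> h \<equiv> compose hyp_space g h"

abbreviation unit :: "'a \<Rightarrow> 'a" where
  "unit \<equiv> \<lambda>x\<in>hyp_space. x"

lemma one_Isom: "\<one>\<^bsub>Isom\<^esub> = unit"
  by (simp add: Isom_def BijGroup_def)

lemma isom: "g \<in> \<Gamma> \<Longrightarrow> g \<in> hyp_isom"
  using subgroup.subset[OF subgroup_Isom] by (auto simp: Isom_def)

lemma bij: "g \<in> \<Gamma> \<Longrightarrow> bij_betw g hyp_space hyp_space"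
  and ext: "g \<in> \<Gamma> \<Longrightarrow> g \<in> extensional hyp_space"
  using isom[of g] by (auto simp: hyp_isom_def Bij_def)

lemma act: "\<lbrakk>g \<in> \<Gamma>; x \<in> hyp_space\<rbrakk> \<Longrightarrow> g x \<in> hyp_space"
  using bij bij_betwE by metis

lemma hdist_act: "\<lbrakk>g \<in> \<Gamma>; x \<in> hyp_space; y \<in> hyp_space\<rbrakk> \<Longrightarrow> hdist (g x) (g y) = hdist x y"
  using isom[of g] unfolding hyp_isom_def by blast

lemma mul_closed: "\<lbrakk>g \<in> \<Gamma>; h \<in> \<Gamma>\<rbrakk> \<Longrightarrow> g \<odot> h \<in> \<Gamma>"
  using subgroup.m_closed[OF subgroup_Isom, of g h] isom[of g] isom[of h]
  by (simp add: Isom_def BijGroup_def hyp_isom_def)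

lemma unit_closed: "unit \<in> \<Gamma>"
  using subgroup.one_closed[OF subgroup_Isom] by (simp add: one_Isom)

lemma mul_apply: "x \<in> hyp_space \<Longrightarrow> (g \<odot> h) x = g (h x)"
  by (simp add: compose_eq)

lemma unit_apply: "x \<in> hyp_space \<Longrightarrow> unit x = x"
  by simp

lemma eqI: "\<lbrakk>g \<in> \<Gamma>; h \<in> \<Gamma>; \<And>x. x \<in> hyp_space \<Longrightarrow> g x = h x\<rbrakk> \<Longrightarrow> g = h"
  using ext by (metis extensionalityI)

text \<open>The restriction makes the inverse extensional, as elements of \<Gamma> are.\<close>

definition ginv :: "('a \<Rightarrow> 'a) \<Rightarrow> 'a \<Rightarrow> 'a" where
  "ginv g = (\<lambda>x\<in>hyp_space. inv_into hyp_space g x)"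

lemma ginv_closed: "g \<in> \<Gamma> \<Longrightarrow> ginv g \<in> \<Gamma>"
proof -
  assume g: "g \<in> \<Gamma>"
  have gB: "g \<in> Bij hyp_space" using isom[OF g] by (simp add: hyp_isom_def)
  interpret I: group "Isom :: ('a \<Rightarrow> 'a) monoid" by (rule group_Isom)
  have gc: "g \<in> carrier Isom" using isom[OF g] by (simp add: Isom_def)
  have eq: "ginv g \<otimes>\<^bsub>Isom\<^esub> g = \<one>\<^bsub>Isom\<^esub>"
  proof -
    have "ginv g \<in> Bij hyp_space" unfolding ginv_def by (rule restrict_inv_into_Bij[OF gB])
    then show ?thesis using Bij_compose_restrict_eq[OF gB] gB by (simp add: Isom_def BijGroup_def ginv_def)
  qed
  have "ginv g \<in> carrier Isom"
  proof -
    have "inv\<^bsub>BijGroup hyp_space\<^esub> g = ginv g" unfolding ginv_def by (rule inv_BijGroup[OF gB])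
    moreover have "inv\<^bsub>BijGroup hyp_space\<^esub> g \<in> hyp_isom"
      unfolding hyp_isom_def by (rule subgroup.m_inv_closed[OF subgroup_distance_preserving])
        (use isom[OF g] in \<open>simp add: hyp_isom_def\<close>)
    ultimately show ?thesis by (simp add: Isom_def)
  qed
  then have "ginv g = inv\<^bsub>Isom\<^esub> g" using I.inv_equality[OF eq gc] by simp
  then show ?thesis using subgroup.m_inv_closed[OF subgroup_Isom g] by simp
qed

lemma ginv_left: "\<lbrakk>g \<in> \<Gamma>; x \<in> hyp_space\<rbrakk> \<Longrightarrow> ginv g (g x) = x"
  using bij[of g] act[of g x] by (simp add: ginv_def bij_betw_def)

lemma ginv_right: "\<lbrakk>g \<in> \<Gamma>; x \<in> hyp_space\<rbrakk> \<Longrightarrow> g (ginv g x) = x"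
  using bij[of g] by (simp add: ginv_def bij_betw_def f_inv_into_f)

lemma mul_ginv_mul: "\<lbrakk>g \<in> \<Gamma>; h \<in> \<Gamma>\<rbrakk> \<Longrightarrow> g \<odot> (ginv g \<odot> h) = h"
  by (rule eqI) (simp_all only: mul_closed ginv_closed mul_apply ginv_right act)

lemma ginv_mul_mul: "\<lbrakk>g \<in> \<Gamma>; h \<in> \<Gamma>\<rbrakk> \<Longrightarrow> ginv g \<odot> (g \<odot> h) = h"
  by (rule eqI) (simp_all only: mul_closed ginv_closed mul_apply ginv_left act)

lemma mul_unit: "g \<in> \<Gamma> \<Longrightarrow> g \<odot> unit = g"
  by (rule eqI) (auto simp: mul_closed unit_closed mul_apply)

lemma orbit_inj: "\<lbrakk>g \<in> \<Gamma>; h \<in> \<Gamma>; g p = h p\<rbrakk> \<Longrightarrow> g = h"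
proof -
  assume g: "g \<in> \<Gamma>" and h: "h \<in> \<Gamma>" and e: "g p = h p"
  have "(ginv g \<odot> h) p = p" using e ginv_left[OF g p] by (simp only: mul_apply[OF p])
  then have "ginv g \<odot> h = unit"
    using stabilizer mul_closed[OF ginv_closed[OF g] h] by (auto simp: one_Isom)
  then have "h = g \<odot> unit" using mul_ginv_mul[OF g h] by simp
  then show ?thesis using mul_unit[OF g] by simp
qed

definition ctr :: "('a \<Rightarrow> 'a) \<Rightarrow> 'a \<times> real" where
  "ctr g = lift (g p)"

text \<open>The choice is unique because lifted points span the Lorentz space;
  \<open>lin_mul\<close> and \<open>lin_unit\<close> rest on this.\<close>

definition lin :: "('a \<Rightarrow> 'a) \<Rightarrow> 'a \<times> real \<Rightarrow> 'a \<times> real" where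
  "lin g = (SOME A. lorentz A \<and> (\<forall>x\<in>hyp_space. lift (g x) = A (lift x)))"

lemma lin: "g \<in> \<Gamma> \<Longrightarrow> lorentz (lin g)" and lift_act: "\<lbrakk>g \<in> \<Gamma>; x \<in> hyp_space\<rbrakk> \<Longrightarrow> lift (g x) = lin g (lift x)"
proof -
  have *: "lorentz (lin g) \<and> (\<forall>x\<in>hyp_space. lift (g x) = lin g (lift x))" if g: "g \<in> \<Gamma>" for g
  proof -
    obtain A where "lorentz A" "\<And>x. x \<in> hyp_space \<Longrightarrow> lift (g x) = A (lift x)"
      using isometry_lorentz[OF isom[OF g]] by metis
    then have "\<exists>A. lorentz A \<and> (\<forall>x\<in>hyp_space. lift (g x) = A (lift x))" by blast
    then show ?thesis unfolding lin_def by (rule someI_ex)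
  qed
  then show "g \<in> \<Gamma> \<Longrightarrow> lorentz (lin g)" by blast
  show "\<lbrakk>g \<in> \<Gamma>; x \<in> hyp_space\<rbrakk> \<Longrightarrow> lift (g x) = lin g (lift x)" using * by blast
qed

lemma ctr_mul: "\<lbrakk>g \<in> \<Gamma>; h \<in> \<Gamma>\<rbrakk> \<Longrightarrow> ctr (g \<odot> h) = lin g (ctr h)"
  unfolding ctr_def by (simp only: mul_apply[OF p] lift_act act[OF _ p])

lemma ctr_inj: "\<lbrakk>g \<in> \<Gamma>; h \<in> \<Gamma>; ctr g = ctr h\<rbrakk> \<Longrightarrow> g = h"
  unfolding ctr_def using lift_inj[OF act act] orbit_inj p by blast

text \<open>Nonnegative iff \<open>x\<close> is at least as close to the centre of \<open>g\<close> as to that of \<open>h\<close>.\<close>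

abbreviation side :: "('a \<Rightarrow> 'a) \<Rightarrow> ('a \<Rightarrow> 'a) \<Rightarrow> 'a \<Rightarrow> real" where
  "side g h x \<equiv> lor (homog x) (ctr g - ctr h)"

definition tile :: "('a \<Rightarrow> 'a) \<Rightarrow> 'a set" where
  "tile g = {x \<in> hyp_space. \<forall>h\<in>\<Gamma>. 0 \<le> side g h x}"

lemma tile_hdist: "g \<in> \<Gamma> \<Longrightarrow> tile g = {x \<in> hyp_space. \<forall>h\<in>\<Gamma>. hdist x (g p) \<le> hdist x (h p)}"
  unfolding tile_def ctr_def using hdist_le_hom_iff[OF _ act[OF _ p] act[OF _ p]] by blast

lemma tile_subset: "tile g \<subseteq> hyp_space"
  by (auto simp: tile_def)

lemma act_mem_tile_iff:
  assumes g: "g \<in> \<Gamma>" and h: "h \<in> \<Gamma>" and x: "x \<in> hyp_space"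
  shows "g x \<in> tile (g \<odot> h) \<longleftrightarrow> x \<in> tile h"
proof -
  have "(\<forall>k\<in>\<Gamma>. hdist (g x) ((g \<odot> h) p) \<le> hdist (g x) (k p))
    \<longleftrightarrow> (\<forall>k\<in>\<Gamma>. hdist (g x) ((g \<odot> h) p) \<le> hdist (g x) ((g \<odot> k) p))"
    using mul_closed[OF g] mul_ginv_mul[OF g] ginv_closed[OF g] mul_closed by metis
  also have "\<dots> \<longleftrightarrow> (\<forall>k\<in>\<Gamma>. hdist x (h p) \<le> hdist x (k p))"
    using hdist_act[OF g x act[OF _ p]] h by (simp only: mul_apply[OF p] cong: ball_cong)
  finally show ?thesis
    using tile_hdist[OF mul_closed[OF g h]] tile_hdist[OF h] act[OF g x] x by simp
qed

lemma tile_mul: 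
  assumes g: "g \<in> \<Gamma>" and h: "h \<in> \<Gamma>"
  shows "tile (g \<odot> h) = g ` tile h"
proof
  show "g ` tile h \<subseteq> tile (g \<odot> h)" using act_mem_tile_iff[OF g h] tile_subset by blast
  show "tile (g \<odot> h) \<subseteq> g ` tile h"
  proof
    fix y assume y: "y \<in> tile (g \<odot> h)"
    then have yb: "y \<in> hyp_space" using tile_subset by blast
    then have xb: "ginv g y \<in> hyp_space" using act[OF ginv_closed[OF g]] by blast
    have "ginv g y \<in> tile h" using act_mem_tile_iff[OF g h xb] y ginv_right[OF g yb] by simp
    then show "y \<in> g ` tile h" using ginv_right[OF g yb] by force
  qed
qed

lemma tile_eq_image: "g \<in> \<Gamma> \<Longrightarrow> tile g = g ` tile unit"
  using tile_mul[OF _ unit_closed] mul_unit by metis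

lemma lor_ctr_pos: "\<lbrakk>g \<in> \<Gamma>; h \<in> \<Gamma>; g \<noteq> h\<rbrakk> \<Longrightarrow> 0 < side g h (g p)"
  unfolding ctr_def using lor_lift_diff_pos act p orbit_inj by metis

lemma orbit_mem_tile: "g \<in> \<Gamma> \<Longrightarrow> g p \<in> tile g"
  using lor_ctr_pos[of g] act[OF _ p] by (fastforce simp: tile_def lor_simps intro: less_imp_le)

lemma orbit_mem_tile_iff: "\<lbrakk>g \<in> \<Gamma>; h \<in> \<Gamma>\<rbrakk> \<Longrightarrow> g p \<in> tile h \<longleftrightarrow> g = h"
proof
  assume g: "g \<in> \<Gamma>" and h: "h \<in> \<Gamma>" and "g p \<in> tile h"
  then have "0 \<le> side h g (g p)" by (simp add: tile_def)
  then show "g = h" using lor_ctr_pos[OF g h] by (force simp: lor_simps)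
qed (use orbit_mem_tile in blast)

lemma tile_inj: "\<lbrakk>g \<in> \<Gamma>; h \<in> \<Gamma>; tile g = tile h\<rbrakk> \<Longrightarrow> g = h"
  using orbit_mem_tile orbit_mem_tile_iff by blast

lemma convex_tile: "convex (tile g)"
proof -
  have "tile g = hyp_space \<inter> (\<Inter>h\<in>\<Gamma>. {x. 0 \<le> side g h x})"
    by (auto simp: tile_def)
  then show ?thesis by (simp only:) (intro convex_Int convex_ball convex_INT convex_lor_halfspace)
qed

lemma lor_tile_nonneg: "\<lbrakk>x \<in> tile g; h \<in> \<Gamma>\<rbrakk> \<Longrightarrow> 0 \<le> side g h x"
  by (simp add: tile_def)

lemma lor_tile_Int: "\<lbrakk>x \<in> tile g; x \<in> tile h; g \<in> \<Gamma>; h \<in> \<Gamma>\<rbrakk> \<Longrightarrow> side g h x = 0"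
  using lor_tile_nonneg[of x g h] lor_tile_nonneg[of x h g] by (simp add: lor_simps)

lemma mem_tile_transfer:
  "\<lbrakk>x \<in> tile g; side g h x = 0\<rbrakk> \<Longrightarrow> x \<in> tile h"
  by (fastforce simp: tile_def lor_simps)

lemma tile_Int_eq:
  "\<lbrakk>g \<in> \<Gamma>; h \<in> \<Gamma>\<rbrakk> \<Longrightarrow> tile g \<inter> tile h = tile g \<inter> {x. side g h x = 0}"
  using lor_tile_Int mem_tile_transfer by blast

lemma tile_Int_face: "\<lbrakk>g \<in> \<Gamma>; h \<in> \<Gamma>\<rbrakk> \<Longrightarrow> tile g \<inter> tile h face_of tile g"
  using face_of_Int_supporting_hyperplane_ge[OF convex_tile[of g], of "snd (ctr g - ctr h)" "fst (ctr g - ctr h)"]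
    lor_tile_nonneg[of _ g h] tile_Int_eq[of g h] by (simp add: lor_hom)

section \<open>Adjacent tiles and the dual graph\<close>

definition adjacent :: "('a \<Rightarrow> 'a) \<Rightarrow> ('a \<Rightarrow> 'a) \<Rightarrow> bool" where
  "adjacent g h \<longleftrightarrow> g \<in> \<Gamma> \<and> h \<in> \<Gamma> \<and> g \<noteq> h \<and> aff_dim (tile g \<inter> tile h) = int DIM('a) - 1"

lemma adjacent_sym: "adjacent g h \<Longrightarrow> adjacent h g"
  by (auto simp: adjacent_def Int_commute)

lemma adjacent_mul_iff:
  assumes "g \<in> \<Gamma>" "h \<in> \<Gamma>" "k \<in> \<Gamma>"
  shows "adjacent (g \<odot> h) (g \<odot> k) \<longleftrightarrow> adjacent h k"
proof -
  have "tile (g \<odot> h) \<inter> tile (g \<odot> k) = g ` (tile h \<inter> tile k)"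
    using bij[OF assms(1)] tile_subset tile_mul assms
    by (simp add: inj_on_image_Int[of g hyp_space] bij_betw_def)
  then have "aff_dim (tile (g \<odot> h) \<inter> tile (g \<odot> k)) = aff_dim (tile h \<inter> tile k)"
    using aff_dim_isometry[OF isom[OF assms(1)], of "tile h \<inter> tile k"] tile_subset by auto
  moreover have "g \<odot> h = g \<odot> k \<longleftrightarrow> h = k" using ginv_mul_mul assms by metis
  ultimately show ?thesis using assms by (simp add: adjacent_def mul_closed)
qed

lemma aff_dim_tile_Int_le:
  assumes "g \<in> \<Gamma>" "h \<in> \<Gamma>" "g \<noteq> h" "F \<subseteq> tile g \<inter> tile h"
  shows "aff_dim F \<le> int DIM('a) - 1"
proof -
  let ?u = "ctr g - ctr h"
  have "F \<subseteq> {x. fst ?u \<bullet> x = snd ?u}" using lor_tile_Int assms by (fastforce simp: lor_hom)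
  then have "aff_dim F \<le> aff_dim {x. fst ?u \<bullet> x = snd ?u}" by (rule aff_dim_subset)
  moreover have "fst ?u \<noteq> 0"
    unfolding ctr_def using lor_diff_lift_ne act p orbit_inj assms by metis
  ultimately show ?thesis by simp
qed

lemma aff_dim_bisector_Int_open:
  assumes g: "g \<in> \<Gamma>" "h \<in> \<Gamma>" "g \<noteq> h" and V: "open V" "y \<in> V"
    and y: "side g h y = 0"
  shows "aff_dim (V \<inter> {x. side g h x = 0}) = int DIM('a) - 1"
proof -
  let ?u = "ctr g - ctr h"
  let ?H = "{x. fst ?u \<bullet> x = snd ?u}"
  have ne: "fst ?u \<noteq> 0"
    unfolding ctr_def using lor_diff_lift_ne act p orbit_inj g by metis
  have "?H \<inter> interior V \<noteq> {}" using y V by (auto simp: lor_hom interior_open)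
  then have "affine hull (?H \<inter> V) = affine hull ?H"
    by (intro affine_hull_affine_Int_nonempty_interior affine_hyperplane)
  then have "aff_dim (?H \<inter> V) = aff_dim ?H" by (metis aff_dim_affine_hull)
  moreover have "V \<inter> {x. lor (homog x) ?u = 0} = ?H \<inter> V" by (auto simp: lor_hom)
  ultimately show ?thesis using ne by simp
qed

text \<open>An open piece of the bisector already has full dimension, and by
  \<open>mem_tile_transfer\<close> it lies in both tiles.\<close>

lemma adjacentI_open:
  assumes g: "g \<in> \<Gamma>" "h \<in> \<Gamma>" "g \<noteq> h" and V: "open V" "y \<in> V"
    and y: "side g h y = 0"
    and loc: "\<And>x. \<lbrakk>x \<in> V; side g h x = 0\<rbrakk> \<Longrightarrow> x \<in> tile g"
  shows "adjacent g h"
proof -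
  have "V \<inter> {x. side g h x = 0} \<subseteq> tile g \<inter> tile h"
    using loc mem_tile_transfer[of _ g h] by auto
  then have "aff_dim (V \<inter> {x. side g h x = 0}) \<le> aff_dim (tile g \<inter> tile h)"
    by (rule aff_dim_subset)
  then have "aff_dim (tile g \<inter> tile h) = int DIM('a) - 1"
    using aff_dim_bisector_Int_open[OF g V y] aff_dim_tile_Int_le[OF g order_refl] by linarith
  then show ?thesis using g by (simp add: adjacent_def)
qed

text \<open>\<open>F\<close> determines the bisector, so the two centre differences are
  proportional, and \<open>lift_collinear\<close> identifies the centres.\<close>

lemma adjacent_unique:
  assumes "adjacent g h" "adjacent g h'" "F \<subseteq> tile g \<inter> tile h" "F \<subseteq> tile g \<inter> tile h'"
    and F: "aff_dim F = int DIM('a) - 1"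
  shows "h = h'"
proof -
  have G: "g \<in> \<Gamma>" "h \<in> \<Gamma>" "h' \<in> \<Gamma>" "g \<noteq> h" "g \<noteq> h'" using assms by (auto simp: adjacent_def)
  have z: "side g h x = 0" "side g h' x = 0" if "x \<in> F" for x
    using lor_tile_Int assms(3,4) G that by blast+
  have "ctr g - ctr h \<noteq> 0" using ctr_inj G by fastforce
  then obtain c where "ctr g - ctr h' = c *\<^sub>R (ctr g - ctr h)"
    using lor_hyperplane_unique[OF F z(1) _ z(2)] by blast
  then have "h p = h' p" unfolding ctr_def
    using G act p orbit_inj by (intro lift_collinear[of "g p"]) metis+
  then show ?thesis using orbit_inj G by blast
qed

text \<open>A common facet lies in the intersection of the tiles, whose dimension is at most that of
  a facet; conversely the intersection itself is a face of both tiles.\<close>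

lemma dual_edges_tile:
  assumes "g \<in> \<Gamma>" "h \<in> \<Gamma>"
  shows "(tile g, tile h) \<in> dual_edges (tile ` \<Gamma>) \<longleftrightarrow> adjacent g h"
proof
  assume "(tile g, tile h) \<in> dual_edges (tile ` \<Gamma>)"
  then obtain F where F: "F \<in> hfacets (tile g)" "F \<in> hfacets (tile h)" and ne: "g \<noteq> h"
    by (auto simp: dual_edges_def)
  then have sub: "F \<subseteq> tile g \<inter> tile h" and dF: "aff_dim F = int DIM('a) - 1"
    using face_of_imp_subset by (auto simp: hfacets_def)
  have "aff_dim F \<le> aff_dim (tile g \<inter> tile h)" using sub by (rule aff_dim_subset)
  then show "adjacent g h"
    using dF aff_dim_tile_Int_le[OF assms ne order_refl] assms ne by (simp add: adjacent_def)
next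
  assume adj: "adjacent g h"
  then have "tile g \<inter> tile h \<in> hfacets (tile g) \<inter> hfacets (tile h)"
    using tile_Int_face[OF assms] tile_Int_face[OF assms(2,1)]
    by (simp add: hfacets_def adjacent_def Int_commute)
  moreover have "tile g \<noteq> tile h" using tile_inj assms adj by (auto simp: adjacent_def)
  ultimately show "(tile g, tile h) \<in> dual_edges (tile ` \<Gamma>)"
    using assms by (auto simp: dual_edges_def)
qed

text \<open>The neighbours of the unit tile inject into its facets by intersection, and left
  translation by \<open>g\<close> carries them to the neighbours of \<open>g\<close>.\<close>

lemma card_adjacent:
  assumes "finite (hfacets (tile unit))" "g \<in> \<Gamma>"
  shows "finite {h. adjacent g h}" "card {h. adjacent g h} \<le> card (hfacets (tile unit))"
proof -
  let ?N = "{h. adjacent unit h}"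
  let ?f = "\<lambda>h. tile unit \<inter> tile h"
  have inj: "inj_on ?f ?N"
  proof (rule inj_onI)
    fix h h' assume h: "h \<in> ?N" "h' \<in> ?N" "?f h = ?f h'"
    show "h = h'"
      by (rule adjacent_unique[of unit h h' "?f h"]) (use h in \<open>auto simp: adjacent_def\<close>)
  qed
  have sub: "?f ` ?N \<subseteq> hfacets (tile unit)"
    using tile_Int_face by (auto simp: hfacets_def adjacent_def)
  have fin: "finite ?N" using finite_imageD[OF finite_subset[OF sub assms(1)] inj] .
  have card: "card ?N \<le> card (hfacets (tile unit))" using card_inj_on_le[OF inj sub assms(1)] .
  have img: "{h. adjacent g h} = (\<lambda>h. g \<odot> h) ` ?N"
  proof
    show "(\<lambda>h. g \<odot> h) ` ?N \<subseteq> {h. adjacent g h}"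
      using adjacent_mul_iff[OF assms(2) unit_closed] mul_unit[OF assms(2)] by (auto simp: adjacent_def)
    show "{h. adjacent g h} \<subseteq> (\<lambda>h. g \<odot> h) ` ?N"
    proof
      fix h assume "h \<in> {h. adjacent g h}"
      then have h: "adjacent g h" "h \<in> \<Gamma>" by (auto simp: adjacent_def)
      have k: "ginv g \<odot> h \<in> \<Gamma>" using mul_closed ginv_closed assms(2) h by blast
      have "adjacent unit (ginv g \<odot> h)"
        using adjacent_mul_iff[OF assms(2) unit_closed k] mul_unit[OF assms(2)] mul_ginv_mul[OF assms(2) h(2)] h(1)
        by simp
      then show "h \<in> (\<lambda>h. g \<odot> h) ` ?N" using mul_ginv_mul[OF assms(2) h(2)] by force
    qed
  qed
  show "finite {h. adjacent g h}" using img fin by simp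
  show "card {h. adjacent g h} \<le> card (hfacets (tile unit))"
    using img card_image_le[OF fin, of "\<lambda>h. g \<odot> h"] card by simp
qed

section \<open>Discreteness and local finiteness\<close>

lemma discrete_at_unit:
  obtains X \<epsilon> where "finite X" "X \<subseteq> hyp_space" "0 < \<epsilon>"
    "\<forall>g\<in>\<Gamma>. (\<forall>x\<in>X. dist (g x) x < \<epsilon>) \<longrightarrow> g = unit"
proof -
  let ?T = "product_topology (\<lambda>_::'a. top_of_set (hyp_space :: 'a set)) hyp_space"
  have "openin (subtopology ?T \<Gamma>) {unit}"
    using discrete unit_closed by (simp add: discrete_isometries_def)
  then obtain U where U: "openin ?T U" "{unit} = U \<inter> \<Gamma>" by (metis openin_subtopology)
  have "unit \<in> U" using U by blast
  \<comment> \<open>A basic neighbourhood in the product topology restricts only finitely many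
    coordinates; these become the test points.\<close>
  then obtain W where W: "finite {i \<in> hyp_space. W i \<noteq> hyp_space}"
    "\<And>i. i \<in> hyp_space \<Longrightarrow> openin (top_of_set hyp_space) (W i)" "unit \<in> PiE hyp_space W" "PiE hyp_space W \<subseteq> U"
    using U(1) unfolding openin_product_topology_alt topspace_euclidean_subtopology by meson
  let ?X = "{i \<in> hyp_space. W i \<noteq> hyp_space}"
  have "\<exists>e>0. ball i e \<inter> hyp_space \<subseteq> W i" if i: "i \<in> ?X" for i
  proof -
    have "i \<in> W i" using W(3) i by (auto simp: PiE_iff)
    moreover have "openin (top_of_set hyp_space) (W i)" using W(2) i by simp
    ultimately show ?thesis unfolding openin_contains_ball by blast
  qed
  then have "\<forall>i\<in>?X. \<exists>e. 0 < e \<and> ball i e \<inter> hyp_space \<subseteq> W i" by blast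
  from bchoice[OF this] obtain e where
    e: "\<And>i. i \<in> ?X \<Longrightarrow> 0 < e i" "\<And>i. i \<in> ?X \<Longrightarrow> ball i (e i) \<inter> hyp_space \<subseteq> W i" by blast
  \<comment> \<open>The inserted 1 keeps the minimum defined when there are no test points.\<close>
  define \<epsilon> where "\<epsilon> = Min (insert 1 (e ` ?X))"
  have \<epsilon>0: "0 < \<epsilon>" unfolding \<epsilon>_def using W(1) e(1) by (subst Min_gr_iff) auto
  have \<epsilon>_le: "\<epsilon> \<le> e i" if "i \<in> ?X" for i unfolding \<epsilon>_def using W(1) that by (intro Min_le) auto
  have "g = unit" if g: "g \<in> \<Gamma>" "\<And>x. x \<in> ?X \<Longrightarrow> dist (g x) x < \<epsilon>" for g
  proof -
    have "g i \<in> W i" if i: "i \<in> hyp_space" for i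
    proof (cases "W i = hyp_space")
      case True
      then show ?thesis using act[OF g(1) i] by simp
    next
      case False
      then have iX: "i \<in> ?X" using i by simp
      then have "g i \<in> ball i (e i)"
        using g(2)[OF iX] \<epsilon>_le[OF iX] by (simp add: dist_commute)
      then show ?thesis using e(2)[OF iX] act[OF g(1) i] by blast
    qed
    then have "g \<in> PiE hyp_space W" using ext[OF g(1)] by (simp add: PiE_iff)
    then show ?thesis using W(4) U(2) g(1) by blast
  qed
  then have "\<forall>g\<in>\<Gamma>. (\<forall>x\<in>?X. dist (g x) x < \<epsilon>) \<longrightarrow> g = unit" by blast
  from that[OF W(1) _ \<epsilon>0 this] show ?thesis by blast
qed

text \<open>By \<open>snd_lift_bound\<close>, bounded height of the centre bounds the images of
  every test point. Among infinitely many such elements two nearly agree on all test points, and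
  their quotient then moves these points too little to differ from \<open>unit\<close>.\<close>

lemma finite_ctr_bounded: "finite {g \<in> \<Gamma>. snd (ctr g) \<le> K}"
proof (rule ccontr)
  assume inf: "infinite {g \<in> \<Gamma>. snd (ctr g) \<le> K}" (is "infinite ?S")
  obtain X \<epsilon> where X: "finite X" "X \<subseteq> hyp_space" "0 < \<epsilon>"
    "\<forall>g\<in>\<Gamma>. (\<forall>x\<in>X. dist (g x) x < \<epsilon>) \<longrightarrow> g = unit" by (rule discrete_at_unit)
  have "bounded ((\<lambda>g. lift (g x)) ` ?S)" if x: "x \<in> X" for x
  proof (rule boundedI)
    fix v assume "v \<in> (\<lambda>g. lift (g x)) ` ?S"
    then obtain g where g: "g \<in> \<Gamma>" "snd (ctr g) \<le> K" "v = lift (g x)" by blast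
    have xb: "x \<in> hyp_space" using x X by blast
    let ?C = "- lor (lift x) (lift p)"
    have C: "0 \<le> ?C" using lor_lift_le(1)[OF xb p] by simp
    have "norm v \<le> 2 * snd (lift (g x))" using norm_lift_le act[OF g(1) xb] g(3) by simp
    also have "\<dots> \<le> 2 * (2 * snd (ctr g) * - lor (lift (g x)) (ctr g))"
      using snd_lift_bound[OF act[OF g(1) xb] act[OF g(1) p]] by (simp add: ctr_def)
    also have "lor (lift (g x)) (ctr g) = lor (lift x) (lift p)"
      using lorentz_lor[OF lin[OF g(1)]] lift_act[OF g(1)] xb p by (simp add: ctr_def)
    also have "2 * (2 * snd (ctr g) * ?C) \<le> 2 * (2 * K * ?C)"
      using g(2) C by (intro mult_left_mono mult_right_mono) auto
    finally show "norm v \<le> 2 * (2 * K * ?C)" .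
  qed
  then obtain S' where S': "S' \<subseteq> ?S" "infinite S'"
    "\<And>g h x. \<lbrakk>g \<in> S'; h \<in> S'; x \<in> X\<rbrakk> \<Longrightarrow> dist (lift (g x)) (lift (h x)) < \<epsilon>"
    using infinite_pigeonhole_bounded[OF X(1) inf _ X(3), of "\<lambda>x g. lift (g x)"] by blast
  obtain g where g: "g \<in> S'" using S'(2) by fastforce
  have "infinite (S' - {g})" using S'(2) by simp
  then obtain h where h: "h \<in> S'" "h \<noteq> g" by (metis DiffE ex_in_conv finite.emptyI singletonI)
  have G: "g \<in> \<Gamma>" "h \<in> \<Gamma>" using g h S'(1) by auto
  have "ginv h \<odot> g = unit"
  proof (rule X(4)[rule_format])
    show "ginv h \<odot> g \<in> \<Gamma>" using G mul_closed ginv_closed by blast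
    fix x assume x: "x \<in> X"
    then have xb: "x \<in> hyp_space" using X by blast
    let ?y = "(ginv h \<odot> g) x"
    have yb: "?y \<in> hyp_space" using act[OF \<open>ginv h \<odot> g \<in> \<Gamma>\<close> xb] .
    have hy: "h ?y = g x" using ginv_right[OF G(2) act[OF G(1) xb]] by (simp only: mul_apply[OF xb])
    have "lor (lift ?y) (lift x) = lor (lin h (lift ?y)) (lin h (lift x))"
      by (rule lorentz_lor[OF lin[OF G(2)], symmetric])
    also have "\<dots> = lor (lift (g x)) (lift (h x))"
      unfolding lift_act[OF G(2) yb, symmetric] lift_act[OF G(2) xb, symmetric] hy ..
    finally have yx: "lor (lift ?y) (lift x) = lor (lift (g x)) (lift (h x))" .
    have "(dist ?y x)\<^sup>2 \<le> 2 * (- lor (lift (g x)) (lift (h x)) - 1)"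
      using dist_le_lor[OF yb xb] unfolding yx .
    also have "2 * (- lor (lift (g x)) (lift (h x)) - 1) = lor (lift (g x) - lift (h x)) (lift (g x) - lift (h x))"
      using lor_lift_self[OF act[OF G(1) xb]] lor_lift_self[OF act[OF G(2) xb]]
      by (simp add: lor_simps lor_commute[of "lift (h x)" "lift (g x)"])
    also have "\<dots> \<le> (norm (lift (g x) - lift (h x)))\<^sup>2" by (rule lor_self_le_norm)
    finally have "(dist ?y x)\<^sup>2 \<le> (norm (lift (g x) - lift (h x)))\<^sup>2" .
    then have "dist ?y x \<le> dist (lift (g x)) (lift (h x))" by (simp add: dist_norm power2_le_iff_abs_le)
    then show "dist ?y x < \<epsilon>" using S'(3)[OF g h(1) x] by simp
  qed
  then have "g = h \<odot> unit" using mul_ginv_mul[OF G(2,1)] by simp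
  then show False using mul_unit[OF G(2)] h(2) by simp
qed

text \<open>For a centre \<open>h p\<close> high on the hyperboloid, a point of norm at most
  \<open>r\<close> is closer to \<open>g p\<close>: comparing the two pairings bounds the height by
  \<open>2 * snd (ctr g) / (1 - r)\<close>. Hence finitely many bisectors matter on a compact part
  of the ball.\<close>

lemma finite_near:
  assumes g: "g \<in> \<Gamma>" and r: "r < 1"
  shows "finite {h \<in> \<Gamma>. \<exists>x. norm x \<le> r \<and> side g h x \<le> 0}"
proof (rule finite_subset[OF _ finite_ctr_bounded[of "2 * snd (ctr g) / (1 - r)"]])
  show "{h \<in> \<Gamma>. \<exists>x. norm x \<le> r \<and> side g h x \<le> 0} \<subseteq> {h \<in> \<Gamma>. snd (ctr h) \<le> 2 * snd (ctr g) / (1 - r)}"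
  proof safe
    fix h x assume h: "h \<in> \<Gamma>" and x: "norm x \<le> r" and le: "side g h x \<le> 0"
    have lor_c: "lor (homog x) (ctr k) = - snd (ctr k) * (1 - x \<bullet> k p)" for k
      unfolding ctr_def by (subst lift_eq_snd) (simp add: lor_scale_right lor_def algebra_simps)
    have cs: "\<bar>x \<bullet> k p\<bar> \<le> r" if "k \<in> \<Gamma>" for k
    proof -
      have "\<bar>x \<bullet> k p\<bar> \<le> norm x * norm (k p)" by (rule Cauchy_Schwarz_ineq2)
      also have "\<dots> \<le> r * 1" using x act[OF that p] by (intro mult_mono) (auto intro: order_trans[OF norm_ge_zero])
      finally show ?thesis by simp
    qed
    have ge1: "1 \<le> snd (ctr k)" if "k \<in> \<Gamma>" for k using snd_lift_ge act[OF that p] by (simp add: ctr_def)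
    have "snd (ctr h) * (1 - r) \<le> snd (ctr h) * (1 - x \<bullet> h p)"
      using cs[OF h] ge1[OF h] by (intro mult_left_mono) auto
    also have "\<dots> \<le> snd (ctr g) * (1 - x \<bullet> g p)" using le by (simp add: lor_diff_right lor_c)
    also have "\<dots> \<le> snd (ctr g) * 2" using cs[OF g] ge1[OF g] r by (intro mult_left_mono) auto
    finally show "snd (ctr h) \<le> 2 * snd (ctr g) / (1 - r)" using r by (simp add: pos_le_divide_eq mult.commute)
  qed
qed

end

section \<open>Ridges of polyhedra and relative interiors\<close>

lemma polyhedron_facet_of_facet:
  fixes S :: "'a::euclidean_space set"
  assumes S: "polyhedron S" and f: "f facet_of S" and c: "c facet_of f"
  obtains g where "g facet_of S" "g \<noteq> f" "c = f \<inter> g"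
proof -
  have fS: "f face_of S" and cf: "c face_of f" and cne: "c \<noteq> {}"
    and df: "aff_dim f = aff_dim S - 1" and dc: "aff_dim c = aff_dim f - 1"
    using f c by (auto simp: facet_of_def)
  have cS: "c face_of S" using cf fS by (rule face_of_trans)
  have cnS: "c \<noteq> S" using df dc by auto
  \<comment> \<open>If \<open>f\<close> were the only facet through \<open>c\<close>, this
    intersection would contain \<open>f\<close>.\<close>
  have ceq: "c = \<Inter>{F. F facet_of S \<and> c \<subseteq> F}" by (rule face_of_polyhedron[OF S cS cne cnS])
  have "\<exists>g. g facet_of S \<and> c \<subseteq> g \<and> g \<noteq> f"
  proof (rule ccontr)
    assume no: "\<not> ?thesis"
    have "f \<subseteq> \<Inter>{F. F facet_of S \<and> c \<subseteq> F}" using no by blast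
    then have "f \<subseteq> c" using ceq by simp
    then have "f = c" using face_of_imp_subset[OF cf] by blast
    then show False using dc by simp
  qed
  then obtain g where g: "g facet_of S" "c \<subseteq> g" "g \<noteq> f" by blast
  then have gS: "g face_of S" and dg: "aff_dim g = aff_dim S - 1" by (auto simp: facet_of_def)
  have cvf: "convex f" and cvg: "convex g" using face_of_imp_convex fS gS by blast+
  have fg: "f \<inter> g face_of S" using face_of_Int fS gS by blast
  have fgf: "f \<inter> g face_of f" using face_of_subset[OF fg] face_of_imp_subset[OF fS] by blast
  have ne: "f \<inter> g \<noteq> f"
  proof
    assume "f \<inter> g = f"
    then have "f face_of g" using face_of_subset[OF fS, of g] face_of_imp_subset[OF gS] by blast
    then have "aff_dim f < aff_dim g" using face_of_aff_dim_lt[OF cvg] g(3) by blast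
    then show False using df dg by simp
  qed
  have lt: "aff_dim (f \<inter> g) < aff_dim f" using face_of_aff_dim_lt[OF cvf fgf ne] .
  have cfg: "c face_of f \<inter> g"
    using face_of_subset[OF cS] face_of_imp_subset[OF cf] g(2) face_of_imp_subset[OF fg] by blast
  have "c = f \<inter> g"
  proof (rule ccontr)
    assume "c \<noteq> f \<inter> g"
    then have "aff_dim c < aff_dim (f \<inter> g)"
      using face_of_aff_dim_lt[OF convex_Int[OF cvf cvg] cfg] by blast
    then show False using lt dc by simp
  qed
  then show ?thesis using that g by blast
qed

text \<open>A relative interior point of a convex set with a second point lies strictly inside a
  segment of the set, and the ball is strictly convex. Applied to ridges, this is where dimension at
  least 3 excludes ideal points.\<close>

lemma rel_interior_in_hyp_space:
  fixes C :: "'a::euclidean_space set"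
  assumes C: "convex C" "C \<subseteq> cball 0 1" "0 < aff_dim C" and x: "x \<in> rel_interior C"
  shows "x \<in> hyp_space"
proof -
  have xC: "x \<in> C" using x rel_interior_subset by blast
  have "C \<noteq> {x}" using C(3) by auto
  then obtain y where y: "y \<in> C" "y \<noteq> x" using xC by blast
  obtain m where m: "m > 1" "\<forall>e. e > 1 \<and> e \<le> m \<longrightarrow> (1 - e) *\<^sub>R y + e *\<^sub>R x \<in> C"
    using convex_rel_interior_if[OF C(1) x] y(1) hull_subset[of C affine] by (meson subsetD)
  define w where "w = (1 - m) *\<^sub>R y + m *\<^sub>R x"
  have w: "w \<in> C" using m by (simp add: w_def)
  have "x = (1 - 1 / m) *\<^sub>R y + (1 / m) *\<^sub>R w"
    using m(1) by (simp add: w_def scaleR_right_distrib diff_divide_distrib flip: scaleR_left_distrib)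
  moreover have "w \<noteq> y" using m y(2) by (simp add: w_def scaleR_left_diff_distrib)
  ultimately have "x \<in> open_segment y w" using m(1) by (auto simp: in_segment intro!: exI[of _ "1 / m"])
  from dist_decreases_open_segment[OF this, of 0] show ?thesis
    using C(2) y(1) w by (auto simp: subset_iff dist_commute)
qed

section \<open>Local structure of the tiles\<close>

context dirichlet_tiling
begin

text \<open>Once redundant bisectors are dropped, each remaining one contains a point of
  \<open>U\<close> at which all the others are strict. Around that point the tile is bounded by this
  bisector alone, so the tile across it is adjacent.\<close>

lemma local_facets:
  assumes g: "g \<in> \<Gamma>" and U: "open U" "convex U" "U \<subseteq> hyp_space"
    and A0: "finite A0" "A0 \<subseteq> \<Gamma> - {g}"
    and q: "q \<in> U" "\<And>h. h \<in> A0 \<Longrightarrow> 0 < side g h q"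
    and loc: "\<And>z. \<lbrakk>z \<in> U; \<forall>h\<in>A0. 0 \<le> side g h z\<rbrakk> \<Longrightarrow> z \<in> tile g"
  obtains A where "A \<subseteq> A0" "\<forall>h\<in>A. adjacent g h"
    "\<forall>z\<in>U. (\<forall>h\<in>A. 0 \<le> side g h z) \<longrightarrow> z \<in> tile g"
proof -
  obtain A where A: "A \<subseteq> A0"
    "\<And>x h. \<lbrakk>x \<in> U; \<forall>h\<in>A. 0 \<le> side g h x; h \<in> A0\<rbrakk> \<Longrightarrow> 0 \<le> side g h x"
    "\<And>h. h \<in> A \<Longrightarrow> \<exists>y\<in>U. side g h y = 0 \<and> (\<forall>j\<in>A - {h}. 0 < side g j y)"
    by (rule irredundant_subfamily[OF A0(1) U(2) q(1), of "\<lambda>h. ctr g - ctr h"]) (use q(2) in auto)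
  have tile: "z \<in> tile g" if "z \<in> U" "\<forall>h\<in>A. 0 \<le> side g h z" for z
    using loc[OF that(1)] A(2)[OF that] by blast
  have finA: "finite A" using A(1) A0(1) finite_subset by blast
  have "adjacent g h" if h: "h \<in> A" for h
  proof -
    obtain y where y: "y \<in> U" "side g h y = 0" "\<forall>j\<in>A - {h}. 0 < side g j y"
      using A(3)[OF h] by blast
    define V where "V = U \<inter> (\<Inter>j\<in>A - {h}. {x. 0 < side g j x})"
    have oV: "open V" unfolding V_def using U(1) finA by (intro open_Int open_INT ballI open_lor_halfspace) auto
    show ?thesis
    proof (rule adjacentI_open[OF g _ _ oV])
      show "h \<in> \<Gamma>" "g \<noteq> h" using h A(1) A0(2) by auto
      show "y \<in> V" using y by (simp add: V_def)
      show "side g h y = 0" by (rule y(2))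
      fix x assume x: "x \<in> V" "side g h x = 0"
      have "0 \<le> side g j x" if "j \<in> A" for j
        using x that by (cases "j = h") (auto simp: V_def intro: less_imp_le)
      then show "x \<in> tile g" using tile x(1) by (auto simp: V_def)
    qed
  qed
  then show ?thesis using that[OF A(1)] tile by blast
qed

lemma lor_homog_combine:
  "lor (homog ((1 - t) *\<^sub>R x + t *\<^sub>R y)) w = (1 - t) * lor (homog x) w + t * lor (homog y) w"
  by (simp only: homog_convex lor_simps)

text \<open>Near \<open>x\<close> the tile is cut out by an irredundant set \<open>A\<close> of
  adjacent tiles through \<open>x\<close>. If \<open>A\<close> were empty, points behind
  \<open>x\<close> as seen from the centre would belong to the tile. If \<open>A\<close> had one
  element, the tile would be a half-space near \<open>x\<close> and all other tiles at
  \<open>x\<close> would share its boundary, forcing \<open>a = b\<close>.\<close>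

lemma tiles_around_point:
  assumes x: "x \<in> tile g" and g: "g \<in> \<Gamma>" and a: "a \<in> \<Gamma>" "a \<noteq> g" "x \<in> tile a"
    and b: "b \<in> \<Gamma>" "b \<noteq> g" "b \<noteq> a" "x \<in> tile b"
  shows "\<exists>h1 h2. h1 \<noteq> h2 \<and> x \<in> tile h1 \<and> x \<in> tile h2 \<and> adjacent g h1 \<and> adjacent g h2"
proof -
  have xb: "x \<in> hyp_space" using x tile_subset by blast
  define r where "r = (1 + norm x) / 2"
  have r: "norm x < r" "r < 1" using xb by (auto simp: r_def)
  define N where "N = {h \<in> \<Gamma>. \<exists>y. norm y \<le> r \<and> side g h y \<le> 0}"
  have finN: "finite N" unfolding N_def by (rule finite_near[OF g r(2)])
  define V where "V = {h \<in> \<Gamma>. x \<in> tile h}"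
  have zero: "side g h x = 0" if "h \<in> V" for h
    using lor_tile_Int[OF x _ g] that by (simp add: V_def)
  have VN: "V \<subseteq> N"
  proof
    fix h assume h: "h \<in> V"
    then have "h \<in> \<Gamma>" "side g h x \<le> 0" "norm x \<le> r"
      using zero[OF h] r by (auto simp: V_def)
    then show "h \<in> N" unfolding N_def by blast
  qed
  have pos: "0 < side g h x" if "h \<in> N - V" for h
  proof -
    have h: "h \<in> \<Gamma>" "x \<notin> tile h" using that by (auto simp: N_def V_def)
    then show ?thesis using lor_tile_nonneg[OF x h(1)] mem_tile_transfer[OF x, of h] by fastforce
  qed
  \<comment> \<open>On this neighbourhood of \<open>x\<close> every bisector that misses
    \<open>x\<close> is strictly satisfied.\<close>
  define O1 where "O1 = ball 0 r \<inter> (\<Inter>h\<in>N - V. {y. 0 < side g h y})"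
  have "open O1" unfolding O1_def using finN by (intro open_Int open_INT open_ball ballI open_lor_halfspace) auto
  moreover have "x \<in> O1" using pos r by (simp add: O1_def)
  ultimately obtain \<epsilon> where \<epsilon>: "0 < \<epsilon>" "ball x \<epsilon> \<subseteq> O1" by (metis openE)
  define U where "U = ball x \<epsilon>"
  have U: "open U" "convex U" "U \<subseteq> hyp_space" "U \<subseteq> O1"
    using \<epsilon> r by (auto simp: U_def O1_def subset_iff)
  define A0 where "A0 = V - {g}"
  have A0: "finite A0" "A0 \<subseteq> \<Gamma> - {g}" using finN VN finite_subset by (auto simp: A0_def V_def)
  have loc: "z \<in> tile g" if z: "z \<in> U" "\<forall>h\<in>A0. 0 \<le> side g h z" for z
  proof -
    have "0 \<le> side g h z" if h: "h \<in> \<Gamma>" for h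
    proof (cases "h \<in> V")
      case True
      then show ?thesis using z(2) by (cases "h = g") (auto simp: A0_def lor_simps)
    next
      case hV: False
      show ?thesis
      proof (cases "h \<in> N")
        case True
        then show ?thesis using z(1) U(4) hV unfolding O1_def by (fastforce intro: less_imp_le)
      next
        case False
        have "norm z \<le> r" using z(1) U(4) by (auto simp: O1_def subset_iff)
        then show ?thesis using False h unfolding N_def by force
      qed
    qed
    then show ?thesis using z(1) U(3) unfolding tile_def by blast
  qed
  define d where "d = g p - x"
  have near: "\<exists>t>0. t < 1 \<and> (\<forall>s. \<bar>s\<bar> \<le> t \<longrightarrow> x + s *\<^sub>R d \<in> U)"
  proof (intro exI[of _ "min (1/2) (\<epsilon> / (2 * (norm d + 1)))"] conjI allI impI)
    have dp: "0 < norm d + 1" by (simp add: add_nonneg_pos)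
    then show "0 < min (1/2) (\<epsilon> / (2 * (norm d + 1)))" using \<epsilon> by simp
    show "min (1/2) (\<epsilon> / (2 * (norm d + 1))) < 1" by simp
    fix s assume "\<bar>s\<bar> \<le> min (1/2) (\<epsilon> / (2 * (norm d + 1)))"
    then have "\<bar>s\<bar> \<le> \<epsilon> / (2 * (norm d + 1))" by simp
    then have "\<bar>s\<bar> * (norm d + 1) \<le> \<epsilon> / 2" using dp by (simp add: field_simps)
    moreover have "\<bar>s\<bar> * norm d \<le> \<bar>s\<bar> * (norm d + 1)" by (simp add: mult_left_mono)
    ultimately have "\<bar>s\<bar> * norm d < \<epsilon>" using \<epsilon> by linarith
    then show "x + s *\<^sub>R d \<in> U" by (simp add: U_def dist_norm)
  qed
  then obtain t where t: "0 < t" "t < 1" "x + t *\<^sub>R d \<in> U" "x - t *\<^sub>R d \<in> U" 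
    by (metis abs_minus_cancel abs_of_pos add_uminus_conv_diff order_refl scaleR_minus_left)
  \<comment> \<open>The bisector functions of tiles at \<open>x\<close> vanish at \<open>x\<close>,
    so along the line to the centre they are proportional to \<open>s\<close>:
    \<open>x + t *\<^sub>R d\<close> is strictly inside and \<open>x - t *\<^sub>R d\<close>
    strictly outside all of them.\<close>
  have val: "side g h (x + s *\<^sub>R d) = s * side g h (g p)" if h: "h \<in> V" for s h
  proof -
    have "x + s *\<^sub>R d = (1 - s) *\<^sub>R x + s *\<^sub>R g p" by (simp add: d_def algebra_simps)
    then show ?thesis using zero[OF h] by (simp add: lor_homog_combine)
  qed
  have gpos: "0 < side g h (g p)" if "h \<in> A0" for h
    using that A0(2) lor_ctr_pos[OF g] by blast
  obtain A where A: "A \<subseteq> A0" "\<forall>h\<in>A. adjacent g h"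
    "\<forall>z\<in>U. (\<forall>h\<in>A. 0 \<le> side g h z) \<longrightarrow> z \<in> tile g"
  proof (rule local_facets[OF g U(1-3) A0 t(3) _ loc])
    fix h assume h: "h \<in> A0"
    then have "h \<in> V" by (simp add: A0_def)
    then show "0 < side g h (x + t *\<^sub>R d)" using val gpos[OF h] t(1) by simp
  qed
  have aA0: "a \<in> A0" and bA0: "b \<in> A0" using a b by (auto simp: A0_def V_def)
  have "\<exists>h1\<in>A. \<exists>h2\<in>A. h1 \<noteq> h2"
  proof (rule ccontr)
    assume "\<not> ?thesis"
    then have sub: "A = {} \<or> (\<exists>h. A = {h})" by (metis ex_in_conv insertI1 subsetI subset_singletonD singletonI subset_antisym insert_absorb insert_iff)
    then show False
    proof
      assume "A = {}"
      then have "x - t *\<^sub>R d \<in> tile g" using A(3) t(4) by blast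
      then have "0 \<le> side g a (x + (- t) *\<^sub>R d)" using lor_tile_nonneg[OF _ a(1)] by simp
      then have "0 \<le> (- t) * side g a (g p)" using val[of a "- t"] aA0 by (simp add: A0_def)
      then show False using gpos[OF aA0] t(1) by (simp add: mult_le_0_iff)
    next
      assume "\<exists>h. A = {h}"
      then obtain h where h: "A = {h}" by blast
      have hA: "h \<in> A0" "adjacent g h" "h \<in> \<Gamma>" "h \<noteq> g" using A(1,2) h A0(2) by auto
      define F where "F = U \<inter> {z. side g h z = 0}"
      have xU: "x \<in> U" using \<epsilon> by (simp add: U_def)
      have dF: "aff_dim F = int DIM('a) - 1"
        unfolding F_def using aff_dim_bisector_Int_open[OF g hA(3) _ U(1) xU] hA zero by (simp add: A0_def)
      have Fg: "F \<subseteq> tile g" using A(3) h by (auto simp: F_def)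
      have Fc: "F \<subseteq> tile g \<inter> tile c" "adjacent g c" if c: "c \<in> A0" for c
      proof -
        have cG: "c \<in> \<Gamma>" "c \<noteq> g" "c \<in> V" using c A0(2) by (auto simp: A0_def)
        have "side g c z = 0" if z: "z \<in> F" for z
        proof -
          \<comment> \<open>\<open>z'\<close> is the mirror image of \<open>z\<close> in
            \<open>x\<close> and lies in \<open>F\<close> too. The nonnegative values of
            \<open>side g c\<close> at \<open>z\<close> and \<open>z'\<close> add up to twice its
            value at \<open>x\<close>, which is 0.\<close>
          define z' where "z' = x + (x - z)"
          have e: "z' = (1 - (-1)) *\<^sub>R x + (-1) *\<^sub>R z" by (simp add: z'_def scaleR_2)
          have ev: "lor (homog z') w = 2 * lor (homog x) w - lor (homog z) w" for w
            unfolding e lor_homog_combine by simp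
          have "z' \<in> U" using z by (simp add: F_def U_def z'_def dist_norm norm_minus_commute)
          moreover have "side g h z' = 0"
            using ev zero z hA(1) by (simp add: F_def A0_def)
          ultimately have "z' \<in> tile g" using Fg by (auto simp: F_def)
          then have "0 \<le> side g c z'" using lor_tile_nonneg cG by blast
          moreover have "0 \<le> side g c z" using lor_tile_nonneg cG Fg z by blast
          ultimately show ?thesis using ev[of "ctr g - ctr c"] zero[OF cG(3)] by simp
        qed
        then show Fc: "F \<subseteq> tile g \<inter> tile c" using Fg mem_tile_transfer by blast
        have "aff_dim F \<le> aff_dim (tile g \<inter> tile c)" using Fc by (rule aff_dim_subset)
        then show "adjacent g c"
          using dF aff_dim_tile_Int_le[OF g cG(1) _ order_refl] g cG by (fastforce simp: adjacent_def)
      qed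
      have "a = b" by (rule adjacent_unique[OF Fc(2)[OF aA0] Fc(2)[OF bA0] Fc(1)[OF aA0] Fc(1)[OF bA0] dF])
      then show False using b by simp
    qed
  qed
  then show ?thesis using A(1,2) unfolding A0_def V_def by blast
qed

text \<open>Possibly infinitely many bisectors define the tile, but by \<open>finite_near\<close>
  finitely many suffice on a ball about the origin containing both the given point and the centre.
  \<open>local_facets\<close> reduces these to adjacent tiles.\<close>

lemma tile_eq_adjacent:
  assumes g: "g \<in> \<Gamma>"
  shows "tile g = {x \<in> hyp_space. \<forall>h. adjacent g h \<longrightarrow> 0 \<le> side g h x}"
proof
  show "tile g \<subseteq> {x \<in> hyp_space. \<forall>h. adjacent g h \<longrightarrow> 0 \<le> side g h x}"
  proof
    fix x assume x: "x \<in> tile g"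
    have "0 \<le> side g h x" if "adjacent g h" for h
      using lor_tile_nonneg[OF x] that by (simp add: adjacent_def)
    then show "x \<in> {x \<in> hyp_space. \<forall>h. adjacent g h \<longrightarrow> 0 \<le> side g h x}"
      using x tile_subset by blast
  qed
  show "{x \<in> hyp_space. \<forall>h. adjacent g h \<longrightarrow> 0 \<le> side g h x} \<subseteq> tile g"
  proof
    fix x assume "x \<in> {x \<in> hyp_space. \<forall>h. adjacent g h \<longrightarrow> 0 \<le> side g h x}"
    then have xb: "x \<in> hyp_space" and x: "\<And>h. adjacent g h \<Longrightarrow> 0 \<le> side g h x" by blast+
    define r where "r = (1 + max (norm x) (norm (g p))) / 2"
    have r: "norm x < r" "norm (g p) < r" "r < 1" using xb act[OF g p] by (auto simp: r_def)
    define A0 where "A0 = {h \<in> \<Gamma>. \<exists>y. norm y \<le> r \<and> side g h y \<le> 0} - {g}"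
    have A0: "finite A0" "A0 \<subseteq> \<Gamma> - {g}" unfolding A0_def using finite_near[OF g r(3)] by auto
    have loc: "z \<in> tile g" if z: "z \<in> ball 0 r" "\<forall>h\<in>A0. 0 \<le> side g h z" for z
    proof -
      have nz: "norm z \<le> r" using z(1) by simp
      have "0 \<le> side g h z" if h: "h \<in> \<Gamma>" for h
      proof (cases "h = g \<or> h \<in> A0")
        case True
        then show ?thesis using z(2) by (auto simp: lor_simps)
      next
        case False
        then show ?thesis using nz h unfolding A0_def by force
      qed
      moreover have "z \<in> hyp_space" using nz r by simp
      ultimately show ?thesis unfolding tile_def by blast
    qed
    obtain A where A: "A \<subseteq> A0" "\<forall>h\<in>A. adjacent g h"
      "\<forall>z\<in>ball 0 r. (\<forall>h\<in>A. 0 \<le> side g h z) \<longrightarrow> z \<in> tile g"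
    proof (rule local_facets[OF g open_ball convex_ball _ A0 _ _ loc])
      show "ball 0 r \<subseteq> (hyp_space :: 'a set)" using r by auto
      show "g p \<in> ball 0 r" using r by simp
      fix h assume h: "h \<in> A0"
      then show "0 < side g h (g p)" using lor_ctr_pos[OF g] A0(2) by blast
    qed
    show "x \<in> tile g" using A(2,3) x r(1) by simp
  qed
qed

section \<open>Consequences of finite covolume\<close>

lemma countable_group: "countable \<Gamma>"
proof -
  have "\<Gamma> \<subseteq> (\<Union>n. {g \<in> \<Gamma>. snd (ctr g) \<le> real n})"
    using real_arch_simple by fastforce
  moreover have "countable (\<Union>n. {g \<in> \<Gamma>. snd (ctr g) \<le> real n})"
    by (intro countable_UN) (auto intro: countable_finite finite_ctr_bounded)
  ultimately show ?thesis by (rule countable_subset)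
qed

text \<open>Moving the pieces of \<open>U\<close> cut out by the translates of a fundamental set \<open>D\<close> back into \<open>D\<close>
  yields disjoint subsets of \<open>D\<close>.\<close>

lemma hvol_wandering_finite:
  assumes D: "fundamental_set \<Gamma> D" "emeasure hvol D < \<infinity>"
    and U: "open U" "U \<subseteq> hyp_space" and disj: "\<And>g h z. \<lbrakk>g \<in> \<Gamma>; h \<in> \<Gamma>; z \<in> hyp_space; g z \<in> U; h z \<in> U\<rbrakk> \<Longrightarrow> g = h"
  shows "emeasure hvol U < \<infinity>"
proof -
  have shv: "sets hvol = sets borel" by (simp add: hvol_def)
  have Db: "D \<in> sets borel" "D \<subseteq> hyp_space" "(\<Union>\<gamma>\<in>\<Gamma>. \<gamma> ` D) = hyp_space"
    using D(1) by (auto simp: fundamental_set_def shv)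
  define W where "W g = {x \<in> hyp_space. g x \<in> U} \<inter> D" for g
  have Wb: "W g \<in> sets borel" if "g \<in> \<Gamma>" for g
    unfolding W_def by (intro sets.Int isometry_borel[OF isom[OF that]] borel_open U(1) Db(1))
  have img: "g ` W g = U \<inter> {y \<in> hyp_space. ginv g y \<in> D}" if g: "g \<in> \<Gamma>" for g
  proof
    show "g ` W g \<subseteq> U \<inter> {y \<in> hyp_space. ginv g y \<in> D}"
    proof
      fix y assume "y \<in> g ` W g"
      then obtain x where x: "x \<in> hyp_space" "g x \<in> U" "x \<in> D" "y = g x" unfolding W_def by blast
      then show "y \<in> U \<inter> {y \<in> hyp_space. ginv g y \<in> D}"
        using act[OF g x(1)] ginv_left[OF g x(1)] by simp
    qed
    show "U \<inter> {y \<in> hyp_space. ginv g y \<in> D} \<subseteq> g ` W g"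
    proof
      fix y assume y: "y \<in> U \<inter> {y \<in> hyp_space. ginv g y \<in> D}"
      then have "g (ginv g y) = y" "ginv g y \<in> hyp_space"
        using ginv_right[OF g] act[OF ginv_closed[OF g]] by blast+
      then show "y \<in> g ` W g" using y unfolding W_def by (metis (mono_tags, lifting) IntD1 IntD2 IntI imageI mem_Collect_eq)
    qed
  qed
  have imgb: "g ` W g \<in> sets borel" if g: "g \<in> \<Gamma>" for g
    unfolding img[OF g] using U(1)
    by (intro sets.Int isometry_borel[OF isom[OF ginv_closed[OF g]] Db(1)] borel_open)
  have vol: "emeasure hvol (g ` W g) = emeasure hvol (W g)" if g: "g \<in> \<Gamma>" for g
    by (rule hvol_isometry_image[OF isom[OF g] Wb[OF g] _ imgb[OF g]]) (auto simp: W_def)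
  have cover: "U \<subseteq> (\<Union>g\<in>\<Gamma>. g ` W g)"
  proof
    fix y assume y: "y \<in> U"
    then have "y \<in> (\<Union>\<gamma>\<in>\<Gamma>. \<gamma> ` D)" using Db(3) U(2) by blast
    then obtain g x where "g \<in> \<Gamma>" "x \<in> D" "y = g x" by blast
    then have "x \<in> W g" using y Db(2) by (auto simp: W_def)
    then show "y \<in> (\<Union>g\<in>\<Gamma>. g ` W g)" using \<open>g \<in> \<Gamma>\<close> \<open>y = g x\<close> by blast
  qed
  define I where "I = to_nat_on \<Gamma> ` \<Gamma>"
  define e where "e = from_nat_into \<Gamma>"
  have eI: "e i \<in> \<Gamma>" "to_nat_on \<Gamma> (e i) = i" if "i \<in> I" for i
    using that countable_group by (auto simp: I_def e_def)
  have eS: "\<exists>i\<in>I. e i = g" if "g \<in> \<Gamma>" for g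
    using that countable_group by (auto simp: I_def e_def)
  define X where "X i = (if i \<in> I then W (e i) else {})" for i
  define Y where "Y i = (if i \<in> I then e i ` W (e i) else {})" for i
  have Xs: "range X \<subseteq> sets hvol" using Wb eI by (auto simp: X_def shv)
  have Ys: "range Y \<subseteq> sets hvol" using imgb eI by (auto simp: Y_def shv)
  have dX: "disjoint_family X"
    unfolding disjoint_family_on_def
  proof (intro ballI impI)
    fix i j :: nat assume ij: "i \<noteq> j"
    show "X i \<inter> X j = {}"
    proof (rule ccontr)
      assume "X i \<inter> X j \<noteq> {}"
      then obtain z where z: "z \<in> X i" "z \<in> X j" by blast
      then have i: "i \<in> I" "j \<in> I" "z \<in> W (e i)" "z \<in> W (e j)" by (auto simp: X_def split: if_splits)
      have "e i = e j" by (rule disj[of _ _ z]) (use i eI in \<open>auto simp: W_def\<close>)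
      then show False using eI i ij by metis
    qed
  qed
  have "U \<subseteq> (\<Union>i. Y i)"
  proof
    fix y assume "y \<in> U"
    then obtain g where "g \<in> \<Gamma>" "y \<in> g ` W g" using cover by blast
    then obtain i where "i \<in> I" "e i = g" using eS by blast
    then have "y \<in> Y i" using \<open>y \<in> g ` W g\<close> by (simp add: Y_def)
    then show "y \<in> (\<Union>i. Y i)" by blast
  qed
  then have "emeasure hvol U \<le> emeasure hvol (\<Union>i. Y i)" using Ys by (intro emeasure_mono) auto
  also have "\<dots> \<le> (\<Sum>i. emeasure hvol (Y i))" by (rule emeasure_subadditive_countably[OF Ys])
  also have "\<dots> = (\<Sum>i. emeasure hvol (X i))" by (rule suminf_cong) (simp add: X_def Y_def vol eI)
  also have "\<dots> = emeasure hvol (\<Union>i. X i)" by (rule suminf_emeasure[OF Xs dX])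
  also have "\<dots> \<le> emeasure hvol D"
    using Db shv by (intro emeasure_mono) (auto simp: X_def W_def split: if_splits)
  finally show ?thesis using D(2) by (rule le_less_trans)
qed

text \<open>The facet half-spaces are intersected in the whole Euclidean space rather than in the
  ball. This adds the ideal points of the tile, so that the theory of closed polyhedra and polytopes
  applies.\<close>

definition polyhedron_hull :: "'a set" where
  "polyhedron_hull = {x. \<forall>h. adjacent unit h \<longrightarrow> 0 \<le> side unit h x}"

lemma tile_unit_eq: "tile unit = polyhedron_hull \<inter> hyp_space"
  unfolding tile_eq_adjacent[OF unit_closed] polyhedron_hull_def by blast

lemma unit_p: "unit p = p"
  using p by (rule unit_apply)

lemma lor_p_pos: "\<lbrakk>h \<in> \<Gamma>; h \<noteq> unit\<rbrakk> \<Longrightarrow> 0 < side unit h p"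
  using lor_ctr_pos[OF unit_closed, of h] unfolding unit_p by blast

lemma hull_strict_nhd:
  assumes fin: "finite {h. adjacent unit h}"
    and x: "\<And>h. adjacent unit h \<Longrightarrow> 0 < side unit h x"
  shows "x \<in> interior polyhedron_hull"
proof -
  let ?O = "\<Inter>h\<in>{h. adjacent unit h}. {y. 0 < side unit h y}"
  have "open ?O" using fin by (intro open_INT ballI open_lor_halfspace) auto
  moreover have "x \<in> ?O" using x by blast
  moreover have "?O \<subseteq> polyhedron_hull" by (auto simp: polyhedron_hull_def intro: less_imp_le)
  ultimately show ?thesis by (meson interiorI)
qed

text \<open>If a hull point \<open>q\<close> lay outside the closed ball, the segment from
  \<open>p\<close> to \<open>q\<close> would cross the sphere at an interior point \<xi> of the
  hull. A cap at \<xi> would lie in the tile and no orbit would meet it twice, so its volume would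
  be finite, against \<open>hvol_boundary_cap\<close>.\<close>

lemma polyhedron_hull_subset_cball:
  assumes fin: "finite {h. adjacent unit h}" and d: "3 \<le> DIM('a)"
    and D: "fundamental_set \<Gamma> D" "emeasure hvol D < \<infinity>"
  shows "polyhedron_hull \<subseteq> cball 0 1"
proof
  fix q assume q: "q \<in> polyhedron_hull"
  show "q \<in> cball 0 1"
  proof (rule ccontr)
    assume "q \<notin> cball 0 1"
    then have nq: "1 < norm q" by simp
    have np: "norm p < 1" using p by simp
    have "\<exists>t\<ge>0. t \<le> 1 \<and> norm ((1 - t) *\<^sub>R p + t *\<^sub>R q) = 1"
      by (rule IVT') (use np nq in \<open>auto intro!: continuous_intros\<close>)
    then obtain t where t: "0 \<le> t" "t \<le> 1" "norm ((1 - t) *\<^sub>R p + t *\<^sub>R q) = 1" by blast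
    have t1: "t < 1" using t nq by (cases "t = 1") auto
    define \<xi> where "\<xi> = (1 - t) *\<^sub>R p + t *\<^sub>R q"
    have \<xi>pos: "0 < side unit h \<xi>" if h: "adjacent unit h" for h
    proof -
      have "0 < side unit h p" using h lor_p_pos by (auto simp: adjacent_def)
      moreover have "0 \<le> side unit h q" using q h by (simp add: polyhedron_hull_def)
      ultimately show ?thesis unfolding \<xi>_def lor_homog_combine using t t1 by (intro add_pos_nonneg) auto
    qed
    have "\<xi> \<in> interior polyhedron_hull" by (rule hull_strict_nhd[OF fin \<xi>pos])
    then obtain r where r: "0 < r" "ball \<xi> r \<subseteq> polyhedron_hull" by (meson mem_interior)
    define U where "U = ball \<xi> r \<inter> hyp_space"
    have oU: "open U" "U \<subseteq> hyp_space" by (auto simp: U_def)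
    have Utile: "U \<subseteq> tile unit"
      unfolding tile_unit_eq using r(2) by (auto simp: U_def)
    \<comment> \<open>If a bisector passed through \<open>z\<close>, a small move away from
      \<open>p\<close> would leave the tile without leaving the open set \<open>U\<close>.\<close>
    have strict: "0 < side unit h z" if z: "z \<in> U" and h: "h \<in> \<Gamma>" "h \<noteq> unit" for z h
    proof (rule ccontr)
      assume neg: "\<not> ?thesis"
      have "0 \<le> side unit h z" using lor_tile_nonneg Utile z h by blast
      then have z0: "side unit h z = 0" using neg by linarith
      obtain e where e: "0 < e" "ball z e \<subseteq> U" using oU(1) z by (metis openE)
      define m where "m = norm (z - p) + 1"
      define s where "s = e / (2 * m)"
      have dp: "0 < m" by (simp add: m_def add_nonneg_pos)
      have s: "0 < s" using e dp by (simp add: s_def)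
      have "s * norm (z - p) \<le> s * m" using s by (simp add: m_def)
      also have "\<dots> = e / 2" using dp by (simp add: s_def)
      finally have "s * norm (z - p) < e" using e by linarith
      then have "z + s *\<^sub>R (z - p) \<in> U" using e(2) s by (auto simp: dist_norm subset_iff)
      moreover have "z + s *\<^sub>R (z - p) = (1 - (- s)) *\<^sub>R z + (- s) *\<^sub>R p" by (simp add: algebra_simps)
      ultimately have "0 \<le> side unit h ((1 - (- s)) *\<^sub>R z + (- s) *\<^sub>R p)"
        using lor_tile_nonneg Utile h by auto
      then have "0 \<le> - s * side unit h p" unfolding lor_homog_combine z0 by simp
      then show False using s lor_p_pos[OF h] by (simp add: mult_le_0_iff)
    qed
    have wander: "g = h" if gh: "g \<in> \<Gamma>" "h \<in> \<Gamma>" "z \<in> hyp_space" "g z \<in> U" "h z \<in> U" for g h z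
    proof (rule ccontr)
      assume ne: "g \<noteq> h"
      \<comment> \<open>This element carries \<open>g z\<close> to \<open>h z\<close>, so
        \<open>h z\<close> lies in its tile, although \<open>strict\<close> puts \<open>h z\<close>
        properly on the side of the unit tile.\<close>
      let ?k = "h \<odot> ginv g"
      have k: "?k \<in> \<Gamma>" using gh mul_closed ginv_closed by blast
      have kg: "?k (g z) = h z"
        using ginv_left[OF gh(1,3)] by (simp only: mul_apply[OF act[OF gh(1,3)]])
      have "?k \<noteq> unit"
      proof
        assume "?k = unit"
        then have "(h \<odot> ginv g) (g p) = g p" using unit_apply[OF act[OF gh(1) p]] by simp
        then have "h p = g p" using ginv_left[OF gh(1) p] by (simp only: mul_apply[OF act[OF gh(1) p]])
        then show False using orbit_inj gh ne by metis
      qed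
      then have "0 < side unit ?k (h z)" using strict gh k by blast
      moreover have "g z \<in> tile unit" using Utile gh by blast
      then have "?k (g z) \<in> tile (?k \<odot> unit)" using act_mem_tile_iff[OF k unit_closed act[OF gh(1,3)]] by blast
      then have "h z \<in> tile ?k" unfolding kg mul_unit[OF k] .
      then have "0 \<le> side ?k unit (h z)" by (rule lor_tile_nonneg[OF _ unit_closed])
      ultimately show False by (simp add: lor_simps)
    qed
    have "emeasure hvol U < \<infinity>" by (rule hvol_wandering_finite[OF D oU wander])
    moreover have "emeasure hvol U = \<infinity>"
      unfolding U_def by (rule hvol_boundary_cap[OF _ r(1) d]) (simp add: \<xi>_def t)
    ultimately show False by simp
  qed
qed

lemma polyhedron_hull_polyhedron:
  assumes "finite {h. adjacent unit h}" shows "polyhedron polyhedron_hull"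
proof -
  have "polyhedron_hull = \<Inter>((\<lambda>h. {x. fst (ctr unit - ctr h) \<bullet> x \<ge> snd (ctr unit - ctr h)}) ` {h. adjacent unit h})"
    by (auto simp: polyhedron_hull_def lor_hom)
  then show ?thesis using assms by (auto intro!: polyhedron_Inter polyhedron_halfspace_ge)
qed

lemma p_interior_hull:
  assumes "finite {h. adjacent unit h}" shows "p \<in> interior polyhedron_hull"
  using assms lor_p_pos by (intro hull_strict_nhd) (auto simp: adjacent_def)

text \<open>Fewer than three normals leave a direction orthogonal to all of them, and the hull would
  contain a line in that direction.\<close>

lemma card_adjacent_ge_3:
  assumes fin: "finite {h. adjacent unit h}" and d: "3 \<le> DIM('a)" and sub: "polyhedron_hull \<subseteq> cball 0 1"
  shows "3 \<le> card {h. adjacent unit h}"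
proof (rule ccontr)
  assume "\<not> ?thesis"
  then have c: "card {h. adjacent unit h} \<le> 2" by simp
  let ?N = "(\<lambda>h. fst (ctr unit - ctr h)) ` {h. adjacent unit h}"
  have "dim ?N \<le> card ?N" using fin by (intro dim_le_card') auto
  also have "\<dots> \<le> 2" using c card_image_le[OF fin] le_trans by blast
  finally have "dim ?N < DIM('a)" using d by simp
  then obtain y where y: "y \<noteq> 0" "\<And>v. v \<in> span ?N \<Longrightarrow> orthogonal y v"
    using orthogonal_to_subspace_exists by blast
  \<comment> \<open>A shift of length 3 exceeds the diameter of the closed ball.\<close>
  define t where "t = 3 / norm y"
  have "p + t *\<^sub>R y \<in> polyhedron_hull"
  proof -
    have "0 \<le> side unit h (p + t *\<^sub>R y)" if h: "adjacent unit h" for h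
    proof -
      have "orthogonal y (fst (ctr unit - ctr h))" using y(2) h by (intro y(2) span_base) auto
      then have "side unit h (p + t *\<^sub>R y) = side unit h p"
        by (simp add: lor_hom orthogonal_def inner_add_right inner_commute[of _ y])
      then show ?thesis using lor_p_pos[of h] h by (auto simp: adjacent_def)
    qed
    then show ?thesis by (simp add: polyhedron_hull_def)
  qed
  then have "norm (p + t *\<^sub>R y) \<le> 1" using sub by auto
  moreover have "norm (t *\<^sub>R y) = 3" using y(1) by (simp add: t_def)
  ultimately show False using norm_triangle_ineq4[of "p + t *\<^sub>R y" p] p by simp
qed

end

section \<open>Ridges with large dihedral angle\<close>

text \<open>\<open>m\<close> is the Euclidean component of \<open>w\<close> orthogonal to
  \<open>span S\<close>, with its last coordinate negated to turn \<open>inner\<close> into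
  \<open>lor\<close>.\<close>

lemma lor_separate:
  assumes "w \<notin> span S"
  obtains m where "\<forall>s\<in>S. lor s m = 0" "lor w m \<noteq> 0"
proof -
  obtain y z where yz: "y \<in> span S" "\<And>v. v \<in> span S \<Longrightarrow> orthogonal z v" "w = y + z"
    using orthogonal_subspace_decomp_exists[of S w] by metis
  have z: "z \<noteq> 0" using yz assms by auto
  let ?m = "(fst z, - snd z)"
  have lm: "lor v ?m = v \<bullet> z" for v by (simp add: lor_eq_inner)
  have "lor s ?m = 0" if "s \<in> S" for s
    unfolding lm using yz(2)[OF span_base[OF that]] by (simp add: orthogonal_def inner_commute)
  moreover have "lor w ?m \<noteq> 0"
    unfolding lm yz(3) using yz(2)[OF yz(1)] z by (simp add: orthogonal_def inner_add_left inner_commute[of y])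
  ultimately show ?thesis using that by blast
qed

lemma lor_normalize:
  assumes "0 < lor w w" "lor u w \<noteq> 0"
  obtains c where "lor (c *\<^sub>R w) (c *\<^sub>R w) = 1" "lor u (c *\<^sub>R w) < 0"
proof -
  define c where "c = - sgn (lor u w) / sqrt (lor w w)"
  have "lor (c *\<^sub>R w) (c *\<^sub>R w) = 1"
    using assms by (simp add: lor_simps c_def sgn_if)
  moreover have "lor u (c *\<^sub>R w) < 0"
    using assms by (simp add: lor_simps c_def sgn_if mult_less_0_iff)
  ultimately show ?thesis using that by blast
qed

lemma homog_span_affine_hull:
  fixes Z :: "'a::euclidean_space set"
  assumes "homog x \<in> span (homog ` Z)"
  shows "x \<in> affine hull Z"
proof (rule ccontr)
  assume "x \<notin> affine hull Z"
  then have "aff_dim (insert x Z) = aff_dim Z + 1" by (simp add: aff_dim_insert)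
  moreover have "dim (homog ` insert x Z) = dim (homog ` Z)"
    using assms by (simp add: dim_insert)
  ultimately show False by (simp add: dim_hom)
qed

context dirichlet_tiling
begin

lemma convex_hull_set: "convex polyhedron_hull"
proof -
  have "polyhedron_hull = (\<Inter>h\<in>{h. adjacent unit h}. {x. 0 \<le> side unit h x})"
    by (auto simp: polyhedron_hull_def)
  then show ?thesis by (simp only:) (intro convex_INT convex_lor_halfspace)
qed

lemma p_mem_hull: "p \<in> polyhedron_hull"
  using lor_p_pos by (auto simp: polyhedron_hull_def adjacent_def intro: less_imp_le)

text \<open>The hull is defined by adjacent tiles only and has points on the sphere. An inequality
  violated at \<open>q\<close> would remain violated at a nearby point of the segment to
  \<open>p\<close>; that point is in the open ball, hence in the tile.\<close>

lemma lor_hull_nonneg: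
  assumes sub: "polyhedron_hull \<subseteq> cball 0 1" and q: "q \<in> polyhedron_hull" and h: "h \<in> \<Gamma>"
  shows "0 \<le> side unit h q"
proof (cases "h = unit")
  case True
  then show ?thesis by (simp add: lor_simps)
next
  case False
  define P where "P = side unit h p"
  define L where "L = side unit h q"
  have P: "0 < P" unfolding P_def by (rule lor_p_pos[OF h False])
  have "0 \<le> L"
  proof (rule ccontr)
    assume "\<not> 0 \<le> L"
    then have L: "L < 0" by simp
    define K where "K = P - L"
    have K: "0 < K" "- L < K" using L P by (auto simp: K_def)
    \<comment> \<open>With this weight the affine function takes the value \<open>L / 2\<close> at
      \<open>z\<close>.\<close>
    define s where "s = - L / (2 * K)"
    have s: "0 < s" "s < 1" using L K by (auto simp: s_def field_simps)
    define z where "z = (1 - (1 - s)) *\<^sub>R p + (1 - s) *\<^sub>R q"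
    have "z \<in> polyhedron_hull"
      unfolding z_def using s by (intro convexD_alt[OF convex_hull_set p_mem_hull q]) auto
    moreover have "norm z < 1"
    proof -
      have "norm z \<le> s * norm p + (1 - s) * norm q"
        using norm_triangle_ineq[of "s *\<^sub>R p" "(1 - s) *\<^sub>R q"] s by (simp add: z_def)
      also have "\<dots> < s * 1 + (1 - s) * 1"
        using s p sub q by (intro add_less_le_mono mult_strict_left_mono mult_left_mono) auto
      finally show ?thesis by simp
    qed
    ultimately have "z \<in> tile unit" unfolding tile_unit_eq by simp
    then have "0 \<le> side unit h z" using h by (rule lor_tile_nonneg)
    then have "0 \<le> s * P + (1 - s) * L" unfolding z_def lor_homog_combine P_def L_def by simp
    also have "s * P + (1 - s) * L = L + s * K" by (simp add: K_def algebra_simps)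
    also have "\<dots> = L / 2" using K by (simp add: s_def)
    finally show False using L by simp
  qed
  then show ?thesis by (simp add: L_def)
qed

lemma hull_Int_face:
  assumes sub: "polyhedron_hull \<subseteq> cball 0 1" and h: "h \<in> \<Gamma>"
  shows "polyhedron_hull \<inter> {x. side unit h x = 0} face_of polyhedron_hull"
  using face_of_Int_supporting_hyperplane_ge[OF convex_hull_set, of "snd (ctr unit - ctr h)" "fst (ctr unit - ctr h)"]
    lor_hull_nonneg[OF sub _ h] by (simp add: lor_hom)

text \<open>A relative interior point of the facet lies on the bisector of some adjacent tile, since
  otherwise it would be interior to the hull. The face cut out by that bisector contains the facet,
  and dimensions force equality.\<close>

lemma hull_facet:
  assumes fin: "finite {h. adjacent unit h}" and sub: "polyhedron_hull \<subseteq> cball 0 1"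
    and f: "f facet_of polyhedron_hull"
  obtains h where "adjacent unit h" "f = polyhedron_hull \<inter> {x. side unit h x = 0}"
proof -
  have ff: "f face_of polyhedron_hull" "f \<noteq> {}" and df: "aff_dim f = aff_dim polyhedron_hull - 1"
    using f by (auto simp: facet_of_def)
  have cf: "convex f" using face_of_imp_convex ff by blast
  then obtain x where x: "x \<in> rel_interior f" using ff(2) rel_interior_eq_empty by blast
  have xf: "x \<in> f" and fQ: "f \<subseteq> polyhedron_hull"
    using x rel_interior_subset face_of_imp_subset[OF ff(1)] by blast+
  have "\<exists>h. adjacent unit h \<and> side unit h x = 0"
  proof (rule ccontr)
    assume no: "\<not> ?thesis"
    have "x \<in> interior polyhedron_hull"
    proof (rule hull_strict_nhd[OF fin])
      fix h assume h: "adjacent unit h"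
      then have "0 \<le> side unit h x" "side unit h x \<noteq> 0"
        using fQ xf no by (auto simp: polyhedron_hull_def)
      then show "0 < side unit h x" by simp
    qed
    then have "f \<inter> rel_interior polyhedron_hull \<noteq> {}"
      using xf interior_subset_rel_interior by blast
    then have "polyhedron_hull \<subseteq> f" by (rule subset_of_face_of[OF ff(1) order_refl])
    then have "f = polyhedron_hull" using fQ by blast
    then show False using df by simp
  qed
  then obtain h where h: "adjacent unit h" "side unit h x = 0" by blast
  have hG: "h \<in> \<Gamma>" "h \<noteq> unit" using h by (auto simp: adjacent_def)
  define g where "g = polyhedron_hull \<inter> {x. side unit h x = 0}"
  have gface: "g face_of polyhedron_hull" unfolding g_def by (rule hull_Int_face[OF sub hG(1)])
  have "g \<inter> rel_interior f \<noteq> {}" using x xf fQ h(2) by (auto simp: g_def)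
  then have fg: "f \<subseteq> g" by (rule subset_of_face_of[OF gface fQ])
  have "p \<notin> g" using lor_p_pos[OF hG] by (simp add: g_def)
  then have "g \<noteq> polyhedron_hull" using p_mem_hull by blast
  then have lt: "aff_dim g < aff_dim polyhedron_hull" by (rule face_of_aff_dim_lt[OF convex_hull_set gface])
  have fgf: "f face_of g" using face_of_subset[OF ff(1) fg] face_of_imp_subset[OF gface] by blast
  have "f = g"
  proof (rule ccontr)
    assume "f \<noteq> g"
    then have "aff_dim f < aff_dim g" by (rule face_of_aff_dim_lt[OF face_of_imp_convex[OF gface] fgf])
    then show False using lt df by simp
  qed
  then show ?thesis using that h(1) by (simp add: g_def)
qed

text \<open>The two facets through the ridge provide the tiles \<open>a\<close> and
  \<open>b\<close>. For the last claim, \<open>side unit h\<close> is nonnegative on the hull, so a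
  zero at a relative interior point of \<open>e\<close> spreads over all of
  \<open>e\<close>.\<close>

lemma ridge_point:
  assumes fin: "finite {h. adjacent unit h}" and sub: "polyhedron_hull \<subseteq> cball 0 1"
    and f: "f facet_of polyhedron_hull" and e: "e facet_of f" and x: "x \<in> rel_interior e" "x \<in> hyp_space"
  shows "x \<in> tile unit"
    and "\<exists>a b. a \<in> \<Gamma> \<and> b \<in> \<Gamma> \<and> a \<noteq> unit \<and> b \<noteq> unit \<and> a \<noteq> b \<and> x \<in> tile a \<and> x \<in> tile b"
    and "\<And>h z. \<lbrakk>h \<in> \<Gamma>; side unit h x = 0; z \<in> e\<rbrakk> \<Longrightarrow> side unit h z = 0"
proof -
  have xe: "x \<in> e" using x(1) rel_interior_subset by blast
  have eQ: "e \<subseteq> polyhedron_hull" using e f facet_of_imp_subset by blast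
  show xt: "x \<in> tile unit" unfolding tile_unit_eq using xe eQ x(2) by blast
  obtain g where g: "g facet_of polyhedron_hull" "g \<noteq> f" "e = f \<inter> g"
    by (rule polyhedron_facet_of_facet[OF polyhedron_hull_polyhedron[OF fin] f e])
  obtain a where a: "adjacent unit a" "f = polyhedron_hull \<inter> {x. side unit a x = 0}"
    by (rule hull_facet[OF fin sub f])
  obtain b where b: "adjacent unit b" "g = polyhedron_hull \<inter> {x. side unit b x = 0}"
    by (rule hull_facet[OF fin sub g(1)])
  have "a \<noteq> b" using a b g(2) by blast
  moreover have "x \<in> tile a" using mem_tile_transfer[OF xt, of a] xe g(3) a(2) by blast
  moreover have "x \<in> tile b" using mem_tile_transfer[OF xt, of b] xe g(3) b(2) by blast
  ultimately show "\<exists>a b. a \<in> \<Gamma> \<and> b \<in> \<Gamma> \<and> a \<noteq> unit \<and> b \<noteq> unit \<and> a \<noteq> b \<and> x \<in> tile a \<and> x \<in> tile b"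
    using a(1) b(1) unfolding adjacent_def by metis
  fix h z assume h: "h \<in> \<Gamma>" "side unit h x = 0" and z: "z \<in> e"
  have "(polyhedron_hull \<inter> {x. side unit h x = 0}) \<inter> rel_interior e \<noteq> {}"
    using x(1) xe eQ h(2) by blast
  then have "e \<subseteq> polyhedron_hull \<inter> {x. side unit h x = 0}"
    by (rule subset_of_face_of[OF hull_Int_face[OF sub h(1)] eQ])
  then show "side unit h z = 0" using z by blast
qed

text \<open>The data of a ridge through \<open>x\<close> with dihedral angle at least \<open>\<pi> / 3\<close>: the outer unit normals
  \<open>m\<close>, \<open>n\<close> of a wedge of at least that angle contained in the tile near \<open>x\<close>; the points \<open>u\<close>, \<open>v\<close>
  of the tile lie on the two sides of that wedge.\<close>

definition fat_ridge :: "'a \<Rightarrow> 'a \<times> real \<Rightarrow> 'a \<times> real \<Rightarrow> 'a \<Rightarrow> 'a \<Rightarrow> bool" where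
  "fat_ridge x m n u v \<longleftrightarrow> x \<in> tile unit \<and>
    (\<exists>a b. a \<in> \<Gamma> \<and> b \<in> \<Gamma> \<and> a \<noteq> unit \<and> b \<noteq> unit \<and> a \<noteq> b \<and> x \<in> tile a \<and> x \<in> tile b) \<and>
    u \<in> tile unit \<and> v \<in> tile unit \<and> lor m m = 1 \<and> lor n n = 1 \<and> - 1 / 2 \<le> lor m n \<and>
    lor (homog x) m = 0 \<and> lor (homog x) n = 0 \<and>
    lor (homog u) m = 0 \<and> lor (homog u) n < 0 \<and> lor (homog v) n = 0 \<and> lor (homog v) m < 0 \<and>
    (\<forall>h\<in>\<Gamma>. side unit h x = 0 \<longrightarrow> (\<exists>\<alpha> \<beta>. ctr unit - ctr h = \<alpha> *\<^sub>R m + \<beta> *\<^sub>R n))"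

text \<open>A bisector through \<open>x\<close> contains the whole ridge and therefore
  \<open>Z\<close>. As \<open>x\<close>, \<open>u\<close>, \<open>v\<close> and \<open>Z\<close>
  span, its normal is determined by its values at \<open>u\<close> and \<open>v\<close>; since
  \<open>m\<close> vanishes at \<open>u\<close> and \<open>n\<close> at \<open>v\<close>, the two
  coefficients can be matched separately.\<close>

lemma fat_ridgeI:
  assumes fin: "finite {h. adjacent unit h}" and sub: "polyhedron_hull \<subseteq> cball 0 1"
    and f: "f facet_of polyhedron_hull" and e: "e facet_of f" and x: "x \<in> rel_interior e" "x \<in> hyp_space"
    and Z: "Z \<subseteq> e" "\<And>z. z \<in> Z \<Longrightarrow> lor (homog z) m = 0" "\<And>z. z \<in> Z \<Longrightarrow> lor (homog z) n = 0"
    and uv: "u \<in> tile unit" "v \<in> tile unit" 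
    and mn: "lor m m = 1" "lor n n = 1" "- 1 / 2 \<le> lor m n" "lor (homog x) m = 0" "lor (homog x) n = 0"
      "lor (homog u) m = 0" "lor (homog u) n < 0" "lor (homog v) n = 0" "lor (homog v) m < 0"
    and full: "span (insert (homog x) (insert (homog u) (insert (homog v) (homog ` Z)))) = UNIV"
  shows "fat_ridge x m n u v"
proof -
  note r = ridge_point[OF fin sub f e x]
  have "\<exists>\<alpha> \<beta>. ctr unit - ctr h = \<alpha> *\<^sub>R m + \<beta> *\<^sub>R n"
    if h: "h \<in> \<Gamma>" "side unit h x = 0" for h
  proof -
    let ?w = "ctr unit - ctr h"
    define \<alpha> where "\<alpha> = lor (homog v) ?w / lor (homog v) m"
    define \<beta> where "\<beta> = lor (homog u) ?w / lor (homog u) n"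
    define y where "y = ?w - \<alpha> *\<^sub>R m - \<beta> *\<^sub>R n"
    have ly: "lor s y = lor s ?w - \<alpha> * lor s m - \<beta> * lor s n" for s
      unfolding y_def by (simp only: lor_diff_right lor_scale_right)
    have "y = 0"
    proof (rule lor_nondegenerate)
      fix s
      have "lor s y = 0"
      proof (rule lor_span_zero)
        show "s \<in> span (insert (homog x) (insert (homog u) (insert (homog v) (homog ` Z))))" using full by blast
        fix t assume "t \<in> insert (homog x) (insert (homog u) (insert (homog v) (homog ` Z)))"
        then consider "t = homog x" | "t = homog u" | "t = homog v" | z where "z \<in> Z" "t = homog z" by blast
        then show "lor t y = 0"
        proof cases
          case 1
          then show ?thesis unfolding ly using h(2) mn by simp
        next
          case 2
          then show ?thesis unfolding ly using mn by (simp add: \<beta>_def)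
        next
          case 3
          then show ?thesis unfolding ly using mn by (simp add: \<alpha>_def)
        next
          case 4
          then have "lor t ?w = 0" using r(3)[OF h] Z(1) by blast
          then show ?thesis unfolding ly using Z(2,3) 4 by simp
        qed
      qed
      then show "lor y s = 0" by (simp add: lor_commute[of y s])
    qed
    then have "?w = \<alpha> *\<^sub>R m + \<beta> *\<^sub>R n" by (simp add: y_def algebra_simps)
    then show ?thesis by blast
  qed
  then show ?thesis unfolding fat_ridge_def using r(1,2) uv mn by blast
qed

text \<open>The ridge \<open>e1\<close> is common to the facets \<open>F\<close> and
  \<open>F'\<close>; through its facet \<open>Z\<close> pass a second ridge \<open>e2\<close> of
  \<open>F\<close> and a second ridge \<open>e3\<close> of \<open>F'\<close>. The plane through
  \<open>e2\<close> and \<open>e3\<close> need not carry a facet, but by convexity the wedge it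
  forms with \<open>F\<close> or \<open>F'\<close> lies in the tile near the ridge. A lower bound
  for the angle of this smaller wedge is enough.\<close>

lemma fat_ridge_exists:
  assumes fin: "finite {h. adjacent unit h}" and d: "3 \<le> DIM('a)" and sub: "polyhedron_hull \<subseteq> cball 0 1"
  obtains x m n u v where "fat_ridge x m n u v"
proof -
  let ?Q = "polyhedron_hull"
  have polyQ: "polyhedron ?Q" by (rule polyhedron_hull_polyhedron[OF fin])
  then have ptQ: "polytope ?Q"
    using sub bounded_subset[OF bounded_cball] by (simp add: polytope_eq_bounded_polyhedron) blast
  have dQ: "aff_dim ?Q = int DIM('a)"
    using p_interior_hull[OF fin] by (intro aff_dim_nonempty_interior) blast
  obtain F where F: "F facet_of ?Q" using polytope_facet_exists[OF ptQ] dQ d by auto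
  have ptF: "polytope F" using face_of_polytope_polytope[OF ptQ] F facet_of_imp_face_of by blast
  have dF: "aff_dim F = int DIM('a) - 1" using F dQ by (simp add: facet_of_def)
  obtain e1 where e1: "e1 facet_of F" using polytope_facet_exists[OF ptF] dF d by auto
  have pte1: "polytope e1" using face_of_polytope_polytope[OF ptF] e1 facet_of_imp_face_of by blast
  have de1: "aff_dim e1 = int DIM('a) - 2" using e1 dF by (simp add: facet_of_def)
  obtain Z where Z: "Z facet_of e1" using polytope_facet_exists[OF pte1] de1 d by auto
  have dZ: "aff_dim Z = int DIM('a) - 3" and Zne: "Z \<noteq> {}" and Ze1: "Z face_of e1"
    using Z de1 by (auto simp: facet_of_def)
  obtain F' where F': "F' facet_of ?Q" "F' \<noteq> F" "e1 = F \<inter> F'" by (rule polyhedron_facet_of_facet[OF polyQ F e1])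
  have ptF': "polytope F'" using face_of_polytope_polytope[OF ptQ] F'(1) facet_of_imp_face_of by blast
  have dF': "aff_dim F' = int DIM('a) - 1" using F'(1) dQ by (simp add: facet_of_def)
  have face: "F face_of ?Q" "F' face_of ?Q" using F F'(1) facet_of_imp_face_of by blast+
  have FQ: "F \<subseteq> ?Q" "F' \<subseteq> ?Q" using face face_of_imp_subset by blast+
  have e1Q: "e1 face_of ?Q" unfolding F'(3) by (rule face_of_Int[OF face])
  have e1F': "e1 facet_of F'"
    using face_of_subset[OF e1Q, of F'] F'(3) FQ de1 dF' e1 by (auto simp: facet_of_def)
  obtain e2 where e2: "e2 facet_of F" "e2 \<noteq> e1" "Z = e1 \<inter> e2"
    by (rule polyhedron_facet_of_facet[OF polytope_imp_polyhedron[OF ptF] e1 Z])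
  obtain e3 where e3: "e3 facet_of F'" "e3 \<noteq> e1" "Z = e1 \<inter> e3"
    by (rule polyhedron_facet_of_facet[OF polytope_imp_polyhedron[OF ptF'] e1F' Z])
  have de2: "aff_dim e2 = int DIM('a) - 2" and de3: "aff_dim e3 = int DIM('a) - 2"
    using e2(1) e3(1) dF dF' by (auto simp: facet_of_def)
  have eF: "e1 \<subseteq> F" "e2 \<subseteq> F" "e3 \<subseteq> F'" "e1 \<subseteq> F'"
    using e1 e2(1) e3(1) F'(3) facet_of_imp_subset by blast+
  have pt: "\<exists>x. x \<in> rel_interior e \<and> x \<in> hyp_space \<and> x \<in> tile unit"
    if e: "convex e" "e \<subseteq> ?Q" "aff_dim e = int DIM('a) - 2" for e
  proof -
    have "e \<noteq> {}" using e(3) d by force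
    then obtain x where x: "x \<in> rel_interior e" using rel_interior_eq_empty[OF e(1)] by blast
    have xb: "x \<in> hyp_space"
    proof (rule rel_interior_in_hyp_space[OF e(1) _ _ x])
      show "e \<subseteq> cball 0 1" using e(2) sub by blast
      show "0 < aff_dim e" using e(3) d by simp
    qed
    moreover have "x \<in> ?Q" using x rel_interior_subset e(2) by blast
    ultimately show ?thesis using x unfolding tile_unit_eq by blast
  qed
  have cve: "convex e1" "convex e2" "convex e3"
    using e1 e2(1) e3(1) facet_of_imp_face_of face_of_imp_convex by blast+
  obtain x1 where x1: "x1 \<in> rel_interior e1" "x1 \<in> hyp_space" "x1 \<in> tile unit"
    using pt[OF cve(1) _ de1] eF FQ by blast
  obtain x2 where x2: "x2 \<in> rel_interior e2" "x2 \<in> hyp_space" "x2 \<in> tile unit"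
    using pt[OF cve(2) _ de2] eF FQ by blast
  obtain x3 where x3: "x3 \<in> rel_interior e3" "x3 \<in> hyp_space" "x3 \<in> tile unit"
    using pt[OF cve(3) _ de3] eF FQ by blast
  have xe: "x1 \<in> e1" "x2 \<in> e2" "x3 \<in> e3" using x1(1) x2(1) x3(1) rel_interior_subset by blast+
  obtain a where a: "adjacent unit a" "F = ?Q \<inter> {x. side unit a x = 0}"
    by (rule hull_facet[OF fin sub F])
  obtain b where b: "adjacent unit b" "F' = ?Q \<inter> {x. side unit b x = 0}"
    by (rule hull_facet[OF fin sub F'(1)])
  define na where "na = ctr unit - ctr a"
  define nb where "nb = ctr unit - ctr b"
  have aG: "a \<in> \<Gamma>" "b \<in> \<Gamma>" using a(1) b(1) by (auto simp: adjacent_def)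
  \<comment> \<open>A relative interior point of \<open>e2\<close> in \<open>F'\<close> would pull
    all of \<open>e2\<close> into \<open>e1\<close>, which has the same dimension; \<open>e3\<close>
    is symmetric.\<close>
  have notin: "x2 \<notin> F'" "x3 \<notin> F"
  proof -
    show "x2 \<notin> F'"
    proof
      assume "x2 \<in> F'"
      then have "F' \<inter> rel_interior e2 \<noteq> {}" using x2(1) by blast
      then have "e2 \<subseteq> F'" using subset_of_face_of[OF face(2)] eF(2) FQ(1) by blast
      then have e21: "e2 \<subseteq> e1" using F'(3) eF by blast
      have "e2 face_of e1"
        using face_of_subset[OF facet_of_imp_face_of[OF e2(1)] e21 eF(1)] .
      then have "aff_dim e2 < aff_dim e1" using face_of_aff_dim_lt[OF cve(1)] e2(2) by blast
      then show False using de1 de2 by simp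
    qed
    show "x3 \<notin> F"
    proof
      assume "x3 \<in> F"
      then have "F \<inter> rel_interior e3 \<noteq> {}" using x3(1) by blast
      then have "e3 \<subseteq> F" using subset_of_face_of[OF face(1)] eF(3) FQ(2) by blast
      then have e31: "e3 \<subseteq> e1" using F'(3) eF by blast
      have "e3 face_of e1"
        using face_of_subset[OF facet_of_imp_face_of[OF e3(1)] e31 eF(4)] .
      then have "aff_dim e3 < aff_dim e1" using face_of_aff_dim_lt[OF cve(1)] e3(2) by blast
      then show False using de1 de3 by simp
    qed
  qed
  have Fna: "lor (homog y) na = 0" if "y \<in> F" for y using that a(2) by (simp add: na_def)
  have Fnb: "lor (homog y) nb = 0" if "y \<in> F'" for y using that b(2) by (simp add: nb_def)
  have u1: "lor (homog x1) na = 0" "lor (homog x1) nb = 0" using Fna Fnb xe eF by blast+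
  have u2: "lor (homog x2) na = 0" "0 < lor (homog x2) nb"
  proof -
    show "lor (homog x2) na = 0" using Fna xe eF by blast
    have q: "x2 \<in> ?Q" using xe eF FQ by blast
    then have "0 \<le> lor (homog x2) nb" unfolding nb_def by (rule lor_hull_nonneg[OF sub _ aG(2)])
    moreover have "lor (homog x2) nb \<noteq> 0" using notin(1) b(2) q by (simp add: nb_def)
    ultimately show "0 < lor (homog x2) nb" by simp
  qed
  have u3: "lor (homog x3) nb = 0" "0 < lor (homog x3) na"
  proof -
    show "lor (homog x3) nb = 0" using Fnb xe eF by blast
    have q: "x3 \<in> ?Q" using xe eF FQ by blast
    then have "0 \<le> lor (homog x3) na" unfolding na_def by (rule lor_hull_nonneg[OF sub _ aG(1)])
    moreover have "lor (homog x3) na \<noteq> 0" using notin(2) a(2) q by (simp add: na_def)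
    ultimately show "0 < lor (homog x3) na" by simp
  qed
  have Zsub: "Z \<subseteq> e1" "Z \<subseteq> e2" "Z \<subseteq> e3" using e2(3) e3(3) by blast+
  have Zn: "lor (homog z) na = 0" "lor (homog z) nb = 0" if "z \<in> Z" for z
    using Fna Fnb that Zsub(1) eF by blast+
  let ?M = "homog ` Z"
  have spanM: "lor s na = 0" "lor s nb = 0" if "s \<in> span ?M" for s
    using lor_span_zero[OF that] Zn by blast+
  have x1M: "homog x1 \<notin> span ?M"
  proof
    assume "homog x1 \<in> span ?M"
    then have "x1 \<in> affine hull Z" by (rule homog_span_affine_hull)
    then have "x1 \<in> Z" using face_of_imp_eq_affine_Int[OF cve(1) Ze1] xe by blast
    then have "e1 \<subseteq> Z" using subset_of_face_of[OF Ze1 order_refl] x1(1) by blast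
    then have "Z = e1" using Zsub by blast
    then show False using dZ de1 by simp
  qed
  have ind1: "homog x1 \<notin> span (insert (homog x2) (insert (homog x3) ?M))"
  proof
    assume "homog x1 \<in> span (insert (homog x2) (insert (homog x3) ?M))"
    then obtain \<alpha> where "homog x1 - \<alpha> *\<^sub>R homog x2 \<in> span (insert (homog x3) ?M)"
      using span_breakdown_eq by blast
    then obtain \<beta> where in_span: "homog x1 - \<alpha> *\<^sub>R homog x2 - \<beta> *\<^sub>R homog x3 \<in> span ?M"
      using span_breakdown_eq by blast
    have "\<alpha> * lor (homog x2) nb = 0" using spanM(2)[OF in_span] u1 u3 by (simp add: lor_simps)
    moreover have "\<beta> * lor (homog x3) na = 0" using spanM(1)[OF in_span] u1 u2 by (simp add: lor_simps)
    ultimately have "\<alpha> = 0" "\<beta> = 0" using u2 u3 by auto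
    then show False using in_span x1M by simp
  qed
  have x2n: "homog x2 \<notin> span (insert (homog x1) ?M)"
  proof
    assume "homog x2 \<in> span (insert (homog x1) ?M)"
    then have "lor (homog x2) nb = 0" by (rule lor_span_zero) (use u1 Zn in blast)
    then show False using u2 by simp
  qed
  have x3n: "homog x3 \<notin> span (insert (homog x2) (insert (homog x1) ?M))"
  proof
    assume "homog x3 \<in> span (insert (homog x2) (insert (homog x1) ?M))"
    then have "lor (homog x3) na = 0" by (rule lor_span_zero) (use u1 u2 Zn in blast)
    then show False using u3 by simp
  qed
  have "int (dim ?M) = int DIM('a) - 2" using dim_hom[of Z] dZ by simp
  then have "dim (insert (homog x3) (insert (homog x2) (insert (homog x1) ?M))) = DIM('a \<times> real)"
    using x1M x2n x3n d by (simp add: dim_insert)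
  then have full: "span (insert (homog x3) (insert (homog x2) (insert (homog x1) ?M))) = UNIV"
    by (simp only: dim_eq_full)
  have npos: "0 < lor w w" if "lor (homog x) w = 0" "x \<in> hyp_space" "lor y w \<noteq> 0" for x y w
  proof -
    have "w \<noteq> 0" using that(3) by (auto simp: lor_simps)
    then show ?thesis using lor_causal_orthogonal(2)[OF _ that(1)] that(2) by simp
  qed
  \<comment> \<open>\<open>m0\<close> is normal to the plane through \<open>e2\<close> and
    \<open>e3\<close>. The signs chosen below make all three unit normals point out of the trihedral
    cone of \<open>x1\<close>, \<open>x2\<close>, \<open>x3\<close> over \<open>Z\<close>.\<close>
  obtain m0 where "\<forall>s\<in>insert (homog x2) (insert (homog x3) ?M). lor s m0 = 0" and m01: "lor (homog x1) m0 \<noteq> 0"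
    by (rule lor_separate[OF ind1])
  then have m0: "lor (homog x2) m0 = 0" "lor (homog x3) m0 = 0" "\<And>z. z \<in> Z \<Longrightarrow> lor (homog z) m0 = 0"
    by blast+
  obtain c1 where c1: "lor (c1 *\<^sub>R m0) (c1 *\<^sub>R m0) = 1" "lor (homog x1) (c1 *\<^sub>R m0) < 0"
    by (rule lor_normalize[OF npos[OF m0(1) x2(2) m01] m01])
  obtain c2 where c2: "lor (c2 *\<^sub>R nb) (c2 *\<^sub>R nb) = 1" "lor (homog x2) (c2 *\<^sub>R nb) < 0"
    by (rule lor_normalize[OF npos[OF u1(2) x1(2), of "homog x2"], of "homog x2"]) (use u2 in auto)
  obtain c3 where c3: "lor (c3 *\<^sub>R na) (c3 *\<^sub>R na) = 1" "lor (homog x3) (c3 *\<^sub>R na) < 0"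
    by (rule lor_normalize[OF npos[OF u1(1) x1(2), of "homog x3"], of "homog x3"]) (use u3 in auto)
  define m1 where "m1 = c1 *\<^sub>R m0"
  define m2 where "m2 = c2 *\<^sub>R nb"
  define m3 where "m3 = c3 *\<^sub>R na"
  have M1: "lor m1 m1 = 1" "lor (homog x1) m1 < 0" "lor (homog x2) m1 = 0" "lor (homog x3) m1 = 0"
    using c1 m0 by (auto simp: m1_def lor_scale_right)
  have M2: "lor m2 m2 = 1" "lor (homog x2) m2 < 0" "lor (homog x1) m2 = 0" "lor (homog x3) m2 = 0"
    using c2 u1 u3 by (auto simp: m2_def lor_scale_right)
  have M3: "lor m3 m3 = 1" "lor (homog x3) m3 < 0" "lor (homog x1) m3 = 0" "lor (homog x2) m3 = 0"
    using c3 u1 u2 by (auto simp: m3_def lor_scale_right)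
  have ZM: "lor (homog z) m1 = 0" "lor (homog z) m2 = 0" "lor (homog z) m3 = 0" if "z \<in> Z" for z
    using Zn[OF that] m0(3)[OF that] by (auto simp: m1_def m2_def m3_def lor_scale_right)
  obtain z where z: "z \<in> Z" using Zne by blast
  have nz: "norm z \<le> 1" using z Zsub eF FQ sub by (auto simp: subset_iff)
  text \<open>The form is positive semidefinite on the orthogonal complement of the causal vector
    \<open>homog z\<close>, so the three unit normals cannot make pairwise angles above \<open>2 * \<pi> / 3\<close>.\<close>
  have "0 \<le> lor (m1 + m2 + m3) (m1 + m2 + m3)"
    by (rule lor_causal_orthogonal(1)[OF nz]) (use ZM[OF z] in \<open>simp add: lor_add_right\<close>)
  also have "\<dots> = 3 + 2 * (lor m1 m2 + lor m1 m3 + lor m2 m3)"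
    using M1(1) M2(1) M3(1)
    by (simp add: lor_add_left lor_add_right lor_commute[of m2 m1] lor_commute[of m3 m1] lor_commute[of m3 m2])
  finally have sum: "0 \<le> 3 + 2 * (lor m1 m2 + lor m1 m3 + lor m2 m3)" .
  have "- 1 / 2 \<le> lor m1 m2 \<or> - 1 / 2 \<le> lor m1 m3 \<or> - 1 / 2 \<le> lor m2 m3"
  proof (rule ccontr)
    assume "\<not> ?thesis"
    then have "lor m1 m2 < - 1 / 2" "lor m1 m3 < - 1 / 2" "lor m2 m3 < - 1 / 2" by auto
    then show False using sum by simp
  qed
  then consider "- 1 / 2 \<le> lor m1 m2" | "- 1 / 2 \<le> lor m1 m3" | "- 1 / 2 \<le> lor m2 m3" by blast
  then show ?thesis
  proof cases
    case 1
    have "fat_ridge x3 m1 m2 x2 x1"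
      by (rule fat_ridgeI[OF fin sub F'(1) e3(1) x3(1,2) Zsub(3) ZM(1,2) x2(3) x1(3)
          M1(1) M2(1) 1 M1(4) M2(4) M1(3) M2(2) M2(3) M1(2) full])
    then show ?thesis by (rule that)
  next
    case 2
    have full': "span (insert (homog x2) (insert (homog x3) (insert (homog x1) ?M))) = UNIV"
      using full by (simp only: insert_commute[of "homog x3" "homog x2"])
    have "fat_ridge x2 m1 m3 x3 x1"
      by (rule fat_ridgeI[OF fin sub F e2(1) x2(1,2) Zsub(2) ZM(1,3) x3(3) x1(3)
          M1(1) M3(1) 2 M1(3) M3(4) M1(4) M3(2) M3(3) M1(2) full'])
    then show ?thesis by (rule that)
  next
    case 3
    have "insert (homog x3) (insert (homog x2) (insert (homog x1) ?M)) = insert (homog x1) (insert (homog x3) (insert (homog x2) ?M))"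
      by blast
    then have full': "span (insert (homog x1) (insert (homog x3) (insert (homog x2) ?M))) = UNIV"
      using full by simp
    have "fat_ridge x1 m2 m3 x3 x2"
      by (rule fat_ridgeI[OF fin sub F e1 x1(1,2) Zsub(1) ZM(2,3) x3(3) x2(3)
          M2(1) M3(1) 3 M2(3) M3(3) M2(4) M3(2) M3(4) M2(2) full'])
    then show ?thesis by (rule that)
  qed
qed

end

section \<open>Tiles around a ridge\<close>

lemma card_le_fibres:
  assumes "finite V" "finite T" "f ` V \<subseteq> T" and le: "\<And>t. t \<in> T \<Longrightarrow> card {g \<in> V. f g = t} \<le> c"
  shows "card V \<le> c * card T"
proof -
  have "V = (\<Union>t\<in>T. {g \<in> V. f g = t})" using assms(3) by blast
  then have "card V \<le> (\<Sum>t\<in>T. card {g \<in> V. f g = t})" using card_UN_le[OF assms(2)] by metis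
  also have "\<dots> \<le> (\<Sum>t\<in>T. c)" by (rule sum_mono[OF le])
  finally show ?thesis by (simp add: mult.commute)
qed

context dirichlet_tiling
begin

section \<open>Linear parts and quotients of group elements\<close>

lemma lin_mul:
  assumes a: "a \<in> \<Gamma>" and b: "b \<in> \<Gamma>"
  shows "lin (a \<odot> b) y = lin a (lin b y)"
proof -
  have lin_comp: "linear (\<lambda>y. lin a (lin b y))"
    using linear_compose[OF lorentz_linear[OF lin[OF b]] lorentz_linear[OF lin[OF a]]] by (simp add: o_def)
  have "y \<in> span (lift ` hyp_space)" using span_lift by blast
  then show ?thesis
  proof (rule linear_eq_on[OF lorentz_linear[OF lin[OF mul_closed[OF a b]]] lin_comp])
    fix w assume "w \<in> lift ` (hyp_space :: 'a set)"
    then obtain x where x: "x \<in> hyp_space" "w = lift x" by blast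
    show "lin (a \<odot> b) w = lin a (lin b w)"
      unfolding x(2) lift_act[OF mul_closed[OF a b] x(1), symmetric] mul_apply[OF x(1)]
      by (simp only: lift_act[OF a act[OF b x(1)]] lift_act[OF b x(1)])
  qed
qed

lemma lin_unit: "lin unit y = y"
proof -
  have "y \<in> span (lift ` hyp_space)" using span_lift by blast
  then show ?thesis
  proof (rule linear_eq_on[OF lorentz_linear[OF lin[OF unit_closed]] linear_ident])
    fix w assume "w \<in> lift ` (hyp_space :: 'a set)"
    then obtain x where x: "x \<in> hyp_space" "w = lift x" by blast
    show "lin unit w = w"
      unfolding x(2) lift_act[OF unit_closed x(1), symmetric] unit_apply[OF x(1)] ..
  qed
qed

lemma mul_assoc: "\<lbrakk>a \<in> \<Gamma>; b \<in> \<Gamma>; c \<in> \<Gamma>\<rbrakk> \<Longrightarrow> (a \<odot> b) \<odot> c = a \<odot> (b \<odot> c)"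
  by (rule eqI) (simp_all only: mul_closed mul_apply act)

lemma unit_mul: "g \<in> \<Gamma> \<Longrightarrow> unit \<odot> g = g"
  by (rule eqI) (simp_all only: mul_closed unit_closed mul_apply unit_apply act)

lemma quotient_mul:
  assumes "g \<in> \<Gamma>" "g' \<in> \<Gamma>" "t \<in> \<Gamma>"
  shows "(g' \<odot> ginv g) \<odot> (g \<odot> t) = g' \<odot> t"
  using assms by (simp only: mul_assoc mul_closed ginv_closed ginv_mul_mul)

lemma quotient_inverse:
  assumes "g \<in> \<Gamma>" "g' \<in> \<Gamma>"
  shows "(g \<odot> ginv g') \<odot> (g' \<odot> ginv g) = unit"
proof -
  have "(g \<odot> ginv g') \<odot> (g' \<odot> ginv g) = g \<odot> ginv g"
    by (rule quotient_mul[OF assms(2,1) ginv_closed[OF assms(1)]])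
  also have "\<dots> = unit"
    by (rule eqI) (simp_all only: assms mul_closed ginv_closed unit_closed mul_apply unit_apply ginv_right)
  finally show ?thesis .
qed

text \<open>At least two of \<open>a\<close>, \<open>b\<close>, \<open>c\<close> differ from
  \<open>h\<close>, as \<open>tiles_around_point\<close> requires.\<close>

lemma two_adjacent_tiles:
  assumes h: "h \<in> \<Gamma>" "y \<in> tile h" and abc: "a \<in> \<Gamma>" "b \<in> \<Gamma>" "c \<in> \<Gamma>" "a \<noteq> b" "a \<noteq> c" "b \<noteq> c"
    "y \<in> tile a" "y \<in> tile b" "y \<in> tile c"
  shows "\<exists>h1 h2. h1 \<noteq> h2 \<and> y \<in> tile h1 \<and> y \<in> tile h2 \<and> adjacent h h1 \<and> adjacent h h2"
proof -
  consider "a \<noteq> h" "b \<noteq> h" | "a \<noteq> h" "c \<noteq> h" | "b \<noteq> h" "c \<noteq> h" using abc by blast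
  then show ?thesis
  proof cases
    case 1
    show ?thesis by (rule tiles_around_point[OF h(2,1), of a b]) (use 1 abc in auto)
  next
    case 2
    show ?thesis by (rule tiles_around_point[OF h(2,1), of a c]) (use 2 abc in auto)
  next
    case 3
    show ?thesis by (rule tiles_around_point[OF h(2,1), of b c]) (use 3 abc in auto)
  qed
qed

lemma finite_tiles_at: "y \<in> hyp_space \<Longrightarrow> finite {g \<in> \<Gamma>. y \<in> tile g}"
proof -
  assume y: "y \<in> hyp_space"
  show ?thesis
  proof (cases "{g \<in> \<Gamma>. y \<in> tile g} = {}")
    case False
    then obtain g where g: "g \<in> \<Gamma>" "y \<in> tile g" by blast
    have sub: "{h \<in> \<Gamma>. y \<in> tile h} \<subseteq> {h \<in> \<Gamma>. \<exists>x. norm x \<le> norm y \<and> side g h x \<le> 0}"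
      using lor_tile_Int[OF g(2) _ g(1)] by fastforce
    have "norm y < 1" using y by simp
    then show ?thesis by (rule finite_subset[OF sub finite_near[OF g(1)]])
  qed (simp only: finite.emptyI)
qed

section \<open>The normal plane of a fat ridge\<close>

context
  fixes x m n u v
  assumes fat: "fat_ridge x m n u v"
begin

lemma fat_x: "x \<in> tile unit" "x \<in> hyp_space"
  using fat tile_subset unfolding fat_ridge_def by blast+

lemma fat_uv: "u \<in> tile unit" "v \<in> tile unit"
  using fat unfolding fat_ridge_def by blast+

lemma fat_mn: "lor m m = 1" "lor n n = 1" "- 1 / 2 \<le> lor m n" "lor (homog x) m = 0" "lor (homog x) n = 0"
  "lor (homog u) m = 0" "lor (homog u) n < 0" "lor (homog v) n = 0" "lor (homog v) m < 0"
  using fat unfolding fat_ridge_def by blast+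

text \<open>All centre differences of tiles at \<open>x\<close> lie here. As the plane is orthogonal
  to the timelike vector \<open>homog x\<close>, the form \<open>lor\<close> makes it a Euclidean
  plane.\<close>

definition ridge_plane where "ridge_plane = {y. \<exists>\<alpha> \<beta>. y = \<alpha> *\<^sub>R m + \<beta> *\<^sub>R n}"

lemma plane_comb: "\<lbrakk>y \<in> ridge_plane; z \<in> ridge_plane\<rbrakk> \<Longrightarrow> a *\<^sub>R y + b *\<^sub>R z \<in> ridge_plane"
proof -
  assume "y \<in> ridge_plane" "z \<in> ridge_plane"
  then obtain \<alpha> \<beta> \<gamma> \<delta> where "y = \<alpha> *\<^sub>R m + \<beta> *\<^sub>R n" "z = \<gamma> *\<^sub>R m + \<delta> *\<^sub>R n" unfolding ridge_plane_def by blast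
  then have "a *\<^sub>R y + b *\<^sub>R z = (a * \<alpha> + b * \<gamma>) *\<^sub>R m + (a * \<beta> + b * \<delta>) *\<^sub>R n"
    by (simp add: algebra_simps)
  then show ?thesis unfolding ridge_plane_def by blast
qed

lemma plane_diff: "\<lbrakk>y \<in> ridge_plane; z \<in> ridge_plane\<rbrakk> \<Longrightarrow> y - z \<in> ridge_plane"
  using plane_comb[of y z 1 "-1"] by simp

lemma plane_bisector: "\<lbrakk>h \<in> \<Gamma>; x \<in> tile h\<rbrakk> \<Longrightarrow> ctr unit - ctr h \<in> ridge_plane"
  using fat lor_tile_Int[OF fat_x(1) _ unit_closed, of h] unfolding fat_ridge_def ridge_plane_def by blast

text \<open>The part of \<open>n\<close> orthogonal to \<open>m\<close> is nonzero, as its pairing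
  with \<open>homog u\<close> shows, and it lies in the positive definite complement of
  \<open>homog x\<close>. In particular the wedge is not degenerate.\<close>

lemma mn_square: "(lor m n)\<^sup>2 < 1"
proof -
  let ?w = "n - lor m n *\<^sub>R m"
  have "lor (homog x) ?w = 0" using fat_mn by (simp add: lor_simps)
  moreover have "lor (homog u) ?w < 0" using fat_mn by (simp add: lor_simps)
  then have "?w \<noteq> 0" by (metis less_irrefl lor_zero_right)
  ultimately have "0 < lor ?w ?w" using lor_causal_orthogonal(2)[of x ?w] fat_x(2) by simp
  then show ?thesis
    using fat_mn by (simp add: lor_simps lor_commute[of n m] power2_eq_square)
qed

text \<open>Divided by \<open>sqrt (1 - (lor m n)\<^sup>2)\<close>, this is the second coordinate in
  the orthonormal basis of the plane that begins with \<open>m\<close>.\<close>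

definition plane_coord where "plane_coord y = lor y n - lor m n * lor y m"

lemma lor_plane:
  assumes "y \<in> ridge_plane"
  shows "lor y y = (lor y m)\<^sup>2 + (plane_coord y)\<^sup>2 / (1 - (lor m n)\<^sup>2)"
proof -
  obtain \<alpha> \<beta> where y: "y = \<alpha> *\<^sub>R m + \<beta> *\<^sub>R n" using assms unfolding ridge_plane_def by blast
  define s where "s = lor m n"
  have s: "1 - s\<^sup>2 \<noteq> 0" using mn_square by (simp add: s_def)
  have ym: "lor y m = \<alpha> + s * \<beta>" and yn: "lor y n = s * \<alpha> + \<beta>"
    using fat_mn by (simp_all add: y lor_simps lor_commute[of n m] s_def algebra_simps)
  have co: "plane_coord y = (1 - s\<^sup>2) * \<beta>"
    unfolding plane_coord_def s_def[symmetric] ym yn by (simp add: algebra_simps power2_eq_square)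
  have "lor y y = \<alpha> * lor y m + \<beta> * lor y n"
    unfolding y by (simp add: lor_simps)
  also have "\<dots> = (\<alpha> + s * \<beta>)\<^sup>2 + (1 - s\<^sup>2) * \<beta>\<^sup>2"
    unfolding ym yn by (simp add: algebra_simps power2_eq_square)
  also have "(1 - s\<^sup>2) * \<beta>\<^sup>2 = (plane_coord y)\<^sup>2 / (1 - s\<^sup>2)"
    unfolding co using s by (simp add: power2_eq_square)
  finally show ?thesis unfolding ym s_def .
qed

lemma plane_cauchy_schwarz:
  assumes "y \<in> ridge_plane"
  shows "(lor y m)\<^sup>2 \<le> lor y y" "(lor y n)\<^sup>2 \<le> lor y y"
proof -
  define s where "s = lor m n"
  have s: "0 < 1 - s\<^sup>2" using mn_square by (simp add: s_def)
  show "(lor y m)\<^sup>2 \<le> lor y y" using lor_plane[OF assms] s by (simp add: s_def)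
  obtain \<alpha> \<beta> where y: "y = \<alpha> *\<^sub>R m + \<beta> *\<^sub>R n" using assms unfolding ridge_plane_def by blast
  have ym: "lor y m = \<alpha> + s * \<beta>" and yn: "lor y n = s * \<alpha> + \<beta>"
    using fat_mn by (simp_all add: y lor_simps lor_commute[of n m] s_def algebra_simps)
  have "lor y y = \<alpha> * lor y m + \<beta> * lor y n"
    unfolding y by (simp add: lor_simps)
  also have "\<dots> = (s * \<alpha> + \<beta>)\<^sup>2 + (1 - s\<^sup>2) * \<alpha>\<^sup>2"
    unfolding ym yn by (simp add: algebra_simps power2_eq_square)
  also have "\<dots> \<ge> (s * \<alpha> + \<beta>)\<^sup>2" using s by simp
  finally show "(lor y n)\<^sup>2 \<le> lor y y" unfolding yn .
qed

definition mid_dir where "mid_dir = (- 1 / sqrt (2 + 2 * lor m n)) *\<^sub>R (m + n)"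

lemma mid_dir_plane: "mid_dir \<in> ridge_plane"
proof -
  have "mid_dir = (- 1 / sqrt (2 + 2 * lor m n)) *\<^sub>R m + (- 1 / sqrt (2 + 2 * lor m n)) *\<^sub>R n"
    unfolding mid_dir_def by (rule scaleR_add_right)
  then show ?thesis unfolding ridge_plane_def by blast
qed

text \<open>\<open>mid_dir\<close> bisects the wedge, and \<open>- lor mid_dir m\<close> is the sine
  of half the wedge angle. The angle is at least \<pi> / 3, and sin (\<pi> / 6) = 1 / 2.\<close>

lemma mid_dir_lor: "lor mid_dir mid_dir = 1" "lor mid_dir m \<le> - 1 / 2" "lor mid_dir n \<le> - 1 / 2"
proof -
  define r where "r = sqrt (2 + 2 * lor m n)"
  have r2: "r * r = 2 + 2 * lor m n" using fat_mn(3) by (simp add: r_def)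
  have "sqrt 1 \<le> r" unfolding r_def using fat_mn(3) by (intro real_sqrt_le_mono) simp
  then have r: "1 \<le> r" by simp
  have mid_dir: "mid_dir = (- 1 / r) *\<^sub>R (m + n)" by (simp add: mid_dir_def r_def)
  have "lor (m + n) (m + n) = r * r"
    using fat_mn unfolding r2 by (simp add: lor_add_left lor_add_right lor_commute[of n m])
  then have "lor mid_dir mid_dir = (- 1 / r) * ((- 1 / r) * (r * r))"
    by (simp only: mid_dir lor_scale_left lor_scale_right)
  then show "lor mid_dir mid_dir = 1" using r by simp
  have half: "lor (m + n) m = r * r / 2" "lor (m + n) n = r * r / 2"
    using fat_mn unfolding r2 by (simp_all add: lor_add_left lor_commute[of n m])
  have "lor mid_dir m = (- 1 / r) * (r * r / 2)" "lor mid_dir n = (- 1 / r) * (r * r / 2)"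
    by (simp_all only: mid_dir lor_scale_left half)
  then show "lor mid_dir m \<le> - 1 / 2" "lor mid_dir n \<le> - 1 / 2" using r by auto
qed

text \<open>Nonnegativity of \<open>side unit h\<close> at \<open>v\<close> and \<open>u\<close>
  makes the coefficients of \<open>m\<close> and \<open>n\<close> nonpositive. Here \<open>y\<close>
  is any vector, so that the claim can be used for directions in the plane as well as for
  points.\<close>

lemma cone_bisector:
  assumes y: "lor y m < 0" "lor y n < 0" and h: "h \<in> \<Gamma>" "h \<noteq> unit" "ctr unit - ctr h \<in> ridge_plane"
  shows "0 < lor y (ctr unit - ctr h)"
proof -
  obtain \<alpha> \<beta> where w: "ctr unit - ctr h = \<alpha> *\<^sub>R m + \<beta> *\<^sub>R n" using h(3) unfolding ridge_plane_def by blast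
  have "0 \<le> side unit h v" using lor_tile_nonneg fat_uv h(1) by blast
  then have "\<alpha> \<le> 0" unfolding w using fat_mn by (simp add: lor_simps zero_le_mult_iff)
  moreover have "0 \<le> side unit h u" using lor_tile_nonneg fat_uv h(1) by blast
  then have "\<beta> \<le> 0" unfolding w using fat_mn by (simp add: lor_simps zero_le_mult_iff)
  moreover have "\<alpha> \<noteq> 0 \<or> \<beta> \<noteq> 0"
    using w ctr_inj[OF unit_closed h(1)] h(2) by auto
  ultimately consider "\<alpha> < 0" "\<beta> \<le> 0" | "\<alpha> \<le> 0" "\<beta> < 0" by linarith
  then have "0 < \<alpha> * lor y m + \<beta> * lor y n"
  proof cases
    case 1
    then show ?thesis using y by (intro add_pos_nonneg mult_neg_neg mult_nonpos_nonpos) auto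
  next
    case 2
    then show ?thesis using y by (intro add_nonneg_pos mult_neg_neg mult_nonpos_nonpos) auto
  qed
  then show ?thesis unfolding w by (simp add: lor_simps)
qed

text \<open>Tiles at \<open>x\<close> are compared by the positions \<open>t1\<close>, \<open>t2\<close> of two neighbours at \<open>x\<close>. The isometry between
  two tiles for which these agree maps centre differences, which span the plane, to centre differences.\<close>

lemma quotient_plane:
  assumes g: "g \<in> \<Gamma>" "g' \<in> \<Gamma>" and t: "t1 \<in> \<Gamma>" "t2 \<in> \<Gamma>" "t1 \<noteq> t2" "t1 \<noteq> unit" "t2 \<noteq> unit"
    and x: "x \<in> tile g" "x \<in> tile (g \<odot> t1)" "x \<in> tile (g \<odot> t2)"
      "x \<in> tile g'" "x \<in> tile (g' \<odot> t1)" "x \<in> tile (g' \<odot> t2)"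
    and y: "y \<in> ridge_plane"
  shows "lin (g' \<odot> ginv g) y \<in> ridge_plane"
proof -
  let ?k = "g' \<odot> ginv g"
  have k: "?k \<in> \<Gamma>" using g mul_closed ginv_closed by blast
  have cl: "g \<odot> t1 \<in> \<Gamma>" "g \<odot> t2 \<in> \<Gamma>" "g' \<odot> t1 \<in> \<Gamma>" "g' \<odot> t2 \<in> \<Gamma>" using g t mul_closed by blast+
  have W2: "ctr a - ctr b \<in> ridge_plane" if "a \<in> \<Gamma>" "x \<in> tile a" "b \<in> \<Gamma>" "x \<in> tile b" for a b
    using plane_diff[OF plane_bisector[OF that(3,4)] plane_bisector[OF that(1,2)]] by simp
  define w1 where "w1 = ctr g - ctr (g \<odot> t1)"
  define w2 where "w2 = ctr g - ctr (g \<odot> t2)"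
  have kc: "lin ?k (ctr (g \<odot> t)) = ctr (g' \<odot> t)" if "t \<in> \<Gamma>" for t
    using ctr_mul[OF k mul_closed[OF g(1) that]] quotient_mul[OF g that] by simp
  have kg: "lin ?k (ctr g) = ctr g'" using kc[OF unit_closed] mul_unit g by simp
  have kw: "lin ?k w1 \<in> ridge_plane" "lin ?k w2 \<in> ridge_plane"
    unfolding w1_def w2_def linear_diff[OF lorentz_linear[OF lin[OF k]]] kg kc[OF t(1)] kc[OF t(2)]
    using W2 g cl x by blast+
  have "w1 \<in> ridge_plane" "w2 \<in> ridge_plane" unfolding w1_def w2_def using W2 g cl x by blast+
  then obtain a1 b1 a2 b2 where w: "w1 = a1 *\<^sub>R m + b1 *\<^sub>R n" "w2 = a2 *\<^sub>R m + b2 *\<^sub>R n" unfolding ridge_plane_def by blast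
  have ne: "g \<noteq> g \<odot> t1" "g \<noteq> g \<odot> t2" "g \<odot> t1 \<noteq> g \<odot> t2"
  proof -
    have inj: "t = t'" if "g \<odot> t = g \<odot> t'" "t \<in> \<Gamma>" "t' \<in> \<Gamma>" for t t'
      using ginv_mul_mul[OF g(1)] that by metis
    show "g \<noteq> g \<odot> t1" "g \<noteq> g \<odot> t2" "g \<odot> t1 \<noteq> g \<odot> t2"
      using inj[of unit t1] inj[of unit t2] inj[of t1 t2] mul_unit[OF g(1)] t unit_closed by metis+
  qed
  have w1_ne: "w1 \<noteq> 0" unfolding w1_def using ctr_inj[OF g(1) cl(1)] ne by auto
  \<comment> \<open>The determinant of the two centre differences. It is nonzero because three
    distinct points of the hyperboloid are never collinear; \<open>q1\<close> and \<open>q2\<close>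
    come from Cramer's rule.\<close>
  define D where "D = a1 * b2 - a2 * b1"
  have D: "D \<noteq> 0"
  proof
    assume D0: "D = 0"
    have "\<exists>c. w2 = c *\<^sub>R w1"
    proof (cases "a1 = 0")
      case False
      have "w2 = (a2 / a1) *\<^sub>R w1" using False D0 unfolding w D_def
        by (simp add: scaleR_right_distrib field_simps)
      then show ?thesis by blast
    next
      case True
      then have "b1 \<noteq> 0" using w1_ne w by auto
      then have "w2 = (b2 / b1) *\<^sub>R w1" using True D0 unfolding w D_def by simp
      then show ?thesis by blast
    qed
    then obtain c where c: "ctr g - ctr (g \<odot> t2) = c *\<^sub>R (ctr g - ctr (g \<odot> t1))" unfolding w1_def w2_def by blast
    have "(g \<odot> t1) p = (g \<odot> t2) p"
    proof (rule lift_collinear[OF act[OF g(1) p] act[OF cl(1) p] act[OF cl(2) p]])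
      show "g p \<noteq> (g \<odot> t1) p" using orbit_inj[OF g(1) cl(1)] ne(1) by blast
      show "g p \<noteq> (g \<odot> t2) p" using orbit_inj[OF g(1) cl(2)] ne(2) by blast
      show "lift (g p) - lift ((g \<odot> t2) p) = c *\<^sub>R (lift (g p) - lift ((g \<odot> t1) p))" using c unfolding ctr_def .
    qed
    then show False using orbit_inj[OF cl(1,2)] ne(3) by blast
  qed
  obtain \<alpha> \<beta> where y: "y = \<alpha> *\<^sub>R m + \<beta> *\<^sub>R n" using y unfolding ridge_plane_def by blast
  define q1 where "q1 = (\<alpha> * b2 - \<beta> * a2) / D"
  define q2 where "q2 = (\<beta> * a1 - \<alpha> * b1) / D"
  have qD: "q1 * D = \<alpha> * b2 - \<beta> * a2" "q2 * D = \<beta> * a1 - \<alpha> * b1" using D by (simp_all add: q1_def q2_def)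
  have "(q1 * a1 + q2 * a2) * D = (q1 * D) * a1 + (q2 * D) * a2" by (simp add: algebra_simps)
  also have "\<dots> = \<alpha> * D" unfolding qD by (simp add: D_def algebra_simps)
  finally have ca: "q1 * a1 + q2 * a2 = \<alpha>" using D by simp
  have "(q1 * b1 + q2 * b2) * D = (q1 * D) * b1 + (q2 * D) * b2" by (simp add: algebra_simps)
  also have "\<dots> = \<beta> * D" unfolding qD by (simp add: D_def algebra_simps)
  finally have cb: "q1 * b1 + q2 * b2 = \<beta>" using D by simp
  have "q1 *\<^sub>R w1 + q2 *\<^sub>R w2 = (q1 * a1 + q2 * a2) *\<^sub>R m + (q1 * b1 + q2 * b2) *\<^sub>R n"
    unfolding w by (simp add: algebra_simps)
  then have "y = q1 *\<^sub>R w1 + q2 *\<^sub>R w2" unfolding y ca cb by simp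
  then have "lin ?k y = q1 *\<^sub>R lin ?k w1 + q2 *\<^sub>R lin ?k w2"
    by (simp only: linear_add[OF lorentz_linear[OF lin[OF k]]] linear_scale[OF lorentz_linear[OF lin[OF k]]])
  then show ?thesis using plane_comb[OF kw] by simp
qed

text \<open>The midpoint of \<open>mid_dir\<close> and its image would otherwise lie in the open cones of two distinct tiles.\<close>

lemma separated:
  assumes k: "k \<in> \<Gamma>" "k \<noteq> unit" "k' \<in> \<Gamma>" "k' \<noteq> unit" and inv: "k' \<odot> k = unit"
    and W: "ctr unit - ctr k \<in> ridge_plane" "ctr unit - ctr k' \<in> ridge_plane" "lin k mid_dir \<in> ridge_plane" "lin k' mid_dir \<in> ridge_plane"
  shows "1 \<le> lor (mid_dir - lin k mid_dir) (mid_dir - lin k mid_dir)"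
proof (rule ccontr)
  assume "\<not> ?thesis"
  then have lt: "lor (mid_dir - lin k mid_dir) (mid_dir - lin k mid_dir) < 1" by simp
  define \<delta> where "\<delta> = (1/2) *\<^sub>R lin k mid_dir + (- (1/2)) *\<^sub>R mid_dir"
  have k'k: "lin k' (lin k w) = w" for w using lin_mul[OF k(3,1), of w] lin_unit inv by simp
  define \<delta>' where "\<delta>' = (1/2) *\<^sub>R lin k' mid_dir + (- (1/2)) *\<^sub>R mid_dir"
  have \<delta>W: "\<delta> \<in> ridge_plane" "\<delta>' \<in> ridge_plane" unfolding \<delta>_def \<delta>'_def using plane_comb[OF W(3) mid_dir_plane] plane_comb[OF W(4) mid_dir_plane] by blast+
  have l: "linear (lin k')" by (rule lorentz_linear[OF lin[OF k(3)]])
  have "\<delta>' = - lin k' \<delta>"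
    unfolding \<delta>_def \<delta>'_def linear_add[OF l] linear_scale[OF l] k'k by simp
  then have \<delta>\<delta>': "lor \<delta>' \<delta>' = lor \<delta> \<delta>"
    using lorentz_lor[OF lin[OF k(3)]] by (simp add: lor_minus_left lor_minus_right)
  have "\<delta> = (- (1/2)) *\<^sub>R (mid_dir - lin k mid_dir)" by (simp add: \<delta>_def algebra_simps)
  then have "lor \<delta> \<delta> = (1/4) * lor (mid_dir - lin k mid_dir) (mid_dir - lin k mid_dir)" by (simp only: lor_scale_left lor_scale_right)
  then have small: "lor \<delta> \<delta> < (1/2)\<^sup>2" "lor \<delta>' \<delta>' < (1/2)\<^sup>2" using lt \<delta>\<delta>' by (auto simp: power2_eq_square)
  \<comment> \<open>The tip of \<open>mid_dir\<close> has distance at least 1/2 from both sides of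
    the wedge, so a shift shorter than 1/2 stays inside.\<close>
  have cone: "lor (mid_dir + d) m < 0 \<and> lor (mid_dir + d) n < 0" if d: "d \<in> ridge_plane" "lor d d < (1/2)\<^sup>2" for d
  proof -
    have "(lor d m)\<^sup>2 < (1/2)\<^sup>2" "(lor d n)\<^sup>2 < (1/2)\<^sup>2" using plane_cauchy_schwarz[OF d(1)] d(2) by linarith+
    then have "\<bar>lor d m\<bar> < 1/2" "\<bar>lor d n\<bar> < 1/2"
      using abs_le_square_iff[of "1/2" "lor d m"] abs_le_square_iff[of "1/2" "lor d n"] by auto
    then show ?thesis using mid_dir_lor unfolding lor_add_left by linarith
  qed
  define y where "y = mid_dir + \<delta>"
  have "0 < lor y (ctr unit - ctr k)"
    unfolding y_def using cone[OF \<delta>W(1) small(1)] k W by (intro cone_bisector) auto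
  moreover have "0 < lor (mid_dir + \<delta>') (ctr unit - ctr k')"
    using cone[OF \<delta>W(2) small(2)] k W by (intro cone_bisector) auto
  moreover have "mid_dir + \<delta>' = lin k' y"
  proof -
    have "lin k' y = lin k' mid_dir + ((1/2) *\<^sub>R mid_dir + (- (1/2)) *\<^sub>R lin k' mid_dir)"
      unfolding y_def \<delta>_def linear_add[OF l] linear_scale[OF l] k'k ..
    also have "\<dots> = (lin k' mid_dir + (- (1/2)) *\<^sub>R lin k' mid_dir) + (1/2) *\<^sub>R mid_dir" by (simp only: ac_simps)
    also have "lin k' mid_dir + (- (1/2)) *\<^sub>R lin k' mid_dir = (1 + - (1/2)) *\<^sub>R lin k' mid_dir"
      by (simp only: scaleR_left_distrib scaleR_one)
    also have "(1 + - (1/2)) *\<^sub>R lin k' mid_dir + (1/2) *\<^sub>R mid_dir = (1 + - (1/2)) *\<^sub>R mid_dir + (1/2) *\<^sub>R lin k' mid_dir" by simp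
    also have "\<dots> = mid_dir + \<delta>'" unfolding \<delta>'_def by (simp only: scaleR_left_distrib scaleR_one ac_simps)
    finally show ?thesis ..
  qed
  \<comment> \<open>Pulled back by \<open>k'\<close>, the second inequality becomes the opposite of
    the first at the same vector \<open>y\<close>.\<close>
  moreover have "ctr unit - ctr k' = lin k' (ctr k - ctr unit)"
    using ctr_mul[OF k(3,1)] ctr_mul[OF k(3) unit_closed] mul_unit[OF k(3)] inv
    by (simp add: linear_diff[OF l])
  ultimately have "0 < lor y (ctr unit - ctr k)" "0 < lor y (ctr k - ctr unit)"
    using lorentz_lor[OF lin[OF k(3)]] by auto
  then show False by (simp add: lor_simps)
qed

text \<open>\<open>h g\<close> carries \<open>g0\<close> to \<open>g\<close> and preserves
  \<open>ridge_plane\<close>, although it need not fix \<open>x\<close>. It moves the wide wedge of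
  the unit tile even when the tiles of \<open>F\<close> are narrow at \<open>x\<close>, so
  \<open>separated\<close> keeps the unit vectors \<open>\<psi> g\<close> at mutual distance at
  least 1. A square of side 1/2 in orthonormal coordinates holds at most one of them.\<close>

lemma card_tiles_same_type:
  assumes T: "t1 \<in> \<Gamma>" "t2 \<in> \<Gamma>" "t1 \<noteq> t2" "t1 \<noteq> unit" "t2 \<noteq> unit"
    and F: "\<And>g. g \<in> F \<Longrightarrow> g \<in> \<Gamma> \<and> x \<in> tile g \<and> x \<in> tile (g \<odot> t1) \<and> x \<in> tile (g \<odot> t2)"
  shows "card F \<le> 25"
proof (cases "F = {}")
  case False
  then obtain g0 where g0: "g0 \<in> F" by blast
  have FG: "g \<in> \<Gamma>" "x \<in> tile g" if "g \<in> F" for g using F[OF that] by blast+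
  have QW: "lin (g' \<odot> ginv g) y \<in> ridge_plane" if "g \<in> F" "g' \<in> F" "y \<in> ridge_plane" for g g' y
    by (rule quotient_plane[OF FG(1)[OF that(1)] FG(1)[OF that(2)] T]) (use F that in blast)+
  define h where "h g = g \<odot> ginv g0" for g
  define hi where "hi g = g0 \<odot> ginv g" for g
  have hG: "h g \<in> \<Gamma>" "hi g \<in> \<Gamma>" if "g \<in> F" for g
    unfolding h_def hi_def using FG(1) that g0 mul_closed ginv_closed by blast+
  have hih: "hi g \<odot> h g = unit" "h g \<odot> hi g = unit" if "g \<in> F" for g
    unfolding h_def hi_def using quotient_inverse FG(1) that g0 by blast+
  have hW: "lin (h g) y \<in> ridge_plane" "lin (hi g) y \<in> ridge_plane" if "g \<in> F" "y \<in> ridge_plane" for g y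
    unfolding h_def hi_def using QW that g0 by blast+
  \<comment> \<open>The detour through \<open>g0\<close>, whose tile contains \<open>x\<close>,
    keeps the centre of \<open>h g\<close> in the plane through \<open>ctr unit\<close> even if the
    tile of \<open>h g\<close> misses \<open>x\<close>.\<close>
  have cW: "ctr (h g) - ctr unit \<in> ridge_plane" if g: "g \<in> F" for g
  proof -
    have l: "linear (lin (h g))" by (rule lorentz_linear[OF lin[OF hG(1)[OF g]]])
    have "h g \<odot> g0 = g"
      using quotient_mul[OF FG(1)[OF g0] FG(1)[OF g] unit_closed] mul_unit FG(1) g g0 unfolding h_def by simp
    then have e: "lin (h g) (ctr g0) = ctr g" using ctr_mul[OF hG(1)[OF g] FG(1)[OF g0]] by simp
    have "ctr (h g) = lin (h g) (ctr unit)"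
      using ctr_mul[OF hG(1)[OF g] unit_closed] mul_unit[OF hG(1)[OF g]] by simp
    also have "ctr unit = ctr g0 + (ctr unit - ctr g0)" by simp
    finally have eq: "ctr (h g) - ctr unit = lin (h g) (ctr unit - ctr g0) - (ctr unit - ctr g)"
      unfolding linear_add[OF l] e by simp
    show ?thesis unfolding eq
      by (rule plane_diff[OF hW(1)[OF g plane_bisector[OF FG[OF g0]]] plane_bisector[OF FG[OF g]]])
  qed
  define k where "k g g' = hi g \<odot> h g'" for g g'
  have kG: "k g g' \<in> \<Gamma>" if "g \<in> F" "g' \<in> F" for g g'
    unfolding k_def using hG that mul_closed by blast
  have kW: "lin (k g g') mid_dir \<in> ridge_plane" if "g \<in> F" "g' \<in> F" for g g'
    unfolding k_def lin_mul[OF hG(2)[OF that(1)] hG(1)[OF that(2)]] using hW that mid_dir_plane by blast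
  have ckW: "ctr unit - ctr (k g g') \<in> ridge_plane" if g: "g \<in> F" "g' \<in> F" for g g'
  proof -
    have l: "linear (lin (hi g))" by (rule lorentz_linear[OF lin[OF hG(2)[OF g(1)]]])
    have "ctr unit - ctr (k g g') = lin (hi g) (ctr (h g) - ctr (h g'))"
      using ctr_mul[OF hG(2)[OF g(1)] hG(1)[OF g(1)]] ctr_mul[OF hG(2)[OF g(1)] hG(1)[OF g(2)]] hih(1)[OF g(1)]
      by (simp add: linear_diff[OF l] k_def)
    moreover have "ctr (h g) - ctr (h g') \<in> ridge_plane"
      using plane_diff[OF cW[OF g(1)] cW[OF g(2)]] by simp
    ultimately show ?thesis using hW(2)[OF g(1)] by simp
  qed
  have kk: "k g' g \<odot> k g g' = unit" if g: "g \<in> F" "g' \<in> F" for g g'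
  proof -
    have "k g' g \<odot> k g g' = hi g' \<odot> (h g \<odot> (hi g \<odot> h g'))"
      unfolding k_def using mul_assoc hG g mul_closed by simp
    also have "h g \<odot> (hi g \<odot> h g') = (h g \<odot> hi g) \<odot> h g'"
      using mul_assoc hG g by simp
    also have "\<dots> = h g'" unfolding hih(2)[OF g(1)] using unit_mul hG g by simp
    finally show ?thesis unfolding hih(1)[OF g(2)] .
  qed
  have k_unit: "g = g'" if g: "g \<in> F" "g' \<in> F" "k g g' = unit" for g g'
  proof -
    have "h g \<odot> (hi g \<odot> h g') = h g \<odot> unit" using g(3) unfolding k_def by simp
    then have "(h g \<odot> hi g) \<odot> h g' = h g" using mul_assoc hG g mul_unit by simp
    then have "h g' = h g" unfolding hih(2)[OF g(1)] using unit_mul hG g by simp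
    then have "h g' \<odot> g0 = h g \<odot> g0" by simp
    then show ?thesis
      using quotient_mul[OF FG(1)[OF g0] _ unit_closed] mul_unit FG(1) g g0 unfolding h_def by simp
  qed
  define \<psi> where "\<psi> g = lin (h g) mid_dir" for g
  have \<psi>W: "\<psi> g \<in> ridge_plane" if "g \<in> F" for g unfolding \<psi>_def using hW that mid_dir_plane by blast
  have \<psi>1: "lor (\<psi> g) (\<psi> g) = 1" if "g \<in> F" for g
    unfolding \<psi>_def using lorentz_lor[OF lin[OF hG(1)[OF that]]] mid_dir_lor by simp
  have sep: "1 \<le> lor (\<psi> g - \<psi> g') (\<psi> g - \<psi> g')" if g: "g \<in> F" "g' \<in> F" "g \<noteq> g'" for g g'
  proof -
    have l: "linear (lin (hi g))" by (rule lorentz_linear[OF lin[OF hG(2)[OF g(1)]]])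
    have "1 \<le> lor (mid_dir - lin (k g g') mid_dir) (mid_dir - lin (k g g') mid_dir)"
      using kG[OF g(1,2)] kG[OF g(2,1)] k_unit[OF g(1,2)] k_unit[OF g(2,1)] g(3)
      by (intro separated[OF _ _ _ _ kk[OF g(1,2)] ckW[OF g(1,2)] ckW[OF g(2,1)] kW[OF g(1,2)] kW[OF g(2,1)]]) auto
    also have "mid_dir - lin (k g g') mid_dir = lin (hi g) (\<psi> g - \<psi> g')"
      unfolding \<psi>_def linear_diff[OF l] k_def lin_mul[OF hG(2)[OF g(1)] hG(1)[OF g(2)]]
      using lin_mul[OF hG(2)[OF g(1)] hG(1)[OF g(1)], of mid_dir] hih(1)[OF g(1)] lin_unit by simp
    finally show ?thesis unfolding lorentz_lor[OF lin[OF hG(2)[OF g(1)]]] .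
  qed
  define r where "r = sqrt (1 - (lor m n)\<^sup>2)"
  have r: "0 < r" "r * r = 1 - (lor m n)\<^sup>2" using mn_square by (auto simp: r_def)
  have lor_co: "lor y y = (lor y m)\<^sup>2 + (plane_coord y / r)\<^sup>2" if "y \<in> ridge_plane" for y
    using lor_plane[OF that] r(2) by (simp add: power_divide power2_eq_square)
  define \<phi> where "\<phi> g = (\<lfloor>2 * lor (\<psi> g) m\<rfloor>, \<lfloor>2 * (plane_coord (\<psi> g) / r)\<rfloor>)" for g
  \<comment> \<open>There are five values rather than four because a coordinate equal to 1 has floor
    2; two coordinates give 25 cells.\<close>
  have fl: "\<lfloor>2 * a\<rfloor> \<in> {-2..2}" if "a\<^sup>2 \<le> 1" for a :: real
  proof -
    have "\<bar>a\<bar> \<le> 1" using that by (simp add: abs_square_le_1)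
    then have "-2 \<le> 2 * a" "2 * a \<le> 2" by auto
    then show ?thesis by (simp add: le_floor_iff floor_le_iff)
  qed
  have "\<phi> ` F \<subseteq> {-2..2} \<times> {-2..2}"
  proof
    fix t assume "t \<in> \<phi> ` F"
    then obtain g where g: "g \<in> F" "t = \<phi> g" by blast
    have "(lor (\<psi> g) m)\<^sup>2 + (plane_coord (\<psi> g) / r)\<^sup>2 = 1" using lor_co[OF \<psi>W[OF g(1)]] \<psi>1[OF g(1)] by simp
    then have "(lor (\<psi> g) m)\<^sup>2 \<le> 1" "(plane_coord (\<psi> g) / r)\<^sup>2 \<le> 1"
      using zero_le_power2[of "lor (\<psi> g) m"] zero_le_power2[of "plane_coord (\<psi> g) / r"] by linarith+
    then show "t \<in> {-2..2} \<times> {-2..2}" unfolding g(2) \<phi>_def using fl by blast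
  qed
  moreover have "inj_on \<phi> F"
  proof (rule inj_onI, rule ccontr)
    fix g g' assume g: "g \<in> F" "g' \<in> F" "\<phi> g = \<phi> g'" "g \<noteq> g'"
    have close: "(a - b)\<^sup>2 < 1 / 4" if "\<lfloor>2 * a\<rfloor> = \<lfloor>2 * b\<rfloor>" for a b :: real
    proof -
      have "\<bar>2 * a - 2 * b\<bar> < 1" using that by linarith
      then have "\<bar>a - b\<bar> < 1 / 2" by linarith
      then have "(a - b)\<^sup>2 < (1/2)\<^sup>2" using abs_le_square_iff[of "1/2" "a - b"] by simp
      then show ?thesis by (simp add: power2_eq_square)
    qed
    let ?d = "\<psi> g - \<psi> g'"
    have "lor ?d m = lor (\<psi> g) m - lor (\<psi> g') m" by (simp add: lor_simps)
    moreover have "plane_coord ?d / r = plane_coord (\<psi> g) / r - plane_coord (\<psi> g') / r"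
      by (simp add: plane_coord_def lor_simps algebra_simps diff_divide_distrib add_divide_distrib)
    ultimately have "(lor ?d m)\<^sup>2 < 1/4" "(plane_coord ?d / r)\<^sup>2 < 1/4" using close g(3) unfolding \<phi>_def by auto
    then have "lor ?d ?d < 1" using lor_co[OF plane_diff[OF \<psi>W[OF g(1)] \<psi>W[OF g(2)]]] by simp
    then show False using sep[OF g(1,2,4)] by simp
  qed
  ultimately have "card F \<le> card ({-2..2::int} \<times> {-2..2::int})" by (intro card_inj_on_le) auto
  then show ?thesis by (simp add: card_cartesian_product)
qed simp

text \<open>The type of a tile at \<open>x\<close> is the pair of relative positions of two of its
  neighbours that also contain \<open>x\<close>. Relative positions are neighbours of
  \<open>unit\<close>, so the number of types is at most the square of their number.\<close>

lemma card_tiles_at: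
  assumes fin: "finite {h. adjacent unit h}"
  shows "card {g \<in> \<Gamma>. x \<in> tile g} \<le> 25 * (card {h. adjacent unit h})\<^sup>2"
proof -
  let ?V = "{g \<in> \<Gamma>. x \<in> tile g}" and ?G = "{h. adjacent unit h}"
  obtain a b where ab: "a \<in> \<Gamma>" "b \<in> \<Gamma>" "a \<noteq> unit" "b \<noteq> unit" "a \<noteq> b" "x \<in> tile a" "x \<in> tile b"
    using fat unfolding fat_ridge_def by blast
  have "\<exists>t. fst t \<in> ?G \<and> snd t \<in> ?G \<and> fst t \<noteq> snd t \<and> x \<in> tile (g \<odot> fst t) \<and> x \<in> tile (g \<odot> snd t)"
    if g: "g \<in> ?V" for g
  proof -
    have gG: "g \<in> \<Gamma>" "x \<in> tile g" using g by blast+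
    obtain h1 h2 where h: "h1 \<noteq> h2" "x \<in> tile h1" "x \<in> tile h2" "adjacent g h1" "adjacent g h2"
      using two_adjacent_tiles[OF gG unit_closed ab(1,2) ab(3,4)[symmetric] ab(5) fat_x(1) ab(6,7)] by blast
    have hG: "h1 \<in> \<Gamma>" "h2 \<in> \<Gamma>" using h unfolding adjacent_def by blast+
    have t: "adjacent unit (ginv g \<odot> h')" "g \<odot> (ginv g \<odot> h') = h'" if "h' \<in> \<Gamma>" "adjacent g h'" for h'
    proof -
      show e: "g \<odot> (ginv g \<odot> h') = h'" using mul_ginv_mul gG that by blast
      have c: "ginv g \<odot> h' \<in> \<Gamma>" using mul_closed ginv_closed gG that by blast
      show "adjacent unit (ginv g \<odot> h')"
        using adjacent_mul_iff[OF gG(1) unit_closed c] that unfolding e mul_unit[OF gG(1)] by blast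
    qed
    have "ginv g \<odot> h1 \<noteq> ginv g \<odot> h2" using t(2)[OF hG(1) h(4)] t(2)[OF hG(2) h(5)] h(1) by metis
    then show ?thesis
      using t(1)[OF hG(1) h(4)] t(1)[OF hG(2) h(5)] h(2,3)
      by (intro exI[of _ "(ginv g \<odot> h1, ginv g \<odot> h2)"])
        (simp only: fst_conv snd_conv mem_Collect_eq t(2)[OF hG(1) h(4)] t(2)[OF hG(2) h(5)] simp_thms)
  qed
  then have "\<forall>g\<in>?V. \<exists>t. fst t \<in> ?G \<and> snd t \<in> ?G \<and> fst t \<noteq> snd t \<and> x \<in> tile (g \<odot> fst t) \<and> x \<in> tile (g \<odot> snd t)"
    by blast
  from bchoice[OF this] obtain \<tau> where
    \<tau>: "\<forall>g\<in>?V. fst (\<tau> g) \<in> ?G \<and> snd (\<tau> g) \<in> ?G \<and> fst (\<tau> g) \<noteq> snd (\<tau> g) \<and>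
      x \<in> tile (g \<odot> fst (\<tau> g)) \<and> x \<in> tile (g \<odot> snd (\<tau> g))" by blast
  have "card ?V \<le> 25 * card (\<tau> ` ?V)"
  proof (rule card_le_fibres[OF finite_tiles_at[OF fat_x(2)] _ order_refl])
    show "finite (\<tau> ` ?V)" using finite_tiles_at[OF fat_x(2)] by (rule finite_imageI)
    fix t assume "t \<in> \<tau> ` ?V"
    then have t: "fst t \<in> ?G" "snd t \<in> ?G" "fst t \<noteq> snd t" using \<tau> by blast+
    show "card {g \<in> ?V. \<tau> g = t} \<le> 25"
    proof (rule card_tiles_same_type[of "fst t" "snd t"])
      show "fst t \<in> \<Gamma>" "snd t \<in> \<Gamma>" "fst t \<noteq> snd t" "fst t \<noteq> unit" "snd t \<noteq> unit"
        using t unfolding adjacent_def mem_Collect_eq by metis+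
      fix g assume "g \<in> {g \<in> ?V. \<tau> g = t}"
      then show "g \<in> \<Gamma> \<and> x \<in> tile g \<and> x \<in> tile (g \<odot> fst t) \<and> x \<in> tile (g \<odot> snd t)" using \<tau> by blast
    qed
  qed
  also have "card (\<tau> ` ?V) \<le> card (?G \<times> ?G)"
  proof (rule card_mono)
    show "\<tau> ` ?V \<subseteq> ?G \<times> ?G"
    proof
      fix t assume "t \<in> \<tau> ` ?V"
      then have "fst t \<in> ?G" "snd t \<in> ?G" using \<tau> by blast+
      then show "t \<in> ?G \<times> ?G" by (metis mem_Sigma_iff prod.collapse)
    qed
  qed (use fin in simp)
  also have "\<dots> = (card ?G)\<^sup>2" by (simp add: card_cartesian_product power2_eq_square)
  finally show ?thesis by simp
qed

end

end

section \<open>The growth bound\<close>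

lemma relpow_map:
  assumes "(u, w) \<in> E ^^ n" and "\<And>a b. (a, b) \<in> E \<Longrightarrow> (f a, f b) \<in> E"
  shows "(f u, f w) \<in> E ^^ n"
  using assms(1) by (induction n arbitrary: w) (auto intro: assms(2))

context dirichlet_tiling
begin

abbreviation tiles where "tiles \<equiv> tile ` \<Gamma>"

abbreviation edges where "edges \<equiv> dual_edges tiles"

lemma dual_edges_tiles: "edges = {(tile g, tile h) | g h. adjacent g h}"
proof -
  have "(A, B) \<in> edges \<longleftrightarrow> (\<exists>g h. A = tile g \<and> B = tile h \<and> adjacent g h)" for A B
  proof
    assume AB: "(A, B) \<in> edges"
    then obtain g h where "g \<in> \<Gamma>" "h \<in> \<Gamma>" "A = tile g" "B = tile h" by (auto simp: dual_edges_def)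
    then show "\<exists>g h. A = tile g \<and> B = tile h \<and> adjacent g h" using AB dual_edges_tile by blast
  next
    assume "\<exists>g h. A = tile g \<and> B = tile h \<and> adjacent g h"
    then obtain g h where gh: "A = tile g" "B = tile h" "adjacent g h" by blast
    then have "g \<in> \<Gamma>" "h \<in> \<Gamma>" unfolding adjacent_def by blast+
    then show "(A, B) \<in> edges" using dual_edges_tile gh by blast
  qed
  then show ?thesis by auto
qed

lemma dual_edges_image:
  assumes g: "g \<in> \<Gamma>" and AB: "(A, B) \<in> edges"
  shows "(g ` A, g ` B) \<in> edges"
proof -
  obtain a b where ab: "A = tile a" "B = tile b" "adjacent a b" using AB unfolding dual_edges_tiles by blast
  then have G: "a \<in> \<Gamma>" "b \<in> \<Gamma>" unfolding adjacent_def by blast+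
  have "g ` A = tile (g \<odot> a)" "g ` B = tile (g \<odot> b)" using tile_mul[OF g] G ab by blast+
  moreover have "adjacent (g \<odot> a) (g \<odot> b)" using adjacent_mul_iff[OF g G] ab(3) by blast
  ultimately show ?thesis unfolding dual_edges_tiles by blast
qed

lemma graph_ball_image_subset:
  assumes g: "g \<in> \<Gamma>"
  shows "(\<lambda>T. g ` T) ` graph_ball tiles (edges) A r \<subseteq> graph_ball tiles (edges) (g ` A) r"
proof
  fix S assume "S \<in> (\<lambda>T. g ` T) ` graph_ball tiles (edges) A r"
  then obtain T n where T: "S = g ` T" "T \<in> tiles" "n \<le> r" "(A, T) \<in> edges ^^ n"
    unfolding graph_ball_eq by blast
  then obtain t where t: "t \<in> \<Gamma>" "T = tile t" by blast
  have mem: "S \<in> tiles" unfolding T(1) t(2) tile_mul[OF g t(1), symmetric] using mul_closed[OF g t(1)] by blast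
  have "(g ` A, S) \<in> edges ^^ n"
    unfolding T(1) by (rule relpow_map[OF T(4) dual_edges_image[OF g]])
  then have "\<exists>n\<le>r. (g ` A, S) \<in> edges ^^ n" using T(3) by blast
  then show "S \<in> graph_ball tiles (edges) (g ` A) r"
    unfolding graph_ball_eq mem_Collect_eq using mem by (rule conjI[rotated])
qed

lemma image_ginv_tile: 
  assumes g: "g \<in> \<Gamma>" and T: "T \<in> tiles"
  shows "g ` (ginv g ` T) = T" "ginv g ` (g ` T) = T"
proof -
  obtain t where t: "t \<in> \<Gamma>" "T = tile t" using T by blast
  show "g ` (ginv g ` T) = T"
    unfolding t(2) tile_mul[OF ginv_closed[OF g] t(1), symmetric]
      tile_mul[OF g mul_closed[OF ginv_closed[OF g] t(1)], symmetric] mul_ginv_mul[OF g t(1)] ..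
  show "ginv g ` (g ` T) = T"
    unfolding t(2) tile_mul[OF g t(1), symmetric]
      tile_mul[OF ginv_closed[OF g] mul_closed[OF g t(1)], symmetric] ginv_mul_mul[OF g t(1)] ..
qed

text \<open>Left translations are automorphisms of the dual graph and act transitively on the
  tiles.\<close>

lemma card_graph_ball_tile:
  assumes g: "g \<in> \<Gamma>"
  shows "card (graph_ball tiles (edges) (tile g) r) = card (graph_ball tiles (edges) (tile unit) r)"
proof -
  let ?B = "\<lambda>A. graph_ball tiles (edges) A r"
  have sub: "?B A \<subseteq> tiles" for A by (auto simp: graph_ball_def)
  have "bij_betw (\<lambda>T. g ` T) (?B (tile unit)) (?B (tile g))"
  proof (rule bij_betw_byWitness[of _ "\<lambda>T. ginv g ` T"])
    show "\<forall>T\<in>?B (tile unit). ginv g ` (g ` T) = T"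
      by (rule ballI, rule image_ginv_tile(2)[OF g subsetD[OF sub]])
    show "\<forall>T\<in>?B (tile g). g ` (ginv g ` T) = T"
      by (rule ballI, rule image_ginv_tile(1)[OF g subsetD[OF sub]])
    show "(\<lambda>T. g ` T) ` ?B (tile unit) \<subseteq> ?B (tile g)"
      using graph_ball_image_subset[OF g, of "tile unit" r] unfolding tile_eq_image[OF g, symmetric] .
    have "ginv g ` tile g = tile unit"
      unfolding tile_eq_image[OF g] using image_ginv_tile(2)[OF g] unit_closed by blast
    then show "(\<lambda>T. ginv g ` T) ` ?B (tile g) \<subseteq> ?B (tile unit)"
      using graph_ball_image_subset[OF ginv_closed[OF g], of "tile g" r] by simp
  qed
  then show ?thesis by (metis bij_betw_same_card)
qed

lemma neighbours_tile:
  assumes g: "g \<in> \<Gamma>"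
  shows "edges `` {tile g} = tile ` {h. adjacent g h}"
proof
  show "tile ` {h. adjacent g h} \<subseteq> edges `` {tile g}" unfolding dual_edges_tiles by blast
  show "edges `` {tile g} \<subseteq> tile ` {h. adjacent g h}"
  proof
    fix B assume "B \<in> edges `` {tile g}"
    then obtain a b where ab: "tile g = tile a" "B = tile b" "adjacent a b" unfolding dual_edges_tiles by blast
    then have "a \<in> \<Gamma>" unfolding adjacent_def by blast
    then have "g = a" using tile_inj[OF g _ ab(1)] by blast
    then show "B \<in> tile ` {h. adjacent g h}" using ab by blast
  qed
qed

text \<open>The set is the translate by \<open>g\<close> of all tiles at the ridge point
  \<open>x\<close>. By \<open>two_adjacent_tiles\<close> each tile at \<open>x\<close> has two
  neighbours at \<open>x\<close>, and translation preserves adjacency.\<close>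

lemma tiles_core:
  assumes fat: "fat_ridge x m n u v" and g: "g \<in> \<Gamma>" and fin: "finite {h. adjacent unit h}"
  shows "\<exists>C. tile g \<in> C \<and> finite C \<and> card C \<le> 25 * (card {h. adjacent unit h})\<^sup>2 \<and>
    (\<forall>c\<in>C. \<exists>w1 w2. w1 \<noteq> w2 \<and> w1 \<in> C \<and> w2 \<in> C \<and> (c, w1) \<in> edges \<and> (c, w2) \<in> edges)"
proof -
  obtain a b where ab: "a \<in> \<Gamma>" "b \<in> \<Gamma>" "a \<noteq> unit" "b \<noteq> unit" "a \<noteq> b" "x \<in> tile a" "x \<in> tile b"
    using fat unfolding fat_ridge_def by blast
  have x: "x \<in> tile unit" "x \<in> hyp_space" using fat_x[OF fat] by blast+
  let ?V = "{h \<in> \<Gamma>. x \<in> tile h}"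
  let ?C = "(\<lambda>h. tile (g \<odot> h)) ` ?V"
  have finV: "finite ?V" by (rule finite_tiles_at[OF x(2)])
  have 1: "tile g \<in> ?C" using x(1) unit_closed mul_unit[OF g] by (intro image_eqI[of _ _ unit]) auto
  have 2: "finite ?C" using finV by (rule finite_imageI)
  have 3: "card ?C \<le> 25 * (card {h. adjacent unit h})\<^sup>2"
    using card_image_le[OF finV] card_tiles_at[OF fat fin] le_trans by blast
  have "\<exists>w1 w2. w1 \<noteq> w2 \<and> w1 \<in> ?C \<and> w2 \<in> ?C \<and> (c, w1) \<in> edges \<and> (c, w2) \<in> edges"
    if c: "c \<in> ?C" for c
  proof -
    obtain h where h: "h \<in> \<Gamma>" "x \<in> tile h" "c = tile (g \<odot> h)" using c by blast
    obtain h1 h2 where hh: "h1 \<noteq> h2" "x \<in> tile h1" "x \<in> tile h2" "adjacent h h1" "adjacent h h2"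
      using two_adjacent_tiles[OF h(1,2) unit_closed ab(1,2) ab(3,4)[symmetric] ab(5) x(1) ab(6,7)] by blast
    have hG: "h1 \<in> \<Gamma>" "h2 \<in> \<Gamma>" using hh unfolding adjacent_def by blast+
    have e: "(c, tile (g \<odot> h')) \<in> edges" if "h' \<in> \<Gamma>" "adjacent h h'" for h'
      unfolding h(3) dual_edges_tile[OF mul_closed[OF g h(1)] mul_closed[OF g that(1)]]
      using adjacent_mul_iff[OF g h(1) that(1)] that(2) by blast
    have "tile (g \<odot> h1) \<noteq> tile (g \<odot> h2)"
      using tile_inj[OF mul_closed[OF g hG(1)] mul_closed[OF g hG(2)]] ginv_mul_mul[OF g] hG hh(1) by metis
    moreover have "tile (g \<odot> h1) \<in> ?C" "tile (g \<odot> h2) \<in> ?C" using hG hh(2,3) by blast+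
    ultimately show ?thesis using e[OF hG(1) hh(4)] e[OF hG(2) hh(5)]
      by (intro exI[of _ "tile (g \<odot> h1)"] exI[of _ "tile (g \<odot> h2)"] conjI)
  qed
  then show ?thesis using 1 2 3 by (intro exI[of _ ?C] conjI ballI)
qed

lemma growth_rate_tiles:
  assumes d: "3 \<le> DIM('a)" and D: "fundamental_set \<Gamma> D" "emeasure hvol D < \<infinity>"
    and fin: "finite (hfacets (tile unit))" and k: "card (hfacets (tile unit)) = k" and T: "T \<in> tiles"
  shows "3 \<le> k" "growth_rate tiles (edges) T \<le> root (25 * k\<^sup>2) (real ((k - 1) ^ (25 * k\<^sup>2) - 1))"
proof -
  note adj = card_adjacent[OF fin, unfolded k]
  have finA: "finite {h. adjacent unit h}" by (rule adj(1)[OF unit_closed])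
  have hull: "polyhedron_hull \<subseteq> cball 0 1" by (rule polyhedron_hull_subset_cball[OF finA d D])
  have "3 \<le> card {h. adjacent unit h}" by (rule card_adjacent_ge_3[OF finA d hull])
  then show k3: "3 \<le> k" using adj(2)[OF unit_closed] by simp
  obtain x m n u v where fat: "fat_ridge x m n u v" by (rule fat_ridge_exists[OF finA d hull])
  obtain t where t: "t \<in> \<Gamma>" "T = tile t" using T by blast
  interpret bounded_degree_graph "edges" k
  proof
    show "sym (edges)" unfolding dual_edges_tiles sym_def using adjacent_sym by blast
    show "3 \<le> k" by (rule k3)
    fix A
    have nb: "finite (edges `` {A}) \<and> card (edges `` {A}) \<le> k"
    proof (cases "A \<in> tiles")
      case True
      then obtain g where g: "g \<in> \<Gamma>" "A = tile g" by blast
      show ?thesis unfolding g(2) neighbours_tile[OF g(1)]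
        using adj[OF g(1)] card_image_le[OF adj(1)[OF g(1)], of tile] by simp
    next
      case False
      then have "edges `` {A} = {}" by (auto simp: dual_edges_def)
      then show ?thesis by simp
    qed
    then show "finite (edges `` {A})" "card (edges `` {A}) \<le> k" by blast+
  qed
  have le: "25 * (card {h. adjacent unit h})\<^sup>2 \<le> 25 * k\<^sup>2"
    using adj(2)[OF unit_closed] by (simp add: power_mono)
  show "growth_rate tiles (edges) T \<le> root (25 * k\<^sup>2) (real ((k - 1) ^ (25 * k\<^sup>2) - 1))"
  proof (rule growth_rate_bound[OF _ T])
    show "edges \<subseteq> tiles \<times> tiles" by (auto simp: dual_edges_def)
    show "0 < 25 * k\<^sup>2" using k3 by simp
    show "card (graph_ball tiles (edges) A r) = card (graph_ball tiles (edges) T r)"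
      if A: "A \<in> tiles" for A r
    proof -
      obtain g where "g \<in> \<Gamma>" "A = tile g" using A by blast
      then show ?thesis using card_graph_ball_tile[of g r] card_graph_ball_tile[OF t(1), of r] t(2) by simp
    qed
    fix A assume "A \<in> tiles"
    then obtain g where g: "g \<in> \<Gamma>" "A = tile g" by blast
    show "\<exists>C. A \<in> C \<and> finite C \<and> card C \<le> 25 * k\<^sup>2 \<and>
      (\<forall>c\<in>C. \<exists>w1 w2. w1 \<noteq> w2 \<and> w1 \<in> C \<and> w2 \<in> C \<and> (c, w1) \<in> edges \<and> (c, w2) \<in> edges)"
    proof -
      obtain C where C: "tile g \<in> C" "finite C" "card C \<le> 25 * (card {h. adjacent unit h})\<^sup>2"
        "\<forall>c\<in>C. \<exists>w1 w2. w1 \<noteq> w2 \<and> w1 \<in> C \<and> w2 \<in> C \<and> (c, w1) \<in> edges \<and> (c, w2) \<in> edges"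
        using tiles_core[OF fat g(1) finA] by metis
      show ?thesis unfolding g(2) by (rule exI[of _ C]) (intro conjI C(1,2,4) le_trans[OF C(3) le])
    qed
  qed
qed

end

lemma root_power_minus_one_less:
  assumes "3 \<le> k" "0 < N"
  shows "root N (real ((k - 1) ^ N - 1)) < real k - 1"
proof -
  have "(k - 1) ^ N \<ge> 1" using assms by simp
  then have "real ((k - 1) ^ N - 1) < real (k - 1) ^ N" by (simp add: of_nat_diff)
  then have "root N (real ((k - 1) ^ N - 1)) < root N (real (k - 1) ^ N)" using assms(2) by (rule real_root_less_mono[rotated])
  also have "\<dots> = real (k - 1)" using assms(2) by (simp add: real_root_power_cancel)
  also have "\<dots> = real k - 1" using assms(1) by simp
  finally show ?thesis .
qed

theorem theorem1p1:
  fixes d k :: nat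
  assumes "d = DIM('a::euclidean_space)" and "d > 2"
  shows "\<exists>\<epsilon>::real. \<epsilon> > 0 \<and>
    (\<forall>(\<Gamma> :: ('a \<Rightarrow> 'a) set) P \<T>.
       hyp_lattice \<Gamma> \<longrightarrow>
       dirichlet_polyhedron \<Gamma> P \<longrightarrow>
       finite (hfacets P) \<longrightarrow> card (hfacets P) = k \<longrightarrow>
       \<T> = tiling \<Gamma> P \<longrightarrow>
       (\<forall>T\<in>\<T>. growth_rate \<T> (dual_edges \<T>) T < real k - 1 - \<epsilon>))"
proof -
  define R where "R = root (25 * k\<^sup>2) (real ((k - 1) ^ (25 * k\<^sup>2) - 1))"
  \<comment> \<open>Half the gap between \<open>R\<close> and \<open>k - 1\<close> leaves room for a
    strict inequality. For \<open>k < 3\<close> there is no such polyhedron by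
    \<open>growth_rate_tiles\<close>, so any positive value will do.\<close>
  define \<epsilon> where "\<epsilon> = (if 3 \<le> k then (real k - 1 - R) / 2 else 1)"
  have R: "R < real k - 1" if "3 \<le> k"
    unfolding R_def using that by (intro root_power_minus_one_less) auto
  have \<epsilon>: "0 < \<epsilon>" unfolding \<epsilon>_def using R by auto
  have "growth_rate \<T> (dual_edges \<T>) T < real k - 1 - \<epsilon>"
    if lat: "hyp_lattice \<Gamma>" and dir: "dirichlet_polyhedron \<Gamma> P" and fin: "finite (hfacets P)"
      and card: "card (hfacets P) = k" and til: "\<T> = tiling \<Gamma> P" and T: "T \<in> \<T>"
    for \<Gamma> :: "('a \<Rightarrow> 'a) set" and P \<T> T
  proof -
    obtain p where dp: "p \<in> hyp_space" "{\<gamma> \<in> \<Gamma>. \<gamma> p = p} = {\<one>\<^bsub>Isom\<^esub>}"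
      "P = {x \<in> hyp_space. \<forall>\<gamma>\<in>\<Gamma>. hdist x p \<le> hdist x (\<gamma> p)}"
      using dir unfolding dirichlet_polyhedron_def by blast
    obtain D where D: "fundamental_set \<Gamma> D" "emeasure hvol D < \<infinity>"
      using lat unfolding hyp_lattice_def by blast
    interpret dirichlet_tiling \<Gamma> p
      by (rule dirichlet_tiling.intro) (use lat dp in \<open>auto simp only: hyp_lattice_def\<close>)
    have P: "P = tile unit" unfolding tile_hdist[OF unit_closed] dp(3) unit_p ..
    have \<T>: "\<T> = tile ` \<Gamma>"
      unfolding til tiling_def P by (rule image_cong[OF refl]) (rule tile_eq_image[symmetric])
    have "3 \<le> DIM('a)" using assms by simp
    note g = growth_rate_tiles[OF this D fin[unfolded P] card[unfolded P] T[unfolded \<T>]]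
    have "growth_rate \<T> (dual_edges \<T>) T \<le> R" unfolding \<T> R_def by (rule g(2))
    moreover have "R < real k - 1 - \<epsilon>" using R[OF g(1)] g(1) by (simp add: \<epsilon>_def field_simps)
    ultimately show ?thesis by simp
  qed
  then show ?thesis using \<epsilon> by blast
qed

end
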